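(* Let $(\mathcal{C},\mathbb{E},\mathfrak{s})$ be an extriangulated category satisfying Condition (WIC), and let $\xi$ be a proper class of $\mathbb{E}$-triangles such that $\mathcal{C}$ has enough $\xi$-projectives and enough $\xi$-injectives. Suppose that $\sup\{\xi\text{-}\mathcal G\mathrm{pd}\,M\mid M\in\mathcal C\}<\infty$. Let $n\geqslant0$ be an integer. Then for any object $N\in\mathbf{Res}(\mathcal{GI}(\xi))\cap\widehat{\mathcal{GI}}(\xi)$, the following are equivalent: (1) $\xi\text{-}\mathcal G\mathrm{id}\,N\leqslant n$. (2) $\xi\mathrm{xt}^{n+i}_{\mathcal{GI}(\xi)}(M,N)=0$ for all $i\geqslant1$ and all $M\in\mathcal C$. (3) $\xi\mathrm{xt}^{n+i}_{\mathcal{GI}(\xi)}(I,N)=0$ for all $i\geqslant1$ and all $I\in\mathcal I(\xi)$.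
   Context: Extriangulated category: an additive category $\mathcal C$ with (ET1) a biadditive functor $\mathbb E:\mathcal C^{op}\times\mathcal C\to\mathbf{Ab}$ and a correspondence $\mathfrak s$ sending each $\delta\in\mathbb E(C,A)$ to a class $[A\xrightarrow{x}B\xrightarrow{y}C]$ of sequences modulo isomorphisms that are the identity on $A$ and $C$. Write $a_*\delta=\mathbb E(C,a)(\delta)$, $c^*\delta=\mathbb E(c,A)(\delta)$; a morphism from $\delta\in\mathbb E(C,A)$ to $\delta'\in\mathbb E(C',A')$ is a pair $(a:A\to A',c:C\to C')$ with $a_*\delta=c^*\delta'$. Axioms: (ET2) every morphism $(a,c)$ of extensions is realized by some $b$ making both squares between the realizing sequences commute, $\mathfrak s(0)=[A\to A\oplus C\to C]$, and $\mathfrak s(\delta\oplus\delta')=\mathfrak s(\delta)\oplus\mathfrak s(\delta')$; (ET3) if $\mathfrak s(\delta)=[A\xrightarrow{x}B\xrightarrow{y}C]$, $\mathfrak s(\delta')=[A'\xrightarrow{x'}B'\xrightarrow{y'}C']$ and $bx=x'a$, there is $c$ with $cy=y'b$ and $(a,c):\delta\to\delta'$ a morphism; (ET4) if $\delta\in\mathbb E(D,A)$, $\delta'\in\mathbb E(F,B)$ are realized by $A\xrightarrow{f}B\xrightarrow{f'}D$ and $B\xrightarrow{g}C\xrightarrow{g'}F$, there are an object $E$, $\delta''\in\mathbb E(E,A)$ realized by $A\xrightarrow{gf}C\xrightarrow{h'}E$, and $D\xrightarrow{d}E\xrightarrow{e}F$ realizing $f'_*\delta'$, with $h'g=df'$,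 $eh'=g'$, $d^*\delta''=\delta$, $f_*\delta''=e^*\delta'$; and the duals (ET3)$^{op}$, (ET4)$^{op}$. If $\mathfrak s(\delta)=[A\xrightarrow{x}B\xrightarrow{y}C]$, then $A\xrightarrow{x}B\xrightarrow{y}C\overset{\delta}{\dashrightarrow}$ is called an $\mathbb E$-triangle, $x$ an inflation, $y$ a deflation; it is split if $\delta=0$. Condition (WIC): for composable $f,g$, if $gf$ is an inflation so is $f$; if $gf$ is a deflation so is $g$. Proper class: a class $\xi$ of $\mathbb E$-triangles closed under isomorphisms such that (1) $\xi$ contains the split $\mathbb E$-triangles and is closed under finite coproducts; (2) if $A\to B\to C\overset{\delta}{\dashrightarrow}$ is in $\xi$, so is every $\mathbb E$-triangle realizing $c^*\delta$ or $a_*\delta$, for any $c:C'\to C$, $a:A\to A'$; (3) (saturated) for $\mathbb E$-triangles $A_i\xrightarrow{x_i}B_i\xrightarrow{y_i}C\overset{\delta_i}{\dashrightarrow}$, $i=1,2$, if the second one and the $\mathbb E$-triangle $A_1\to M\to B_2\overset{y_2^*\delta_1}{\dashrightarrow}$ are in $\xi$, then the first one is in $\xi$. $P$ is $\xi$-projective if $0\to\mathcal C(P,A)\to\mathcal C(P,B)\to\mathcal C(P,C)\to0$ is exact for every $\mathbb E$-triangle $A\to B\to C\dashrightarrow$ in $\xi$; $I$ is $\xi$-injective if $0\to\mathcal C(C,I)\to\mathcal C(B,I)\to\mathcal C(A,I)\to0$ is exact for all such. $\mathcal P(\xi)$, $\mathcal I(\xi)$ denote the corresponding classes. Enough $\xi$-projectives: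 each $A$ admits an $\mathbb E$-triangle $K\to P\to A\dashrightarrow$ in $\xi$ with $P\in\mathcal P(\xi)$; enough $\xi$-injectives: each $A$ admits $A\to I\to K\dashrightarrow$ in $\xi$ with $I\in\mathcal I(\xi)$. For a class $\mathcal W$, an $\mathbb E$-triangle $A\to B\to C\dashrightarrow$ in $\xi$ is $\mathcal C(\mathcal W,-)$-exact if $0\to\mathcal C(W,A)\to\mathcal C(W,B)\to\mathcal C(W,C)\to0$ is exact for all $W\in\mathcal W$, and $\mathcal C(-,\mathcal W)$-exact if $0\to\mathcal C(C,W)\to\mathcal C(B,W)\to\mathcal C(A,W)\to0$ is exact for all $W\in\mathcal W$. A complex $\cdots\to X_1\xrightarrow{d_1}X_0\xrightarrow{d_0}X_{-1}\to\cdots$ is $\xi$-exact if there are $\mathbb E$-triangles $K_{n+1}\xrightarrow{g_n}X_n\xrightarrow{f_n}K_n\dashrightarrow$ in $\xi$ (resolution $\mathbb E$-triangles) with $d_n=g_{n-1}f_n$ for all $n$. A complete $\xi$-projective resolution is a $\xi$-exact complex of $\xi$-projectives whose resolution $\mathbb E$-triangles are $\mathcal C(-,\mathcal P(\xi))$-exact; the objects $K_n$ occurring are called $\xi$-$\mathcal G$projective, forming $\mathcal{GP}(\xi)$. Dually ($\xi$-exact complexes of $\xi$-injectives with $\mathcal C(\mathcal I(\xi),-)$-exact resolution $\mathbb E$-triangles) one defines $\xi$-$\mathcal G$injective objects, forming $\mathcal{GI}(\xi)$. $\xi\text{-}\mathcal G\mathrm{pd}$ is defined inductively: $\xi\text{-}\mathcal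 G\mathrm{pd}\,0=-1$; it is $0$ for nonzero objects of $\mathcal{GP}(\xi)$; $\xi\text{-}\mathcal G\mathrm{pd}A\leqslant n$ if there is an $\mathbb E$-triangle $K\to G\to A\dashrightarrow$ in $\xi$ with $G\in\mathcal{GP}(\xi)$ and $\xi\text{-}\mathcal G\mathrm{pd}K\leqslant n-1$; $\infty$ if no such $n$. $\xi\text{-}\mathcal G\mathrm{id}$ is defined dually via $\mathbb E$-triangles $A\to Q\to L\dashrightarrow$ in $\xi$ with $Q\in\mathcal{GI}(\xi)$. $\widehat{\mathcal{GI}}(\xi)$ is the full subcategory of objects of finite $\xi\text{-}\mathcal G\mathrm{id}$. A proper $\xi$-$\mathcal G$injective coresolution of $B$ is a $\xi$-exact complex $0\to B\to H^0\to H^1\to\cdots$ with all $H^i\in\mathcal{GI}(\xi)$ whose resolution $\mathbb E$-triangles $L^i\to H^i\to L^{i+1}\dashrightarrow$ ($L^0=B$) are $\mathcal C(-,\mathcal{GI}(\xi))$-exact; its deleted complex $\mathbf H_\sharp$ is $0\to H^0\to H^1\to\cdots$. $\mathbf{Res}(\mathcal{GI}(\xi))$ is the full subcategory of objects having a proper $\xi$-$\mathcal G$injective coresolution. For $B\in\mathbf{Res}(\mathcal{GI}(\xi))$ and any $A$, $\xi\mathrm{xt}^n_{\mathcal{GI}(\xi)}(A,B):=H^n(\mathcal C(A,\mathbf H_\sharp))$, independent of the choice of coresolution up to isomorphism. *)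

theory Defs
  imports "HOL-Algebra.Exact_Sequence" "HOL-Library.Extended_Real"
begin

section \<open>Additive categories\<close>

text \<open>
  The objects are all elements of the type \<open>'o\<close> (an additive category has a zero object, so its
  class of objects is nonempty).  The abelian groups \<open>\<C>(A,B)\<close> are groups in the sense of
  \<^theory>\<open>HOL-Algebra.Group\<close>, hence written multiplicatively: \<open>\<otimes>\<close> is the addition of morphisms
  and \<open>\<one>\<close> the zero morphism.  Hom-sets are not required to be disjoint; objects are given
  explicitly wherever they matter.
\<close>

record ('o, 'm) additive_data =
  Hom :: "'o \<Rightarrow> 'o \<Rightarrow> 'm monoid"
  idm :: "'o \<Rightarrow> 'm"
  cmp :: "'m \<Rightarrow> 'm \<Rightarrow> 'm"  (infixr \<open>\<circledcirc>\<index>\<close> 75)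

abbreviation arr :: "('o, 'm, 'z) additive_data_scheme \<Rightarrow> 'o \<Rightarrow> 'o \<Rightarrow> 'm set" where
  "arr \<C> A B \<equiv> carrier (Hom \<C> A B)"

abbreviation zero_arr :: "('o, 'm, 'z) additive_data_scheme \<Rightarrow> 'o \<Rightarrow> 'o \<Rightarrow> 'm" where
  "zero_arr \<C> A B \<equiv> \<one>\<^bsub>Hom \<C> A B\<^esub>"

definition is_zero :: "('o, 'm, 'z) additive_data_scheme \<Rightarrow> 'o \<Rightarrow> bool" where
  "is_zero \<C> Z \<longleftrightarrow> (\<forall>A. trivial_group (Hom \<C> A Z) \<and> trivial_group (Hom \<C> Z A))"

definition isos :: "('o, 'm, 'z) additive_data_scheme \<Rightarrow> 'o \<Rightarrow> 'o \<Rightarrow> 'm set" where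
  "isos \<C> A B = {f \<in> arr \<C> A B. \<exists>g \<in> arr \<C> B A. g \<circledcirc>\<^bsub>\<C>\<^esub> f = idm \<C> A \<and> f \<circledcirc>\<^bsub>\<C>\<^esub> g = idm \<C> B}"

definition biproduct ::
  "('o, 'm, 'z) additive_data_scheme \<Rightarrow> 'o \<Rightarrow> 'o \<Rightarrow> 'o \<Rightarrow> 'm \<Rightarrow> 'm \<Rightarrow> 'm \<Rightarrow> 'm \<Rightarrow> bool" where
  "biproduct \<C> A B S i j p q \<longleftrightarrow>
     i \<in> arr \<C> A S \<and> j \<in> arr \<C> B S \<and> p \<in> arr \<C> S A \<and> q \<in> arr \<C> S B \<and>
     p \<circledcirc>\<^bsub>\<C>\<^esub> i = idm \<C> A \<and> q \<circledcirc>\<^bsub>\<C>\<^esub> j = idm \<C> B \<and>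
     p \<circledcirc>\<^bsub>\<C>\<^esub> j = zero_arr \<C> B A \<and> q \<circledcirc>\<^bsub>\<C>\<^esub> i = zero_arr \<C> A B \<and>
     (i \<circledcirc>\<^bsub>\<C>\<^esub> p) \<otimes>\<^bsub>Hom \<C> S S\<^esub> (j \<circledcirc>\<^bsub>\<C>\<^esub> q) = idm \<C> S"

locale additive_category =
  fixes \<C> :: "('o, 'm, 'z) additive_data_scheme" (structure)
  assumes Hom_comm_group: "comm_group (Hom \<C> A B)"
    and idm_closed: "idm \<C> A \<in> arr \<C> A A"
    and cmp_closed: "\<lbrakk>f \<in> arr \<C> A B; g \<in> arr \<C> B D\<rbrakk> \<Longrightarrow> g \<circledcirc> f \<in> arr \<C> A D"
    and cmp_idm_right: "f \<in> arr \<C> A B \<Longrightarrow> f \<circledcirc> idm \<C> A = f"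
    and cmp_idm_left: "f \<in> arr \<C> A B \<Longrightarrow> idm \<C> B \<circledcirc> f = f"
    and cmp_assoc: "\<lbrakk>f \<in> arr \<C> A B; g \<in> arr \<C> B D; h \<in> arr \<C> D E\<rbrakk>
        \<Longrightarrow> (h \<circledcirc> g) \<circledcirc> f = h \<circledcirc> (g \<circledcirc> f)"
    and cmp_add_right: "\<lbrakk>f \<in> arr \<C> A B; f' \<in> arr \<C> A B; g \<in> arr \<C> B D\<rbrakk>
        \<Longrightarrow> g \<circledcirc> (f \<otimes>\<^bsub>Hom \<C> A B\<^esub> f') = (g \<circledcirc> f) \<otimes>\<^bsub>Hom \<C> A D\<^esub> (g \<circledcirc> f')"
    and cmp_add_left: "\<lbrakk>f \<in> arr \<C> A B; g \<in> arr \<C> B D; g' \<in> arr \<C> B D\<rbrakk>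
        \<Longrightarrow> (g \<otimes>\<^bsub>Hom \<C> B D\<^esub> g') \<circledcirc> f = (g \<circledcirc> f) \<otimes>\<^bsub>Hom \<C> A D\<^esub> (g' \<circledcirc> f)"
    and zero_exists: "\<exists>Z. is_zero \<C> Z"
    and biproduct_exists: "\<exists>S i j p q. biproduct \<C> A B S i j p q"


section \<open>Extriangulated categories\<close>

text \<open>
  \<open>\<EE> \<C> C A\<close> is the group \<open>\<EE>(C,A)\<close>, again in multiplicative notation, so that \<open>\<one>\<close> is the split
  extension; \<open>Emap \<C> c a\<close> is \<open>\<EE>(c,a)\<close>; and \<open>\<ss> \<C> C A \<delta>\<close> is the equivalence class \<open>\<ss>(\<delta>)\<close> of
  triples \<open>(x,B,y)\<close>, standing for sequences \<open>A \<rightarrow> B \<rightarrow> C\<close>.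
\<close>

record ('o, 'm, 'e) extri_data = "('o, 'm) additive_data" +
  EE :: "'o \<Rightarrow> 'o \<Rightarrow> 'e monoid"  (\<open>\<EE>\<close>)
  Emap :: "'m \<Rightarrow> 'm \<Rightarrow> 'e \<Rightarrow> 'e"
  realization :: "'o \<Rightarrow> 'o \<Rightarrow> 'e \<Rightarrow> ('m \<times> 'o \<times> 'm) set"  (\<open>\<ss>\<close>)

text \<open>\<open>push \<C> C a \<delta>\<close> is \<open>a\<^sub>*\<delta>\<close> and \<open>pull \<C> A c \<delta>\<close> is \<open>c\<^sup>*\<delta>\<close>, for \<open>\<delta> \<in> \<EE>(C,A)\<close>.\<close>

definition push :: "('o, 'm, 'e) extri_data \<Rightarrow> 'o \<Rightarrow> 'm \<Rightarrow> 'e \<Rightarrow> 'e" where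
  "push \<C> C a \<delta> = Emap \<C> (idm \<C> C) a \<delta>"

definition pull :: "('o, 'm, 'e) extri_data \<Rightarrow> 'o \<Rightarrow> 'm \<Rightarrow> 'e \<Rightarrow> 'e" where
  "pull \<C> A c \<delta> = Emap \<C> c (idm \<C> A) \<delta>"

definition seqs :: "('o, 'm, 'z) additive_data_scheme \<Rightarrow> 'o \<Rightarrow> 'o \<Rightarrow> ('m \<times> 'o \<times> 'm) set" where
  "seqs \<C> A C = {(x, B, y). x \<in> arr \<C> A B \<and> y \<in> arr \<C> B C}"

definition seq_equiv ::
  "('o, 'm, 'z) additive_data_scheme \<Rightarrow> 'o \<Rightarrow> 'o \<Rightarrow> (('m \<times> 'o \<times> 'm) \<times> ('m \<times> 'o \<times> 'm)) set" where
  "seq_equiv \<C> A C = {((x, B, y), (x', B', y')).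
     (x, B, y) \<in> seqs \<C> A C \<and> (x', B', y') \<in> seqs \<C> A C \<and>
     (\<exists>b \<in> isos \<C> B B'. b \<circledcirc>\<^bsub>\<C>\<^esub> x = x' \<and> y' \<circledcirc>\<^bsub>\<C>\<^esub> b = y)}"

text \<open>The tuple \<open>(A, x, B, y, C, \<delta>)\<close> stands for \<open>A \<rightarrow> B \<rightarrow> C\<close> together with \<open>\<delta> \<in> \<EE>(C,A)\<close>.\<close>

type_synonym ('o, 'm, 'e) triangle = "'o \<times> 'm \<times> 'o \<times> 'm \<times> 'o \<times> 'e"

definition Etriangles :: "('o, 'm, 'e) extri_data \<Rightarrow> ('o, 'm, 'e) triangle set" where
  "Etriangles \<C> = {(A, x, B, y, C, \<delta>).
     \<delta> \<in> carrier (\<EE> \<C> C A) \<and> (x, B, y) \<in> seqs \<C> A C \<and>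
     \<ss> \<C> C A \<delta> = seq_equiv \<C> A C `` {(x, B, y)}}"

text \<open>
  \<open>is_dsum \<C> t t' u\<close>: \<open>u\<close> is a direct sum of \<open>t\<close> and \<open>t'\<close>, for some choice of biproducts of the
  three pairs of objects.  The extension of \<open>u\<close> is the element \<open>\<delta> \<oplus> \<delta>'\<close> of \<open>\<EE>(C \<oplus> C', A \<oplus> A')\<close>
  corresponding to \<open>(\<delta>, 0, 0, \<delta>')\<close> under the decomposition given by biadditivity.
\<close>

fun is_dsum :: "('o, 'm, 'e) extri_data \<Rightarrow> ('o, 'm, 'e) triangle \<Rightarrow> ('o, 'm, 'e) triangle
    \<Rightarrow> ('o, 'm, 'e) triangle \<Rightarrow> bool" where
  "is_dsum \<C> (A, x, B, y, C, \<delta>) (A', x', B', y', C', \<delta>') (SA, X, SB, Y, SC, \<Delta>) \<longleftrightarrow>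
    (\<exists>iA iA' pA pA' iB iB' pB pB' iC iC' pC pC'.
       biproduct \<C> A A' SA iA iA' pA pA' \<and>
       biproduct \<C> B B' SB iB iB' pB pB' \<and>
       biproduct \<C> C C' SC iC iC' pC pC' \<and>
       X = (iB \<circledcirc>\<^bsub>\<C>\<^esub> x \<circledcirc>\<^bsub>\<C>\<^esub> pA) \<otimes>\<^bsub>Hom \<C> SA SB\<^esub> (iB' \<circledcirc>\<^bsub>\<C>\<^esub> x' \<circledcirc>\<^bsub>\<C>\<^esub> pA') \<and>
       Y = (iC \<circledcirc>\<^bsub>\<C>\<^esub> y \<circledcirc>\<^bsub>\<C>\<^esub> pB) \<otimes>\<^bsub>Hom \<C> SB SC\<^esub> (iC' \<circledcirc>\<^bsub>\<C>\<^esub> y' \<circledcirc>\<^bsub>\<C>\<^esub> pB') \<and>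
       \<Delta> = Emap \<C> pC iA \<delta> \<otimes>\<^bsub>\<EE> \<C> SC SA\<^esub> Emap \<C> pC' iA' \<delta>')"

locale extriangulated_category = additive_category \<C>
  for \<C> :: "('o, 'm, 'e) extri_data" (structure) +
  assumes EE_comm_group: "comm_group (\<EE> \<C> C A)"
    and Emap_hom: "\<lbrakk>c \<in> arr \<C> C' C; a \<in> arr \<C> A A'\<rbrakk> \<Longrightarrow> Emap \<C> c a \<in> hom (\<EE> \<C> C A) (\<EE> \<C> C' A')"
    and Emap_idm: "\<delta> \<in> carrier (\<EE> \<C> C A) \<Longrightarrow> Emap \<C> (idm \<C> C) (idm \<C> A) \<delta> = \<delta>"
    and Emap_cmp: "\<lbrakk>c \<in> arr \<C> C' C; c' \<in> arr \<C> C'' C'; a \<in> arr \<C> A A'; a' \<in> arr \<C> A' A'';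
        \<delta> \<in> carrier (\<EE> \<C> C A)\<rbrakk> \<Longrightarrow> Emap \<C> (c \<circledcirc> c') (a' \<circledcirc> a) \<delta> = Emap \<C> c' a' (Emap \<C> c a \<delta>)"
    and push_add: "\<lbrakk>a \<in> arr \<C> A A'; a' \<in> arr \<C> A A'; \<delta> \<in> carrier (\<EE> \<C> C A)\<rbrakk>
        \<Longrightarrow> push \<C> C (a \<otimes>\<^bsub>Hom \<C> A A'\<^esub> a') \<delta> = push \<C> C a \<delta> \<otimes>\<^bsub>\<EE> \<C> C A'\<^esub> push \<C> C a' \<delta>"
    and pull_add: "\<lbrakk>c \<in> arr \<C> C' C; c' \<in> arr \<C> C' C; \<delta> \<in> carrier (\<EE> \<C> C A)\<rbrakk>
        \<Longrightarrow> pull \<C> A (c \<otimes>\<^bsub>Hom \<C> C' C\<^esub> c') \<delta> = pull \<C> A c \<delta> \<otimes>\<^bsub>\<EE> \<C> C' A\<^esub> pull \<C> A c' \<delta>"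
    and realization_class:
      "\<delta> \<in> carrier (\<EE> \<C> C A) \<Longrightarrow> \<ss> \<C> C A \<delta> \<in> seqs \<C> A C // seq_equiv \<C> A C"
    and ET2_morphism:
      "\<lbrakk>(A, x, B, y, C, \<delta>) \<in> Etriangles \<C>; (A', x', B', y', C', \<delta>') \<in> Etriangles \<C>;
        a \<in> arr \<C> A A'; c \<in> arr \<C> C C'; push \<C> C a \<delta> = pull \<C> A' c \<delta>'\<rbrakk>
       \<Longrightarrow> \<exists>b \<in> arr \<C> B B'. b \<circledcirc> x = x' \<circledcirc> a \<and> y' \<circledcirc> b = c \<circledcirc> y"
    and ET2_zero:
      "biproduct \<C> A C S i j p q \<Longrightarrow> (A, i, S, q, C, \<one>\<^bsub>\<EE> \<C> C A\<^esub>) \<in> Etriangles \<C>"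
    and ET2_dsum:
      "\<lbrakk>t \<in> Etriangles \<C>; t' \<in> Etriangles \<C>; is_dsum \<C> t t' u\<rbrakk> \<Longrightarrow> u \<in> Etriangles \<C>"
    and ET3:
      "\<lbrakk>(A, x, B, y, C, \<delta>) \<in> Etriangles \<C>; (A', x', B', y', C', \<delta>') \<in> Etriangles \<C>;
        a \<in> arr \<C> A A'; b \<in> arr \<C> B B'; b \<circledcirc> x = x' \<circledcirc> a\<rbrakk>
       \<Longrightarrow> \<exists>c \<in> arr \<C> C C'. c \<circledcirc> y = y' \<circledcirc> b \<and> push \<C> C a \<delta> = pull \<C> A' c \<delta>'"
    and ET3_op:
      "\<lbrakk>(A, x, B, y, C, \<delta>) \<in> Etriangles \<C>; (A', x', B', y', C', \<delta>') \<in> Etriangles \<C>;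
        b \<in> arr \<C> B B'; c \<in> arr \<C> C C'; c \<circledcirc> y = y' \<circledcirc> b\<rbrakk>
       \<Longrightarrow> \<exists>a \<in> arr \<C> A A'. b \<circledcirc> x = x' \<circledcirc> a \<and> push \<C> C a \<delta> = pull \<C> A' c \<delta>'"
    and ET4:
      "\<lbrakk>(A, f, B, f', D, \<delta>) \<in> Etriangles \<C>; (B, g, C, g', F, \<delta>') \<in> Etriangles \<C>\<rbrakk>
       \<Longrightarrow> \<exists>E \<delta>'' h' d e.
             (A, g \<circledcirc> f, C, h', E, \<delta>'') \<in> Etriangles \<C> \<and>
             (D, d, E, e, F, push \<C> F f' \<delta>') \<in> Etriangles \<C> \<and>
             h' \<circledcirc> g = d \<circledcirc> f' \<and> e \<circledcirc> h' = g' \<and>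
             pull \<C> A d \<delta>'' = \<delta> \<and> push \<C> E f \<delta>'' = pull \<C> B e \<delta>'"
    and ET4_op:
      "\<lbrakk>(D, f', B, f, A, \<delta>) \<in> Etriangles \<C>; (F, g', C, g, B, \<delta>') \<in> Etriangles \<C>\<rbrakk>
       \<Longrightarrow> \<exists>E \<delta>'' h' d e.
             (E, h', C, f \<circledcirc> g, A, \<delta>'') \<in> Etriangles \<C> \<and>
             (F, e, E, d, D, pull \<C> F f' \<delta>') \<in> Etriangles \<C> \<and>
             g \<circledcirc> h' = f' \<circledcirc> d \<and> h' \<circledcirc> e = g' \<and>
             push \<C> A d \<delta>'' = \<delta> \<and> pull \<C> E f \<delta>'' = push \<C> B e \<delta>'"

definition inflation :: "('o, 'm, 'e) extri_data \<Rightarrow> 'o \<Rightarrow> 'o \<Rightarrow> 'm \<Rightarrow> bool" where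
  "inflation \<C> A B x \<longleftrightarrow> (\<exists>y C \<delta>. (A, x, B, y, C, \<delta>) \<in> Etriangles \<C>)"

definition deflation :: "('o, 'm, 'e) extri_data \<Rightarrow> 'o \<Rightarrow> 'o \<Rightarrow> 'm \<Rightarrow> bool" where
  "deflation \<C> B C y \<longleftrightarrow> (\<exists>A x \<delta>. (A, x, B, y, C, \<delta>) \<in> Etriangles \<C>)"

definition WIC :: "('o, 'm, 'e) extri_data \<Rightarrow> bool" where
  "WIC \<C> \<longleftrightarrow> (\<forall>A B C f g. f \<in> arr \<C> A B \<longrightarrow> g \<in> arr \<C> B C \<longrightarrow>
     (inflation \<C> A C (g \<circledcirc>\<^bsub>\<C>\<^esub> f) \<longrightarrow> inflation \<C> A B f) \<and>
     (deflation \<C> A C (g \<circledcirc>\<^bsub>\<C>\<^esub> f) \<longrightarrow> deflation \<C> B C g))"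


section \<open>Proper classes\<close>

fun triangle_iso ::
  "('o, 'm, 'e) extri_data \<Rightarrow> ('o, 'm, 'e) triangle \<Rightarrow> ('o, 'm, 'e) triangle \<Rightarrow> bool" where
  "triangle_iso \<C> (A, x, B, y, C, \<delta>) (A', x', B', y', C', \<delta>') \<longleftrightarrow>
    (\<exists>a \<in> isos \<C> A A'. \<exists>b \<in> isos \<C> B B'. \<exists>c \<in> isos \<C> C C'.
       b \<circledcirc>\<^bsub>\<C>\<^esub> x = x' \<circledcirc>\<^bsub>\<C>\<^esub> a \<and> c \<circledcirc>\<^bsub>\<C>\<^esub> y = y' \<circledcirc>\<^bsub>\<C>\<^esub> b \<and> push \<C> C a \<delta> = pull \<C> A' c \<delta>')"

locale proper_class = extriangulated_category \<C>
  for \<C> :: "('o, 'm, 'e) extri_data" (structure) +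
  fixes \<xi> :: "('o, 'm, 'e) triangle set"
  assumes subset_Etriangles: "\<xi> \<subseteq> Etriangles \<C>"
    and iso_closed: "\<lbrakk>t \<in> \<xi>; t' \<in> Etriangles \<C>; triangle_iso \<C> t t'\<rbrakk> \<Longrightarrow> t' \<in> \<xi>"
    and split_in: "(A, x, B, y, C, \<one>\<^bsub>\<EE> \<C> C A\<^esub>) \<in> Etriangles \<C>
        \<Longrightarrow> (A, x, B, y, C, \<one>\<^bsub>\<EE> \<C> C A\<^esub>) \<in> \<xi>"
    and dsum_closed: "\<lbrakk>t \<in> \<xi>; t' \<in> \<xi>; is_dsum \<C> t t' u\<rbrakk> \<Longrightarrow> u \<in> \<xi>"
    and base_change: "\<lbrakk>(A, x, B, y, C, \<delta>) \<in> \<xi>; c \<in> arr \<C> C' C;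
        (A, x', B', y', C', pull \<C> A c \<delta>) \<in> Etriangles \<C>\<rbrakk>
       \<Longrightarrow> (A, x', B', y', C', pull \<C> A c \<delta>) \<in> \<xi>"
    and cobase_change: "\<lbrakk>(A, x, B, y, C, \<delta>) \<in> \<xi>; a \<in> arr \<C> A A';
        (A', x', B', y', C, push \<C> C a \<delta>) \<in> Etriangles \<C>\<rbrakk>
       \<Longrightarrow> (A', x', B', y', C, push \<C> C a \<delta>) \<in> \<xi>"
    and saturated: "\<lbrakk>(A1, x1, B1, y1, C, \<delta>1) \<in> Etriangles \<C>; (A2, x2, B2, y2, C, \<delta>2) \<in> \<xi>;
        (A1, m, M, m', B2, pull \<C> A1 y2 \<delta>1) \<in> \<xi>\<rbrakk>
       \<Longrightarrow> (A1, x1, B1, y1, C, \<delta>1) \<in> \<xi>"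


section \<open>Relative projective and injective objects\<close>

text \<open>
  Exactness of \<open>0 \<rightarrow> \<C>(W,A) \<rightarrow> \<C>(W,B) \<rightarrow> \<C>(W,C) \<rightarrow> 0\<close>, respectively of
  \<open>0 \<rightarrow> \<C>(C,W) \<rightarrow> \<C>(B,W) \<rightarrow> \<C>(A,W) \<rightarrow> 0\<close>.  The library's \<^const>\<open>short_exact_sequence\<close> lists
  groups and maps from right to left.
\<close>

fun exact_from :: "('o, 'm, 'e) extri_data \<Rightarrow> 'o \<Rightarrow> ('o, 'm, 'e) triangle \<Rightarrow> bool" where
  "exact_from \<C> W (A, x, B, y, C, \<delta>) \<longleftrightarrow>
     short_exact_sequence (Hom \<C> W C) (Hom \<C> W B) (Hom \<C> W A) (\<lambda>u. y \<circledcirc>\<^bsub>\<C>\<^esub> u) (\<lambda>u. x \<circledcirc>\<^bsub>\<C>\<^esub> u)"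

fun exact_into :: "('o, 'm, 'e) extri_data \<Rightarrow> 'o \<Rightarrow> ('o, 'm, 'e) triangle \<Rightarrow> bool" where
  "exact_into \<C> W (A, x, B, y, C, \<delta>) \<longleftrightarrow>
     short_exact_sequence (Hom \<C> A W) (Hom \<C> B W) (Hom \<C> C W) (\<lambda>u. u \<circledcirc>\<^bsub>\<C>\<^esub> x) (\<lambda>u. u \<circledcirc>\<^bsub>\<C>\<^esub> y)"

definition Proj :: "('o, 'm, 'e) extri_data \<Rightarrow> ('o, 'm, 'e) triangle set \<Rightarrow> 'o set" where
  "Proj \<C> \<xi> = {P. \<forall>t \<in> \<xi>. exact_from \<C> P t}"

definition Inj :: "('o, 'm, 'e) extri_data \<Rightarrow> ('o, 'm, 'e) triangle set \<Rightarrow> 'o set" where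
  "Inj \<C> \<xi> = {I. \<forall>t \<in> \<xi>. exact_into \<C> I t}"

definition enough_projectives ::
  "('o, 'm, 'e) extri_data \<Rightarrow> ('o, 'm, 'e) triangle set \<Rightarrow> bool" where
  "enough_projectives \<C> \<xi> \<longleftrightarrow> (\<forall>A. \<exists>K x P y \<delta>. P \<in> Proj \<C> \<xi> \<and> (K, x, P, y, A, \<delta>) \<in> \<xi>)"

definition enough_injectives ::
  "('o, 'm, 'e) extri_data \<Rightarrow> ('o, 'm, 'e) triangle set \<Rightarrow> bool" where
  "enough_injectives \<C> \<xi> \<longleftrightarrow> (\<forall>A. \<exists>x I y K \<delta>. I \<in> Inj \<C> \<xi> \<and> (A, x, I, y, K, \<delta>) \<in> \<xi>)"


section \<open>Relative Gorenstein projective and injective objects\<close>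

text \<open>
  \<open>(K, g, f, \<delta>)\<close> are resolution \<open>\<EE>\<close>-triangles \<open>K\<^bsub>n+1\<^esub> \<rightarrow> X\<^sub>n \<rightarrow> K\<^sub>n\<close> of the complex \<open>(X, d)\<close>, whose
  differential is \<open>d\<^sub>n : X\<^sub>n \<rightarrow> X\<^bsub>n-1\<^esub>\<close>.
\<close>

definition resolution_triangles ::
  "('o, 'm, 'e) extri_data \<Rightarrow> ('o, 'm, 'e) triangle set \<Rightarrow> (int \<Rightarrow> 'o) \<Rightarrow> (int \<Rightarrow> 'm)
   \<Rightarrow> (int \<Rightarrow> 'o) \<Rightarrow> (int \<Rightarrow> 'm) \<Rightarrow> (int \<Rightarrow> 'm) \<Rightarrow> (int \<Rightarrow> 'e) \<Rightarrow> bool" where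
  "resolution_triangles \<C> \<xi> X d K g f \<delta> \<longleftrightarrow>
     (\<forall>n. (K (n + 1), g n, X n, f n, K n, \<delta> n) \<in> \<xi> \<and> d n = g (n - 1) \<circledcirc>\<^bsub>\<C>\<^esub> f n)"

definition GProj :: "('o, 'm, 'e) extri_data \<Rightarrow> ('o, 'm, 'e) triangle set \<Rightarrow> 'o set" where
  "GProj \<C> \<xi> = {A. \<exists>X d K g f \<delta>.
     resolution_triangles \<C> \<xi> X d K g f \<delta> \<and>
     (\<forall>n. X n \<in> Proj \<C> \<xi>) \<and>
     (\<forall>n. \<forall>P \<in> Proj \<C> \<xi>. exact_into \<C> P (K (n + 1), g n, X n, f n, K n, \<delta> n)) \<and>
     (\<exists>n. A = K n)}"

definition GInj :: "('o, 'm, 'e) extri_data \<Rightarrow> ('o, 'm, 'e) triangle set \<Rightarrow> 'o set" where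
  "GInj \<C> \<xi> = {A. \<exists>X d K g f \<delta>.
     resolution_triangles \<C> \<xi> X d K g f \<delta> \<and>
     (\<forall>n. X n \<in> Inj \<C> \<xi>) \<and>
     (\<forall>n. \<forall>I \<in> Inj \<C> \<xi>. exact_from \<C> I (K (n + 1), g n, X n, f n, K n, \<delta> n)) \<and>
     (\<exists>n. A = K n)}"


section \<open>Relative Gorenstein dimensions\<close>

text \<open>
  \<open>Gpd_le \<C> \<xi> k A\<close> is the relation \<open>\<xi>-\<G>pd A \<le> k\<close>.  The first two rules express that the dimension
  is \<open>-1\<close> for zero objects and at most \<open>0\<close> for objects of \<open>\<G>\<P>(\<xi>)\<close>.  The dimension itself is the
  least such \<open>k\<close>, and \<open>\<infinity>\<close> (the infimum of the empty set) if there is none.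
\<close>

inductive Gpd_le ::
  "('o, 'm, 'e) extri_data \<Rightarrow> ('o, 'm, 'e) triangle set \<Rightarrow> int \<Rightarrow> 'o \<Rightarrow> bool"
  for \<C> :: "('o, 'm, 'e) extri_data" and \<xi> :: "('o, 'm, 'e) triangle set" where
  zero: "\<lbrakk>is_zero \<C> A; - 1 \<le> k\<rbrakk> \<Longrightarrow> Gpd_le \<C> \<xi> k A"
| GProj: "\<lbrakk>A \<in> GProj \<C> \<xi>; 0 \<le> k\<rbrakk> \<Longrightarrow> Gpd_le \<C> \<xi> k A"
| step: "\<lbrakk>(K, x, G, y, A, \<delta>) \<in> \<xi>; G \<in> GProj \<C> \<xi>; Gpd_le \<C> \<xi> (k - 1) K\<rbrakk> \<Longrightarrow> Gpd_le \<C> \<xi> k A"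

definition Gpd :: "('o, 'm, 'e) extri_data \<Rightarrow> ('o, 'm, 'e) triangle set \<Rightarrow> 'o \<Rightarrow> ereal" where
  "Gpd \<C> \<xi> A = Inf {ereal (real_of_int k) | k. Gpd_le \<C> \<xi> k A}"

inductive Gid_le ::
  "('o, 'm, 'e) extri_data \<Rightarrow> ('o, 'm, 'e) triangle set \<Rightarrow> int \<Rightarrow> 'o \<Rightarrow> bool"
  for \<C> :: "('o, 'm, 'e) extri_data" and \<xi> :: "('o, 'm, 'e) triangle set" where
  zero: "\<lbrakk>is_zero \<C> A; - 1 \<le> k\<rbrakk> \<Longrightarrow> Gid_le \<C> \<xi> k A"
| GInj: "\<lbrakk>A \<in> GInj \<C> \<xi>; 0 \<le> k\<rbrakk> \<Longrightarrow> Gid_le \<C> \<xi> k A"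
| step: "\<lbrakk>(A, x, Q, y, L, \<delta>) \<in> \<xi>; Q \<in> GInj \<C> \<xi>; Gid_le \<C> \<xi> (k - 1) L\<rbrakk> \<Longrightarrow> Gid_le \<C> \<xi> k A"

definition Gid :: "('o, 'm, 'e) extri_data \<Rightarrow> ('o, 'm, 'e) triangle set \<Rightarrow> 'o \<Rightarrow> ereal" where
  "Gid \<C> \<xi> A = Inf {ereal (real_of_int k) | k. Gid_le \<C> \<xi> k A}"

definition finite_Gid :: "('o, 'm, 'e) extri_data \<Rightarrow> ('o, 'm, 'e) triangle set \<Rightarrow> 'o set" where
  "finite_Gid \<C> \<xi> = {A. Gid \<C> \<xi> A < \<infinity>}"


section \<open>Relative cohomology\<close>

text \<open>
  The complex \<open>0 \<rightarrow> B \<rightarrow> H\<^sup>0 \<rightarrow> H\<^sup>1 \<rightarrow> \<dots>\<close> with coaugmentation \<open>\<epsilon> : B \<rightarrow> H\<^sup>0\<close> and differentials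
  \<open>d\<^sup>i : H\<^sup>i \<rightarrow> H\<^bsup>i+1\<^esup>\<close> is a proper coresolution of \<open>B\<close> by objects of \<open>\<W>\<close>, with resolution
  \<open>\<EE>\<close>-triangles \<open>L\<^sup>i \<rightarrow> H\<^sup>i \<rightarrow> L\<^bsup>i+1\<^esup>\<close>.
\<close>

definition proper_coresolution ::
  "('o, 'm, 'e) extri_data \<Rightarrow> ('o, 'm, 'e) triangle set \<Rightarrow> 'o set \<Rightarrow> 'o
   \<Rightarrow> 'm \<Rightarrow> (nat \<Rightarrow> 'o) \<Rightarrow> (nat \<Rightarrow> 'm) \<Rightarrow> bool" where
  "proper_coresolution \<C> \<xi> \<W> B \<epsilon> H d \<longleftrightarrow>
     (\<forall>i. H i \<in> \<W>) \<and>
     (\<exists>L g f \<delta>. L 0 = B \<and> g 0 = \<epsilon> \<and>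
        (\<forall>i. (L i, g i, H i, f i, L (Suc i), \<delta> i) \<in> \<xi> \<and>
             (\<forall>W \<in> \<W>. exact_into \<C> W (L i, g i, H i, f i, L (Suc i), \<delta> i)) \<and>
             d i = g (Suc i) \<circledcirc>\<^bsub>\<C>\<^esub> f i))"

definition Res_GInj :: "('o, 'm, 'e) extri_data \<Rightarrow> ('o, 'm, 'e) triangle set \<Rightarrow> 'o set" where
  "Res_GInj \<C> \<xi> = {B. \<exists>\<epsilon> H d. proper_coresolution \<C> \<xi> (GInj \<C> \<xi>) B \<epsilon> H d}"

text \<open>The group \<open>H\<^sup>n(\<C>(A, \<^bold>H))\<close> for the complex \<open>\<^bold>H = (0 \<rightarrow> H\<^sup>0 \<rightarrow> H\<^sup>1 \<rightarrow> \<dots>)\<close>.\<close>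

definition hom_cohomology ::
  "('o, 'm, 'e) extri_data \<Rightarrow> 'o \<Rightarrow> (nat \<Rightarrow> 'o) \<Rightarrow> (nat \<Rightarrow> 'm) \<Rightarrow> nat \<Rightarrow> 'm set monoid" where
  "hom_cohomology \<C> A H d n =
     (Hom \<C> A (H n))\<lparr>carrier := kernel (Hom \<C> A (H n)) (Hom \<C> A (H (Suc n))) (\<lambda>u. d n \<circledcirc>\<^bsub>\<C>\<^esub> u)\<rparr>
     Mod (case n of 0 \<Rightarrow> {zero_arr \<C> A (H 0)}
          | Suc m \<Rightarrow> (\<lambda>u. d m \<circledcirc>\<^bsub>\<C>\<^esub> u) ` arr \<C> A (H m))"

text \<open>
  The groups \<open>\<xi>xt\<^sup>n(A,B)\<close> over \<open>\<G>\<I>(\<xi>)\<close>, computed from a chosen proper coresolution of \<open>B\<close> that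
  depends only on \<open>B\<close>; meaningful for \<open>B\<close> in \<^const>\<open>Res_GInj\<close> only.
\<close>

definition chosen_coresolution ::
  "('o, 'm, 'e) extri_data \<Rightarrow> ('o, 'm, 'e) triangle set \<Rightarrow> 'o \<Rightarrow> (nat \<Rightarrow> 'o) \<times> (nat \<Rightarrow> 'm)" where
  "chosen_coresolution \<C> \<xi> B =
     (SOME (H, d). \<exists>\<epsilon>. proper_coresolution \<C> \<xi> (GInj \<C> \<xi>) B \<epsilon> H d)"

definition xixt_GInj ::
  "('o, 'm, 'e) extri_data \<Rightarrow> ('o, 'm, 'e) triangle set \<Rightarrow> nat \<Rightarrow> 'o \<Rightarrow> 'o \<Rightarrow> 'm set monoid" where
  "xixt_GInj \<C> \<xi> n A B =
     (case chosen_coresolution \<C> \<xi> B of (H, d) \<Rightarrow> hom_cohomology \<C> A H d n)"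

end

theory Submission
  imports Defs
begin

text \<open>
  Gorenstein injective objects are closed under extensions and under summands with injective complement,
  hence under cokernels of \<open>\<xi>\<close>-inflations.  The first two closure properties are coinductive: let every
  object \<open>A\<close> of a class have no nontrivial \<open>\<xi>\<close>-extension by injectives, let a map from an injective to \<open>A\<close>
  vanish if all its composites into injectives do, and let there be \<open>\<xi>\<close>-triangles \<open>A' \<rightarrow> X \<rightarrow> A\<close> and
  \<open>A \<rightarrow> X' \<rightarrow> A''\<close> with \<open>X\<close>, \<open>X'\<close> injective and \<open>A'\<close>, \<open>A''\<close> in the class; then the class consists of
  Gorenstein injectives.
  By a Schanuel argument the \<open>n\<close>-th cosyzygy \<open>L\<^sup>n\<close> of \<open>N\<close> in a proper coresolution is then Gorenstein
  injective iff the dimension of \<open>N\<close> is at most \<open>n\<close>.  In that case the coresolution splits from \<open>L\<^sup>n\<close>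
  on, and the cohomology vanishes above \<open>n\<close>.  Conversely, as the dimension is finite, some \<open>L\<^sup>m\<close> is
  Gorenstein injective, and one descends from \<open>L\<^bsup>k+1\<^esup>\<close> to \<open>L\<^sup>k\<close> for \<open>k \<ge> n\<close>: vanishing of the cohomology
  in degree \<open>k + 1\<close> on injectives says that every map \<open>I \<rightarrow> L\<^bsup>k+1\<^esup>\<close> lifts to \<open>H\<^sup>k\<close>, so pulling back along an
  injective cover of \<open>L\<^bsup>k+1\<^esup>\<close> exhibits \<open>L\<^sup>k\<close>, up to an injective summand, as an extension of Gorenstein
  injectives.
\<close>

section \<open>Elementary calculus of morphisms and extensions\<close>

context additive_category
begin

lemma Hom_group: "group (Hom \<C> A B)"
  by (rule comm_group.axioms(2)[OF Hom_comm_group])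

lemma zero_closed [simp]: "zero_arr \<C> A B \<in> arr \<C> A B"
  by (rule monoid.one_closed[OF group.is_monoid[OF Hom_group]])

lemma add_closed: "\<lbrakk>f \<in> arr \<C> A B; g \<in> arr \<C> A B\<rbrakk> \<Longrightarrow> f \<otimes>\<^bsub>Hom \<C> A B\<^esub> g \<in> arr \<C> A B"
  by (rule monoid.m_closed[OF group.is_monoid[OF Hom_group]])

lemma add_zero [simp]:
  assumes "f \<in> arr \<C> A B"
  shows "f \<otimes>\<^bsub>Hom \<C> A B\<^esub> zero_arr \<C> A B = f" "zero_arr \<C> A B \<otimes>\<^bsub>Hom \<C> A B\<^esub> f = f"
  using monoid.r_one[OF group.is_monoid[OF Hom_group] assms]
    monoid.l_one[OF group.is_monoid[OF Hom_group] assms] by simp_all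

lemma add_eq_self:
  assumes "f \<in> arr \<C> A B" "d \<in> arr \<C> A B" "f = f \<otimes>\<^bsub>Hom \<C> A B\<^esub> d"
  shows "d = zero_arr \<C> A B"
  using group.l_cancel_one'[OF Hom_group assms(1,2)] assms(3) by simp

lemma difference_exists:
  assumes "f \<in> arr \<C> A B" "f' \<in> arr \<C> A B"
  obtains d where "d \<in> arr \<C> A B" "f = f' \<otimes>\<^bsub>Hom \<C> A B\<^esub> d"
proof -
  interpret group "Hom \<C> A B" by (rule Hom_group)
  show ?thesis
    using assms that[of "inv\<^bsub>Hom \<C> A B\<^esub> f' \<otimes>\<^bsub>Hom \<C> A B\<^esub> f"] by (simp add: m_assoc[symmetric])
qed

lemma cmp_zero_right [simp]:
  assumes "g \<in> arr \<C> B D"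
  shows "g \<circledcirc> zero_arr \<C> A B = zero_arr \<C> A D"
  using cmp_add_right[OF zero_closed zero_closed assms, of A]
  by (intro add_eq_self[OF cmp_closed[OF zero_closed assms] cmp_closed[OF zero_closed assms]]) simp

lemma cmp_zero_left [simp]:
  assumes "f \<in> arr \<C> A B"
  shows "zero_arr \<C> B D \<circledcirc> f = zero_arr \<C> A D"
  using cmp_add_left[OF assms zero_closed zero_closed, of D]
  by (intro add_eq_self[OF cmp_closed[OF assms zero_closed] cmp_closed[OF assms zero_closed]]) simp

lemma cmp_hom_left: "g \<in> arr \<C> B D \<Longrightarrow> (\<lambda>u. g \<circledcirc> u) \<in> hom (Hom \<C> A B) (Hom \<C> A D)"
  by (auto simp: hom_def cmp_closed cmp_add_right)

lemma cmp_hom_right: "f \<in> arr \<C> A B \<Longrightarrow> (\<lambda>u. u \<circledcirc> f) \<in> hom (Hom \<C> B D) (Hom \<C> A D)"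
  by (auto simp: hom_def cmp_closed cmp_add_left)

lemma is_zero_arr:
  assumes "is_zero \<C> Z"
  shows "f \<in> arr \<C> A Z \<Longrightarrow> f = zero_arr \<C> A Z" "f \<in> arr \<C> Z A \<Longrightarrow> f = zero_arr \<C> Z A"
  using assms by (auto simp: is_zero_def trivial_group_def)

lemma biproductD:
  assumes "biproduct \<C> A B S i j p q"
  shows "i \<in> arr \<C> A S" "j \<in> arr \<C> B S" "p \<in> arr \<C> S A" "q \<in> arr \<C> S B"
    "p \<circledcirc> i = idm \<C> A" "q \<circledcirc> j = idm \<C> B" "p \<circledcirc> j = zero_arr \<C> B A" "q \<circledcirc> i = zero_arr \<C> A B"
    "(i \<circledcirc> p) \<otimes>\<^bsub>Hom \<C> S S\<^esub> (j \<circledcirc> q) = idm \<C> S"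
  using assms by (simp_all add: biproduct_def)

lemma biproduct_swap:
  assumes "biproduct \<C> A B S i j p q"
  shows "biproduct \<C> B A S j i q p"
proof -
  note b = biproductD[OF assms]
  interpret comm_group "Hom \<C> S S" by (rule Hom_comm_group)
  show ?thesis
    unfolding biproduct_def using b m_comm[OF cmp_closed[OF b(3) b(1)] cmp_closed[OF b(4) b(2)]]
    by simp
qed

lemma biproduct_zero:
  assumes "is_zero \<C> Z"
  shows "biproduct \<C> A Z A (idm \<C> A) (zero_arr \<C> Z A) (idm \<C> A) (zero_arr \<C> A Z)"
proof -
  have "zero_arr \<C> A Z \<circledcirc> zero_arr \<C> Z A = idm \<C> Z"
    using is_zero_arr(1)[OF assms idm_closed] by simp
  then show ?thesis
    by (simp add: biproduct_def idm_closed cmp_idm_left[OF idm_closed] cmp_idm_left[OF zero_closed]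
        cmp_idm_right[OF zero_closed] cmp_zero_left[OF zero_closed])
qed

lemma isos_arr: "f \<in> isos \<C> A B \<Longrightarrow> f \<in> arr \<C> A B"
  by (simp add: isos_def)

lemma isos_inverse:
  assumes "f \<in> isos \<C> A B"
  obtains g where "g \<in> isos \<C> B A" "g \<circledcirc> f = idm \<C> A" "f \<circledcirc> g = idm \<C> B"
  using assms that by (auto simp: isos_def)

lemma isosI:
  assumes f: "f \<in> arr \<C> A B" and g: "g \<in> arr \<C> B A" and h: "h \<in> arr \<C> B A"
    and "f \<circledcirc> g = idm \<C> B" "h \<circledcirc> f = idm \<C> A"
  shows "f \<in> isos \<C> A B"
proof -
  have "h = g"
    using cmp_assoc[OF g f h] assms by (simp add: cmp_idm_left cmp_idm_right)
  then show ?thesis using assms by (auto simp: isos_def)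
qed

lemma idm_iso: "idm \<C> A \<in> isos \<C> A A"
  using idm_closed cmp_idm_left by (auto simp: isos_def)

lemma isos_cmp:
  assumes "f \<in> isos \<C> A B" "g \<in> isos \<C> B D"
  shows "g \<circledcirc> f \<in> isos \<C> A D"
proof -
  obtain f' where f': "f' \<in> isos \<C> B A" "f' \<circledcirc> f = idm \<C> A" "f \<circledcirc> f' = idm \<C> B"
    using assms(1) by (rule isos_inverse)
  obtain g' where g': "g' \<in> isos \<C> D B" "g' \<circledcirc> g = idm \<C> B" "g \<circledcirc> g' = idm \<C> D"
    using assms(2) by (rule isos_inverse)
  note a = isos_arr[OF assms(1)] isos_arr[OF assms(2)] isos_arr[OF f'(1)] isos_arr[OF g'(1)]
  have "(f' \<circledcirc> g') \<circledcirc> (g \<circledcirc> f) = f' \<circledcirc> ((g' \<circledcirc> g) \<circledcirc> f)"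
    using cmp_assoc[OF cmp_closed[OF a(1,2)] a(4,3)] cmp_assoc[OF a(1,2,4)] by simp
  moreover have "(g \<circledcirc> f) \<circledcirc> (f' \<circledcirc> g') = g \<circledcirc> ((f \<circledcirc> f') \<circledcirc> g')"
    using cmp_assoc[OF cmp_closed[OF a(4,3)] a(1,2)] cmp_assoc[OF a(4,3,1)] by simp
  ultimately show ?thesis
    using a f' g' cmp_closed[OF a(1,2)] cmp_closed[OF a(4,3)]
    by (auto simp: isos_def cmp_idm_left intro!: bexI[of _ "f' \<circledcirc> g'"])
qed

text \<open>Equality of two classes \<open>\<ss>(\<delta>)\<close> thereby yields an isomorphism of
  middle terms, and conversely.\<close>

lemma seq_equiv_equiv: "equiv (seqs \<C> A C) (seq_equiv \<C> A C)"
proof (rule equivI)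
  show "seq_equiv \<C> A C \<subseteq> seqs \<C> A C \<times> seqs \<C> A C"
    by (auto simp: seq_equiv_def)
  show "refl_on (seqs \<C> A C) (seq_equiv \<C> A C)"
    using idm_iso cmp_idm_left cmp_idm_right
    by (auto simp: refl_on_def seq_equiv_def seqs_def intro!: bexI[OF _ idm_iso])
  show "sym (seq_equiv \<C> A C)"
  proof (rule symI)
    fix s t assume "(s, t) \<in> seq_equiv \<C> A C"
    then obtain x B y x' B' y' b where s: "s = (x, B, y)" "t = (x', B', y')"
      and q: "s \<in> seqs \<C> A C" "t \<in> seqs \<C> A C" and b: "b \<in> isos \<C> B B'" "b \<circledcirc> x = x'" "y' \<circledcirc> b = y"
      by (auto simp: seq_equiv_def)
    obtain c where c: "c \<in> isos \<C> B' B" "c \<circledcirc> b = idm \<C> B" "b \<circledcirc> c = idm \<C> B'"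
      using b(1) by (rule isos_inverse)
    have a: "x \<in> arr \<C> A B" "y' \<in> arr \<C> B' C" using q s by (auto simp: seqs_def)
    have "c \<circledcirc> x' = x" "y \<circledcirc> c = y'"
      using cmp_assoc[OF a(1) isos_arr[OF b(1)] isos_arr[OF c(1)]]
        cmp_assoc[OF isos_arr[OF c(1)] isos_arr[OF b(1)] a(2)] a b c
      by (simp_all add: cmp_idm_left cmp_idm_right)
    then show "(t, s) \<in> seq_equiv \<C> A C"
      using q s c by (auto simp: seq_equiv_def)
  qed
  show "trans (seq_equiv \<C> A C)"
  proof (rule transI)
    fix s t u assume "(s, t) \<in> seq_equiv \<C> A C" "(t, u) \<in> seq_equiv \<C> A C"
    then obtain x B y x' B' y' b x'' B'' y'' b' where s: "s = (x, B, y)" "t = (x', B', y')" "u = (x'', B'', y'')"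
      and q: "s \<in> seqs \<C> A C" "t \<in> seqs \<C> A C" "u \<in> seqs \<C> A C"
      and b: "b \<in> isos \<C> B B'" "b \<circledcirc> x = x'" "y' \<circledcirc> b = y"
      and b': "b' \<in> isos \<C> B' B''" "b' \<circledcirc> x' = x''" "y'' \<circledcirc> b' = y'"
      unfolding seq_equiv_def by fast
    have a: "x \<in> arr \<C> A B" "y'' \<in> arr \<C> B'' C" using q s by (auto simp: seqs_def)
    have "(b' \<circledcirc> b) \<circledcirc> x = x''" "y'' \<circledcirc> (b' \<circledcirc> b) = y"
      using cmp_assoc[OF a(1) isos_arr[OF b(1)] isos_arr[OF b'(1)]]
        cmp_assoc[OF isos_arr[OF b(1)] isos_arr[OF b'(1)] a(2)] b b' by simp_all
    then show "(s, u) \<in> seq_equiv \<C> A C"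
      using q s isos_cmp[OF b(1) b'(1)] by (auto simp: seq_equiv_def)
  qed
qed

end

context extriangulated_category
begin

section \<open>Functoriality of extensions and uniqueness of realizations\<close>

lemma EE_group: "group (\<EE> \<C> C A)"
  by (rule comm_group.axioms(2)[OF EE_comm_group])

lemma EE_one_closed [simp]: "\<one>\<^bsub>\<EE> \<C> C A\<^esub> \<in> carrier (\<EE> \<C> C A)"
  by (rule monoid.one_closed[OF group.is_monoid[OF EE_group]])

lemma push_hom: "a \<in> arr \<C> A A' \<Longrightarrow> push \<C> C a \<in> hom (\<EE> \<C> C A) (\<EE> \<C> C A')"
  using Emap_hom[OF idm_closed, of a A A' C] by (simp add: push_def[abs_def])

lemma pull_hom: "c \<in> arr \<C> C' C \<Longrightarrow> pull \<C> A c \<in> hom (\<EE> \<C> C A) (\<EE> \<C> C' A)"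
  using Emap_hom[OF _ idm_closed, of c C' C A] by (simp add: pull_def[abs_def])

lemma push_closed [intro]:
  "\<lbrakk>a \<in> arr \<C> A A'; \<delta> \<in> carrier (\<EE> \<C> C A)\<rbrakk> \<Longrightarrow> push \<C> C a \<delta> \<in> carrier (\<EE> \<C> C A')"
  by (rule hom_in_carrier[OF push_hom])

lemma pull_closed [intro]:
  "\<lbrakk>c \<in> arr \<C> C' C; \<delta> \<in> carrier (\<EE> \<C> C A)\<rbrakk> \<Longrightarrow> pull \<C> A c \<delta> \<in> carrier (\<EE> \<C> C' A)"
  by (rule hom_in_carrier[OF pull_hom])

lemma push_one [simp]: "a \<in> arr \<C> A A' \<Longrightarrow> push \<C> C a \<one>\<^bsub>\<EE> \<C> C A\<^esub> = \<one>\<^bsub>\<EE> \<C> C A'\<^esub>"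
  by (rule hom_one[OF push_hom EE_group EE_group])

lemma pull_one [simp]: "c \<in> arr \<C> C' C \<Longrightarrow> pull \<C> A c \<one>\<^bsub>\<EE> \<C> C A\<^esub> = \<one>\<^bsub>\<EE> \<C> C' A\<^esub>"
  by (rule hom_one[OF pull_hom EE_group EE_group])

lemma push_idm [simp]: "\<delta> \<in> carrier (\<EE> \<C> C A) \<Longrightarrow> push \<C> C (idm \<C> A) \<delta> = \<delta>"
  by (simp add: push_def Emap_idm)

lemma pull_idm [simp]: "\<delta> \<in> carrier (\<EE> \<C> C A) \<Longrightarrow> pull \<C> A (idm \<C> C) \<delta> = \<delta>"
  by (simp add: pull_def Emap_idm)

lemma push_push:
  assumes "a \<in> arr \<C> A A'" "a' \<in> arr \<C> A' A''" "\<delta> \<in> carrier (\<EE> \<C> C A)"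
  shows "push \<C> C a' (push \<C> C a \<delta>) = push \<C> C (a' \<circledcirc> a) \<delta>"
  using Emap_cmp[OF idm_closed idm_closed assms] by (simp add: push_def cmp_idm_left[OF idm_closed])

lemma pull_pull:
  assumes "c \<in> arr \<C> C' C" "c' \<in> arr \<C> C'' C'" "\<delta> \<in> carrier (\<EE> \<C> C A)"
  shows "pull \<C> A c' (pull \<C> A c \<delta>) = pull \<C> A (c \<circledcirc> c') \<delta>"
  using Emap_cmp[OF assms(1,2) idm_closed idm_closed assms(3)]
  by (simp add: pull_def cmp_idm_left[OF idm_closed])

lemma push_pull:
  assumes a: "a \<in> arr \<C> A A'" and c: "c \<in> arr \<C> C' C" and d: "\<delta> \<in> carrier (\<EE> \<C> C A)"
  shows "push \<C> C' a (pull \<C> A c \<delta>) = pull \<C> A' c (push \<C> C a \<delta>)"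
  using Emap_cmp[OF c idm_closed idm_closed a d] Emap_cmp[OF idm_closed c a idm_closed d] a c
  by (simp add: push_def pull_def cmp_idm_left cmp_idm_right)

lemma EtrianglesD:
  assumes "(A, x, B, y, C, \<delta>) \<in> Etriangles \<C>"
  shows "x \<in> arr \<C> A B" "y \<in> arr \<C> B C" "\<delta> \<in> carrier (\<EE> \<C> C A)"
  using assms by (auto simp: Etriangles_def seqs_def)

lemma realize:
  assumes "\<delta> \<in> carrier (\<EE> \<C> C A)"
  obtains x B y where "(A, x, B, y, C, \<delta>) \<in> Etriangles \<C>"
proof -
  obtain s where "s \<in> seqs \<C> A C" "\<ss> \<C> C A \<delta> = seq_equiv \<C> A C `` {s}"
    using realization_class[OF assms] by (auto elim: quotientE)
  then show ?thesis using assms that by (cases s) (auto simp: Etriangles_def)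
qed

lemma Etriangles_seq_equiv:
  assumes "(A, x, B, y, C, \<delta>) \<in> Etriangles \<C>" "(A, x', B', y', C, \<delta>) \<in> Etriangles \<C>"
  obtains b where "b \<in> isos \<C> B B'" "b \<circledcirc> x = x'" "y' \<circledcirc> b = y"
proof -
  have "seq_equiv \<C> A C `` {(x, B, y)} = seq_equiv \<C> A C `` {(x', B', y')}" "(x', B', y') \<in> seqs \<C> A C"
    using assms by (auto simp: Etriangles_def)
  then have "((x, B, y), (x', B', y')) \<in> seq_equiv \<C> A C"
    using eq_equiv_class[OF _ seq_equiv_equiv] by blast
  then show ?thesis using that by (auto simp: seq_equiv_def)
qed

lemma Etriangles_cong:
  assumes "(A, x, B, y, C, \<delta>) \<in> Etriangles \<C>" "b \<in> isos \<C> B B'"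
    "x' \<in> arr \<C> A B'" "y' \<in> arr \<C> B' C" "b \<circledcirc> x = x'" "y' \<circledcirc> b = y"
  shows "(A, x', B', y', C, \<delta>) \<in> Etriangles \<C>"
proof -
  have "((x, B, y), (x', B', y')) \<in> seq_equiv \<C> A C"
    using assms EtrianglesD[OF assms(1)] by (auto simp: seq_equiv_def seqs_def)
  then have "seq_equiv \<C> A C `` {(x, B, y)} = seq_equiv \<C> A C `` {(x', B', y')}"
    by (rule equiv_class_eq[OF seq_equiv_equiv])
  then show ?thesis using assms by (auto simp: Etriangles_def seqs_def)
qed

text \<open>This triangle and that of \<open>split_left\<close> serve as test objects: a morphism
  out of one of them, completed by \<open>ET3\<close> or \<open>ET3_op\<close>, encodes a
  factorization or a vanishing.\<close>

lemma split_right: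
  assumes "is_zero \<C> Z"
  shows "(A, idm \<C> A, A, zero_arr \<C> A Z, Z, \<one>\<^bsub>\<EE> \<C> Z A\<^esub>) \<in> Etriangles \<C>"
  using ET2_zero[OF biproduct_zero[OF assms]] .

lemma split_left:
  assumes "is_zero \<C> Z"
  shows "(Z, zero_arr \<C> Z A, A, idm \<C> A, A, \<one>\<^bsub>\<EE> \<C> A Z\<^esub>) \<in> Etriangles \<C>"
  using ET2_zero[OF biproduct_swap[OF biproduct_zero[OF assms]]] .

end

section \<open>The opposite category\<close>

text \<open>Dual statements about extriangulated categories are obtained by applying a lemma to this
  category. Sequences are reversed inside the classes, so that dualizing a triangle amounts to
  permuting its tuple (\<open>Etriangles_opp\<close>).\<close>

definition opp :: "('o, 'm, 'e) extri_data \<Rightarrow> ('o, 'm, 'e) extri_data" where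
  "opp \<C> = \<lparr>Hom = \<lambda>A B. Hom \<C> B A, idm = idm \<C>, cmp = \<lambda>g f. cmp \<C> f g,
     EE = \<lambda>C A. EE \<C> A C, Emap = \<lambda>c a. Emap \<C> a c,
     realization = \<lambda>C A \<delta>. (\<lambda>(x, B, y). (y, B, x)) ` realization \<C> A C \<delta>\<rparr>"

lemma opp_simps [simp]:
  "Hom (opp \<C>) A B = Hom \<C> B A" "idm (opp \<C>) = idm \<C>" "g \<circledcirc>\<^bsub>opp \<C>\<^esub> f = f \<circledcirc>\<^bsub>\<C>\<^esub> g"
  "\<EE> (opp \<C>) C A = \<EE> \<C> A C" "Emap (opp \<C>) c a = Emap \<C> a c"
  "push (opp \<C>) C a = pull \<C> C a" "pull (opp \<C>) A c = push \<C> A c"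
  "\<ss> (opp \<C>) C A \<delta> = (\<lambda>(x, B, y). (y, B, x)) ` \<ss> \<C> A C \<delta>"
  by (simp_all add: opp_def push_def[abs_def] pull_def[abs_def])

lemma isos_opp [simp]: "isos (opp \<C>) A B = isos \<C> B A"
  by (auto simp: isos_def)

lemma is_zero_opp [simp]: "is_zero (opp \<C>) Z = is_zero \<C> Z"
  by (auto simp: is_zero_def)

lemma biproduct_opp [simp]: "biproduct (opp \<C>) A B S i j p q = biproduct \<C> A B S p q i j"
  by (auto simp: biproduct_def)

context extriangulated_category
begin

text \<open>An isomorphism of the opposite category runs the other way in \<open>\<C>\<close>, so
  unfolding gives the pair in swapped order; symmetry of \<open>seq_equiv\<close> swaps it
  back.\<close>

lemma seq_equiv_opp:
  "((x, B, y), (x', B', y')) \<in> seq_equiv (opp \<C>) A C \<longleftrightarrow> ((y, B, x), (y', B', x')) \<in> seq_equiv \<C> C A"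
proof -
  have "((x, B, y), (x', B', y')) \<in> seq_equiv (opp \<C>) A C \<longleftrightarrow> ((y', B', x'), (y, B, x)) \<in> seq_equiv \<C> C A"
    unfolding seq_equiv_def seqs_def by (auto simp: Bex_def)
  also have "\<dots> \<longleftrightarrow> ((y, B, x), (y', B', x')) \<in> seq_equiv \<C> C A"
    using seq_equiv_equiv[of C A] unfolding equiv_def sym_def by blast
  finally show ?thesis .
qed

lemma seq_equiv_opp_class:
  "seq_equiv (opp \<C>) A C `` {(x, B, y)} = (\<lambda>(x, B, y). (y, B, x)) ` (seq_equiv \<C> C A `` {(y, B, x)})"
proof (rule Set.set_eqI)
  fix t :: "'m \<times> 'o \<times> 'm"
  obtain a b c where t: "t = (a, b, c)" by (cases t)
  have "(a, b, c) \<in> (\<lambda>(x, B, y). (y, B, x)) ` S \<longleftrightarrow> (c, b, a) \<in> S" for S :: "('m \<times> 'o \<times> 'm) set"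
    by force
  then show "t \<in> seq_equiv (opp \<C>) A C `` {(x, B, y)} \<longleftrightarrow>
      t \<in> (\<lambda>(x, B, y). (y, B, x)) ` (seq_equiv \<C> C A `` {(y, B, x)})"
    by (simp only: t Image_singleton_iff seq_equiv_opp)
qed

lemma Etriangles_opp [simp]:
  "(A, x, B, y, C, \<delta>) \<in> Etriangles (opp \<C>) \<longleftrightarrow> (C, y, B, x, A, \<delta>) \<in> Etriangles \<C>"
proof -
  \<comment> \<open>Reversal of triples is injective, so equality of reversed classes gives back
    equality of the classes.\<close>
  have "inj (\<lambda>(x :: 'm, B :: 'o, y :: 'm). (y, B, x))" by (auto simp: inj_def)
  note * = inj_image_eq_iff[OF this]
  show ?thesis
    unfolding Etriangles_def seq_equiv_opp_class mem_Collect_eq prod.case opp_simps * by (auto simp: seqs_def)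
qed

text \<open>Composites nest to the right in \<open>is_dsum\<close>; reversal nests them to the left,
  and the assumptions on the arrows allow reassociation.\<close>

lemma is_dsum_opp:
  assumes "\<delta> \<in> carrier (\<EE> \<C> A C)" "\<delta>' \<in> carrier (\<EE> \<C> A' C')"
    and "x \<in> arr \<C> B A" "y \<in> arr \<C> C B" "x' \<in> arr \<C> B' A'" "y' \<in> arr \<C> C' B'"
  shows "is_dsum (opp \<C>) (A, x, B, y, C, \<delta>) (A', x', B', y', C', \<delta>') (SA, X, SB, Y, SC, \<Delta>)
    \<Longrightarrow> is_dsum \<C> (C, y, B, x, A, \<delta>) (C', y', B', x', A', \<delta>') (SC, Y, SB, X, SA, \<Delta>)"
proof -
  assume "is_dsum (opp \<C>) (A, x, B, y, C, \<delta>) (A', x', B', y', C', \<delta>') (SA, X, SB, Y, SC, \<Delta>)"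
  then obtain iA iA' pA pA' iB iB' pB pB' iC iC' pC pC' where
       b: "biproduct \<C> A A' SA pA pA' iA iA'"
       "biproduct \<C> B B' SB pB pB' iB iB'"
       "biproduct \<C> C C' SC pC pC' iC iC'" and
       X: "X = ((pA \<circledcirc> x) \<circledcirc> iB) \<otimes>\<^bsub>Hom \<C> SB SA\<^esub> ((pA' \<circledcirc> x') \<circledcirc> iB')"
       "Y = ((pB \<circledcirc> y) \<circledcirc> iC) \<otimes>\<^bsub>Hom \<C> SC SB\<^esub> ((pB' \<circledcirc> y') \<circledcirc> iC')"
       "\<Delta> = Emap \<C> iA pC \<delta> \<otimes>\<^bsub>\<EE> \<C> SA SC\<^esub> Emap \<C> iA' pC' \<delta>'"
    unfolding is_dsum.simps biproduct_opp opp_simps by (elim exE conjE) (rule that; assumption)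
  note b1 = biproductD[OF b(1)] and b2 = biproductD[OF b(2)] and b3 = biproductD[OF b(3)]
  have "X = (pA \<circledcirc> x \<circledcirc> iB) \<otimes>\<^bsub>Hom \<C> SB SA\<^esub> (pA' \<circledcirc> x' \<circledcirc> iB')"
    "Y = (pB \<circledcirc> y \<circledcirc> iC) \<otimes>\<^bsub>Hom \<C> SC SB\<^esub> (pB' \<circledcirc> y' \<circledcirc> iC')"
    using X cmp_assoc[OF b2(3) assms(3) b1(1)] cmp_assoc[OF b2(4) assms(5) b1(2)]
      cmp_assoc[OF b3(3) assms(4) b2(1)] cmp_assoc[OF b3(4) assms(6) b2(2)] by auto
  with b X(3) show ?thesis unfolding is_dsum.simps by (intro exI conjI) assumption+
qed

text \<open>\<open>ET3\<close> is exchanged with \<open>ET3_op\<close> and \<open>ET4\<close> with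
  \<open>ET4_op\<close>; the split triangle of a biproduct becomes the one with the summands
  interchanged.\<close>

lemma extriangulated_category_opp: "extriangulated_category (opp \<C>)"
proof (intro extriangulated_category.intro additive_category.intro extriangulated_category_axioms.intro)
  show "comm_group (Hom (opp \<C>) A B)" for A B by (simp add: Hom_comm_group)
  show "idm (opp \<C>) A \<in> arr (opp \<C>) A A" for A by (simp add: idm_closed)
  show "\<lbrakk>f \<in> arr (opp \<C>) A B; g \<in> arr (opp \<C>) B D\<rbrakk> \<Longrightarrow> g \<circledcirc>\<^bsub>opp \<C>\<^esub> f \<in> arr (opp \<C>) A D" for f g A B D
    by (simp add: cmp_closed)
  show "f \<in> arr (opp \<C>) A B \<Longrightarrow> f \<circledcirc>\<^bsub>opp \<C>\<^esub> idm (opp \<C>) A = f" for f A B by (simp add: cmp_idm_left)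
  show "f \<in> arr (opp \<C>) A B \<Longrightarrow> idm (opp \<C>) B \<circledcirc>\<^bsub>opp \<C>\<^esub> f = f" for f A B by (simp add: cmp_idm_right)
  show "\<lbrakk>f \<in> arr (opp \<C>) A B; g \<in> arr (opp \<C>) B D; h \<in> arr (opp \<C>) D E\<rbrakk>
        \<Longrightarrow> (h \<circledcirc>\<^bsub>opp \<C>\<^esub> g) \<circledcirc>\<^bsub>opp \<C>\<^esub> f = h \<circledcirc>\<^bsub>opp \<C>\<^esub> g \<circledcirc>\<^bsub>opp \<C>\<^esub> f" for f g h A B D E
    by (simp add: cmp_assoc)
  show "\<lbrakk>f \<in> arr (opp \<C>) A B; f' \<in> arr (opp \<C>) A B; g \<in> arr (opp \<C>) B D\<rbrakk>
        \<Longrightarrow> g \<circledcirc>\<^bsub>opp \<C>\<^esub> (f \<otimes>\<^bsub>Hom (opp \<C>) A B\<^esub> f')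
          = (g \<circledcirc>\<^bsub>opp \<C>\<^esub> f) \<otimes>\<^bsub>Hom (opp \<C>) A D\<^esub> (g \<circledcirc>\<^bsub>opp \<C>\<^esub> f')" for f f' g A B D
    by (simp add: cmp_add_left)
  show "\<lbrakk>f \<in> arr (opp \<C>) A B; g \<in> arr (opp \<C>) B D; g' \<in> arr (opp \<C>) B D\<rbrakk>
        \<Longrightarrow> (g \<otimes>\<^bsub>Hom (opp \<C>) B D\<^esub> g') \<circledcirc>\<^bsub>opp \<C>\<^esub> f
          = (g \<circledcirc>\<^bsub>opp \<C>\<^esub> f) \<otimes>\<^bsub>Hom (opp \<C>) A D\<^esub> (g' \<circledcirc>\<^bsub>opp \<C>\<^esub> f)" for f g g' A B D
    by (simp add: cmp_add_right)
  show "\<exists>Z. is_zero (opp \<C>) Z" using zero_exists by simp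
  show "\<exists>S i j p q. biproduct (opp \<C>) A B S i j p q" for A B
    using biproduct_exists[of A B] by (simp) metis
  show "comm_group (\<EE> (opp \<C>) C A)" for C A by (simp add: EE_comm_group)
  show "\<lbrakk>c \<in> arr (opp \<C>) C' C; a \<in> arr (opp \<C>) A A'\<rbrakk>
      \<Longrightarrow> Emap (opp \<C>) c a \<in> hom (\<EE> (opp \<C>) C A) (\<EE> (opp \<C>) C' A')" for c a C C' A A'
    using Emap_hom[of a A' A c C C'] by (simp add: opp_def)
  show "\<delta> \<in> carrier (\<EE> (opp \<C>) C A) \<Longrightarrow> Emap (opp \<C>) (idm (opp \<C>) C) (idm (opp \<C>) A) \<delta> = \<delta>" for \<delta> C A
    by (simp add: Emap_idm)
  show "\<lbrakk>c \<in> arr (opp \<C>) C' C; c' \<in> arr (opp \<C>) C'' C'; a \<in> arr (opp \<C>) A A'; a' \<in> arr (opp \<C>) A' A'';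
        \<delta> \<in> carrier (\<EE> (opp \<C>) C A)\<rbrakk>
      \<Longrightarrow> Emap (opp \<C>) (c \<circledcirc>\<^bsub>opp \<C>\<^esub> c') (a' \<circledcirc>\<^bsub>opp \<C>\<^esub> a) \<delta> = Emap (opp \<C>) c' a' (Emap (opp \<C>) c a \<delta>)"
    for c c' a a' \<delta> C C' C'' A A' A''
    using Emap_cmp[of a A' A a' A'' c C C' c' C''] by simp
  show "\<lbrakk>a \<in> arr (opp \<C>) A A'; a' \<in> arr (opp \<C>) A A'; \<delta> \<in> carrier (\<EE> (opp \<C>) C A)\<rbrakk>
        \<Longrightarrow> push (opp \<C>) C (a \<otimes>\<^bsub>Hom (opp \<C>) A A'\<^esub> a') \<delta>
          = push (opp \<C>) C a \<delta> \<otimes>\<^bsub>\<EE> (opp \<C>) C A'\<^esub> push (opp \<C>) C a' \<delta>" for a a' \<delta> C A A'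
    by (simp add: pull_add)
  show "\<lbrakk>c \<in> arr (opp \<C>) C' C; c' \<in> arr (opp \<C>) C' C; \<delta> \<in> carrier (\<EE> (opp \<C>) C A)\<rbrakk>
        \<Longrightarrow> pull (opp \<C>) A (c \<otimes>\<^bsub>Hom (opp \<C>) C' C\<^esub> c') \<delta>
          = pull (opp \<C>) A c \<delta> \<otimes>\<^bsub>\<EE> (opp \<C>) C' A\<^esub> pull (opp \<C>) A c' \<delta>" for c c' \<delta> C C' A
    by (simp add: push_add)
  show "\<ss> (opp \<C>) C A \<delta> \<in> seqs (opp \<C>) A C // seq_equiv (opp \<C>) A C"
    if d: "\<delta> \<in> carrier (\<EE> (opp \<C>) C A)" for \<delta> C A
  proof -
    have d: "\<delta> \<in> carrier (\<EE> \<C> A C)" using d by simp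
    obtain x B y where "(C, x, B, y, A, \<delta>) \<in> Etriangles \<C>" using d by (rule realize)
    then have "(A, y, B, x, C, \<delta>) \<in> Etriangles (opp \<C>)" by simp
    then show ?thesis unfolding Etriangles_def by (auto intro: quotientI)
  qed
  show "\<exists>b\<in>arr (opp \<C>) B B'. b \<circledcirc>\<^bsub>opp \<C>\<^esub> x = x' \<circledcirc>\<^bsub>opp \<C>\<^esub> a \<and> y' \<circledcirc>\<^bsub>opp \<C>\<^esub> b = c \<circledcirc>\<^bsub>opp \<C>\<^esub> y"
    if "(A, x, B, y, C, \<delta>) \<in> Etriangles (opp \<C>)" "(A', x', B', y', C', \<delta>') \<in> Etriangles (opp \<C>)"
      "a \<in> arr (opp \<C>) A A'" "c \<in> arr (opp \<C>) C C'" "push (opp \<C>) C a \<delta> = pull (opp \<C>) A' c \<delta>'"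
    for A x B y C \<delta> A' x' B' y' C' \<delta>' a c
    using ET2_morphism[of C' y' B' x' A' \<delta>' C y B x A \<delta> c a] that by (auto simp: eq_commute)
  show "(A, i, S, q, C, \<one>\<^bsub>\<EE> (opp \<C>) C A\<^esub>) \<in> Etriangles (opp \<C>)"
    if "biproduct (opp \<C>) A C S i j p q" for A C S i j p q
    using ET2_zero[OF biproduct_swap] that by simp
  show "u \<in> Etriangles (opp \<C>)"
    if "t \<in> Etriangles (opp \<C>)" "t' \<in> Etriangles (opp \<C>)" "is_dsum (opp \<C>) t t' u" for t t' u
  proof -
    obtain A x B y C \<delta> A' x' B' y' C' \<delta>' SA X SB Y SC \<Delta> where
      t: "t = (A, x, B, y, C, \<delta>)" "t' = (A', x', B', y', C', \<delta>')" "u = (SA, X, SB, Y, SC, \<Delta>)"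
      by (cases t rule: prod_cases6, cases t' rule: prod_cases6, cases u rule: prod_cases6) (rule that)
    have e: "(C, y, B, x, A, \<delta>) \<in> Etriangles \<C>" "(C', y', B', x', A', \<delta>') \<in> Etriangles \<C>"
      using that t by auto
    show ?thesis
      using ET2_dsum[OF e is_dsum_opp] that(3) EtrianglesD[OF e(1)] EtrianglesD[OF e(2)] t by simp
  qed
  show "\<exists>c\<in>arr (opp \<C>) C C'. c \<circledcirc>\<^bsub>opp \<C>\<^esub> y = y' \<circledcirc>\<^bsub>opp \<C>\<^esub> b \<and> push (opp \<C>) C a \<delta> = pull (opp \<C>) A' c \<delta>'"
    if "(A, x, B, y, C, \<delta>) \<in> Etriangles (opp \<C>)" "(A', x', B', y', C', \<delta>') \<in> Etriangles (opp \<C>)"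
      "a \<in> arr (opp \<C>) A A'" "b \<in> arr (opp \<C>) B B'" "b \<circledcirc>\<^bsub>opp \<C>\<^esub> x = x' \<circledcirc>\<^bsub>opp \<C>\<^esub> a"
    for A x B y C \<delta> A' x' B' y' C' \<delta>' a b
    using ET3_op[of C' y' B' x' A' \<delta>' C y B x A \<delta> b a] that by (auto simp: eq_commute)
  show "\<exists>a\<in>arr (opp \<C>) A A'. b \<circledcirc>\<^bsub>opp \<C>\<^esub> x = x' \<circledcirc>\<^bsub>opp \<C>\<^esub> a \<and> push (opp \<C>) C a \<delta> = pull (opp \<C>) A' c \<delta>'"
    if "(A, x, B, y, C, \<delta>) \<in> Etriangles (opp \<C>)" "(A', x', B', y', C', \<delta>') \<in> Etriangles (opp \<C>)"
      "b \<in> arr (opp \<C>) B B'" "c \<in> arr (opp \<C>) C C'" "c \<circledcirc>\<^bsub>opp \<C>\<^esub> y = y' \<circledcirc>\<^bsub>opp \<C>\<^esub> b"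
    for A x B y C \<delta> A' x' B' y' C' \<delta>' b c
    using ET3[of C' y' B' x' A' \<delta>' C y B x A \<delta> c b] that by (auto simp: eq_commute)
  show "\<exists>E \<delta>'' h' d e. (A, g \<circledcirc>\<^bsub>opp \<C>\<^esub> f, C, h', E, \<delta>'') \<in> Etriangles (opp \<C>) \<and>
      (D, d, E, e, F, push (opp \<C>) F f' \<delta>') \<in> Etriangles (opp \<C>) \<and>
      h' \<circledcirc>\<^bsub>opp \<C>\<^esub> g = d \<circledcirc>\<^bsub>opp \<C>\<^esub> f' \<and> e \<circledcirc>\<^bsub>opp \<C>\<^esub> h' = g' \<and>
      pull (opp \<C>) A d \<delta>'' = \<delta> \<and> push (opp \<C>) E f \<delta>'' = pull (opp \<C>) B e \<delta>'"
    if "(A, f, B, f', D, \<delta>) \<in> Etriangles (opp \<C>)" "(B, g, C, g', F, \<delta>') \<in> Etriangles (opp \<C>)"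
    for A f B f' D \<delta> g C g' F \<delta>'
    using ET4_op[of D f' B f A \<delta> F g' C g \<delta>'] that by simp
  show "\<exists>E \<delta>'' h' d e. (E, h', C, f \<circledcirc>\<^bsub>opp \<C>\<^esub> g, A, \<delta>'') \<in> Etriangles (opp \<C>) \<and>
      (F, e, E, d, D, pull (opp \<C>) F f' \<delta>') \<in> Etriangles (opp \<C>) \<and>
      g \<circledcirc>\<^bsub>opp \<C>\<^esub> h' = f' \<circledcirc>\<^bsub>opp \<C>\<^esub> d \<and> h' \<circledcirc>\<^bsub>opp \<C>\<^esub> e = g' \<and>
      push (opp \<C>) A d \<delta>'' = \<delta> \<and> pull (opp \<C>) E f \<delta>'' = push (opp \<C>) B e \<delta>'"
    if "(D, f', B, f, A, \<delta>) \<in> Etriangles (opp \<C>)" "(F, g', C, g, B, \<delta>') \<in> Etriangles (opp \<C>)"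
    for D f' B f A \<delta> F g' C g \<delta>'
    using ET4[of A f B f' D \<delta> g C g' F \<delta>'] that by simp
qed

section \<open>Exact sequences and pushouts of triangles\<close>

lemma EE_difference_exists:
  assumes "\<delta> \<in> carrier (\<EE> \<C> C A)" "\<delta>' \<in> carrier (\<EE> \<C> C A)"
  obtains \<tau> where "\<tau> \<in> carrier (\<EE> \<C> C A)" "\<delta> = \<delta>' \<otimes>\<^bsub>\<EE> \<C> C A\<^esub> \<tau>"
proof -
  interpret group "\<EE> \<C> C A" by (rule EE_group)
  show ?thesis
    using assms that[of "inv\<^bsub>\<EE> \<C> C A\<^esub> \<delta>' \<otimes>\<^bsub>\<EE> \<C> C A\<^esub> \<delta>"] by (simp add: m_assoc[symmetric])
qed

lemma EE_eq_self:
  assumes "\<delta> \<in> carrier (\<EE> \<C> C A)" "\<tau> \<in> carrier (\<EE> \<C> C A)" "\<delta> = \<delta> \<otimes>\<^bsub>\<EE> \<C> C A\<^esub> \<tau>"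
  shows "\<tau> = \<one>\<^bsub>\<EE> \<C> C A\<^esub>"
  using group.l_cancel_one'[OF EE_group assms(1,2)] assms(3) by simp

lemma push_zero [simp]:
  assumes "\<delta> \<in> carrier (\<EE> \<C> C A)"
  shows "push \<C> C (zero_arr \<C> A A') \<delta> = \<one>\<^bsub>\<EE> \<C> C A'\<^esub>"
  using push_add[OF zero_closed zero_closed assms, of A'] push_closed[OF zero_closed assms, of A']
  by (intro EE_eq_self) simp_all

text \<open>\<open>ET3\<close>, applied to the trivial triangle
  \<open>A \<rightarrow> A \<rightarrow> 0\<close> and the maps \<open>idm \<C> A\<close> and
  \<open>x\<close>, factors the composite through a zero object.\<close>

lemma Etriangles_comp_zero:
  assumes "(A, x, B, y, C, \<delta>) \<in> Etriangles \<C>"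
  shows "y \<circledcirc> x = zero_arr \<C> A C"
proof -
  obtain Z where Z: "is_zero \<C> Z" using zero_exists by blast
  note t = EtrianglesD[OF assms]
  obtain c where "c \<in> arr \<C> Z C" "c \<circledcirc> zero_arr \<C> A Z = y \<circledcirc> x"
    using ET3[OF split_right[OF Z] assms idm_closed t(1)] by blast
  then show ?thesis by simp
qed

text \<open>Exactness in the middle of
  \<open>\<C>(X,A) \<rightarrow> \<C>(X,B) \<rightarrow> \<C>(X,C)\<close>: \<open>ET3_op\<close>
  completes the maps \<open>u\<close> and \<open>0\<close> on the trivial triangle
  \<open>X \<rightarrow> X \<rightarrow> 0\<close> by \<open>v\<close>.\<close>

lemma lift_zero:
  assumes T: "(A, x, B, y, C, \<delta>) \<in> Etriangles \<C>" and u: "u \<in> arr \<C> X B" "y \<circledcirc> u = zero_arr \<C> X C"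
  obtains v where "v \<in> arr \<C> X A" "u = x \<circledcirc> v"
proof -
  obtain Z where Z: "is_zero \<C> Z" using zero_exists by blast
  have "zero_arr \<C> Z C \<circledcirc> zero_arr \<C> X Z = y \<circledcirc> u" using u(2) by simp
  then obtain v where "v \<in> arr \<C> X A" "u \<circledcirc> idm \<C> X = x \<circledcirc> v"
    using ET3_op[OF split_right[OF Z] T u(1) zero_closed] by blast
  then show ?thesis using that u(1) by (simp add: cmp_idm_right)
qed

text \<open>As \<open>c\<close> pulls \<open>\<delta>\<close> back to the split extension,
  \<open>ET2_morphism\<close> maps the biproduct of \<open>A\<close> and \<open>X\<close> to
  \<open>B\<close> over \<open>c\<close>; restriction to \<open>X\<close> is the lift.\<close>

lemma lift_pull:
  assumes T: "(A, x, B, y, C, \<delta>) \<in> Etriangles \<C>" and c: "c \<in> arr \<C> X C" "pull \<C> A c \<delta> = \<one>\<^bsub>\<EE> \<C> X A\<^esub>"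
  obtains u where "u \<in> arr \<C> X B" "y \<circledcirc> u = c"
proof -
  obtain S i j p q where S: "biproduct \<C> A X S i j p q" using biproduct_exists by blast
  note s = biproductD[OF S] and t = EtrianglesD[OF T]
  obtain b where b: "b \<in> arr \<C> S B" "y \<circledcirc> b = c \<circledcirc> q"
    using ET2_morphism[OF ET2_zero[OF S] T idm_closed c(1)] c(2) by auto
  have "y \<circledcirc> (b \<circledcirc> j) = c"
    using cmp_assoc[OF s(2) b(1) t(2)] cmp_assoc[OF s(2) s(4) c(1)] b s c by (simp add: cmp_idm_right)
  then show ?thesis using that cmp_closed[OF s(2) b(1)] by blast
qed

text \<open>\<open>ET3_op\<close> on the trivial triangle
  \<open>0 \<rightarrow> B \<rightarrow> B\<close> exhibits the pullback as a pushout of a split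
  extension.\<close>

lemma pull_deflation:
  assumes T: "(A, x, B, y, C, \<delta>) \<in> Etriangles \<C>"
  shows "pull \<C> A y \<delta> = \<one>\<^bsub>\<EE> \<C> B A\<^esub>"
proof -
  obtain Z where Z: "is_zero \<C> Z" using zero_exists by blast
  obtain a where "a \<in> arr \<C> Z A" "push \<C> B a \<one>\<^bsub>\<EE> \<C> B Z\<^esub> = pull \<C> A y \<delta>"
    using ET3_op[OF split_left[OF Z] T idm_closed EtrianglesD(2)[OF T]] by blast
  then show ?thesis by simp
qed

lemma pull_cmp_deflation:
  assumes T: "(A, x, B, y, C, \<delta>) \<in> Etriangles \<C>" and u: "u \<in> arr \<C> X B"
  shows "pull \<C> A (y \<circledcirc> u) \<delta> = \<one>\<^bsub>\<EE> \<C> X A\<^esub>"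
  using pull_pull[OF EtrianglesD(2)[OF T] u EtrianglesD(3)[OF T]] pull_deflation[OF T] pull_one[OF u] by simp

lemma extend_zero:
  assumes T: "(A, x, B, y, C, \<delta>) \<in> Etriangles \<C>" and u: "u \<in> arr \<C> B X" "u \<circledcirc> x = zero_arr \<C> A X"
  obtains v where "v \<in> arr \<C> C X" "u = v \<circledcirc> y"
  using extriangulated_category.lift_zero[OF extriangulated_category_opp, of C y B x A \<delta> u X] assms
  by auto

lemma extend_push:
  assumes T: "(A, x, B, y, C, \<delta>) \<in> Etriangles \<C>" and a: "a \<in> arr \<C> A X" "push \<C> C a \<delta> = \<one>\<^bsub>\<EE> \<C> C X\<^esub>"
  obtains u where "u \<in> arr \<C> B X" "u \<circledcirc> x = a"
  using extriangulated_category.lift_pull[OF extriangulated_category_opp, of C y B x A \<delta> a X] assms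
  by auto

lemma push_cmp_inflation:
  assumes T: "(A, x, B, y, C, \<delta>) \<in> Etriangles \<C>" and u: "u \<in> arr \<C> B X"
  shows "push \<C> C (u \<circledcirc> x) \<delta> = \<one>\<^bsub>\<EE> \<C> C X\<^esub>"
  using extriangulated_category.pull_cmp_deflation[OF extriangulated_category_opp, of C y B x A \<delta> u X] assms
  by auto

text \<open>Exactness at \<open>\<EE>(X,A)\<close>: the map \<open>x\<close> extends over a
  realization of \<open>\<theta>\<close>, and \<open>ET3\<close> yields \<open>t\<close> on the
  third terms.\<close>

lemma push_eq_one_pull:
  assumes T: "(A, x, B, y, C, \<delta>) \<in> Etriangles \<C>"
    and th: "\<theta> \<in> carrier (\<EE> \<C> X A)" "push \<C> X x \<theta> = \<one>\<^bsub>\<EE> \<C> X B\<^esub>"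
  obtains t where "t \<in> arr \<C> X C" "\<theta> = pull \<C> A t \<delta>"
proof -
  obtain m M n where M: "(A, m, M, n, X, \<theta>) \<in> Etriangles \<C>" using th(1) by (rule realize)
  obtain b where b: "b \<in> arr \<C> M B" "b \<circledcirc> m = x"
    using M EtrianglesD(1)[OF T] th(2) by (rule extend_push)
  have "b \<circledcirc> m = x \<circledcirc> idm \<C> A" using b EtrianglesD[OF T] by (simp add: cmp_idm_right)
  then obtain c where "c \<in> arr \<C> X C" "push \<C> X (idm \<C> A) \<theta> = pull \<C> A c \<delta>"
    using ET3[OF M T idm_closed b(1)] by blast
  then show ?thesis using that th(1) by simp
qed

section \<open>The five lemma and split triangles\<close>

lemma five_right_inverse:
  assumes T: "(A, x, B, y, C, \<delta>) \<in> Etriangles \<C>" and T': "(A', x', B', y', C', \<delta>') \<in> Etriangles \<C>"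
    and a: "a \<in> isos \<C> A A'" and b: "b \<in> arr \<C> B B'" and c: "c \<in> isos \<C> C C'"
    and bx: "b \<circledcirc> x = x' \<circledcirc> a" and yb: "y' \<circledcirc> b = c \<circledcirc> y"
    and ac: "push \<C> C a \<delta> = pull \<C> A' c \<delta>'"
  obtains w where "w \<in> arr \<C> B' B" "b \<circledcirc> w = idm \<C> B'"
proof -
  obtain a' where a': "a' \<in> isos \<C> A' A" "a' \<circledcirc> a = idm \<C> A" "a \<circledcirc> a' = idm \<C> A'"
    using a by (rule isos_inverse)
  obtain c' where c': "c' \<in> isos \<C> C' C" "c' \<circledcirc> c = idm \<C> C" "c \<circledcirc> c' = idm \<C> C'"
    using c by (rule isos_inverse)
  note r = isos_arr[OF a] isos_arr[OF c] isos_arr[OF a'(1)] isos_arr[OF c'(1)]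
  note t = EtrianglesD[OF T] and t' = EtrianglesD[OF T']
  \<comment> \<open>First approximation to the inverse: \<open>u\<close> lifts along
    \<open>y\<close>, because its pullback of \<open>\<delta>\<close> becomes trivial after pushing
    along the isomorphism \<open>a\<close>.\<close>
  define u where "u = c' \<circledcirc> y'"
  have u: "u \<in> arr \<C> B' C" unfolding u_def using t'(2) r(4) by (rule cmp_closed)
  have cu: "c \<circledcirc> u = y'"
    using cmp_assoc[OF t'(2) r(4) r(2)] c' t' by (simp add: u_def cmp_idm_left)
  have "push \<C> B' a (pull \<C> A u \<delta>) = pull \<C> A' u (pull \<C> A' c \<delta>')"
    using push_pull[OF r(1) u t(3)] ac by simp
  also have "\<dots> = \<one>\<^bsub>\<EE> \<C> B' A'\<^esub>"
    using pull_pull[OF r(2) u t'(3)] cu pull_deflation[OF T'] by simp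
  finally have "push \<C> B' a' (push \<C> B' a (pull \<C> A u \<delta>)) = \<one>\<^bsub>\<EE> \<C> B' A\<^esub>"
    using r by simp
  then have "pull \<C> A u \<delta> = \<one>\<^bsub>\<EE> \<C> B' A\<^esub>"
    using push_push[OF r(1,3) pull_closed[OF u t(3)]] a' pull_closed[OF u t(3)] by simp
  with T u obtain w where w: "w \<in> arr \<C> B' B" "y \<circledcirc> w = u" by (rule lift_pull)
  have bw: "b \<circledcirc> w \<in> arr \<C> B' B'" using w(1) b by (rule cmp_closed)
  have y: "y' \<circledcirc> (b \<circledcirc> w) = y'"
    using cmp_assoc[OF w(1) b t'(2)] cmp_assoc[OF w(1) t(2) r(2)] yb w cu by simp
  \<comment> \<open>\<open>b \<circledcirc> w\<close> agrees with the identity only after applying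
    \<open>y'\<close>; the difference \<open>d\<close> factors through \<open>x'\<close> and is
    absorbed by adding \<open>x \<circledcirc> a' \<circledcirc> v\<close> to
    \<open>w\<close>.\<close>
  obtain d where d: "d \<in> arr \<C> B' B'" "idm \<C> B' = (b \<circledcirc> w) \<otimes>\<^bsub>Hom \<C> B' B'\<^esub> d"
    using idm_closed bw by (rule difference_exists)
  have "y' \<circledcirc> d = zero_arr \<C> B' C'"
    using cmp_add_right[OF bw d(1) t'(2)] d(2)[symmetric] y t'(2) cmp_closed[OF d(1) t'(2)]
    by (intro add_eq_self[OF t'(2)]) (simp_all add: cmp_idm_right)
  with T' d(1) obtain v where v: "v \<in> arr \<C> B' A'" "d = x' \<circledcirc> v" by (rule lift_zero)
  have av: "a' \<circledcirc> v \<in> arr \<C> B' A" using v(1) r(3) by (rule cmp_closed)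
  have "b \<circledcirc> (x \<circledcirc> (a' \<circledcirc> v)) = x' \<circledcirc> (a \<circledcirc> (a' \<circledcirc> v))"
    using cmp_assoc[OF av t(1) b] cmp_assoc[OF av r(1) t'(1)] bx by simp
  also have "\<dots> = d"
    using cmp_assoc[OF v(1) r(3) r(1)] a' v by (simp add: cmp_idm_left)
  finally have "b \<circledcirc> (w \<otimes>\<^bsub>Hom \<C> B' B\<^esub> (x \<circledcirc> (a' \<circledcirc> v))) = idm \<C> B'"
    using cmp_add_right[OF w(1) cmp_closed[OF av t(1)] b] d(2) by simp
  then show ?thesis using that add_closed[OF w(1) cmp_closed[OF av t(1)]] by blast
qed

lemma five_lemma:
  assumes T: "(A, x, B, y, C, \<delta>) \<in> Etriangles \<C>" and T': "(A', x', B', y', C', \<delta>') \<in> Etriangles \<C>"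
    and a: "a \<in> isos \<C> A A'" and b: "b \<in> arr \<C> B B'" and c: "c \<in> isos \<C> C C'"
    and bx: "b \<circledcirc> x = x' \<circledcirc> a" and yb: "y' \<circledcirc> b = c \<circledcirc> y"
    and ac: "push \<C> C a \<delta> = pull \<C> A' c \<delta>'"
  shows "b \<in> isos \<C> B B'"
proof -
  obtain w where w: "w \<in> arr \<C> B' B" "b \<circledcirc> w = idm \<C> B'"
    using assms by (rule five_right_inverse)
  obtain v where v: "v \<in> arr \<C> B' B" "v \<circledcirc> b = idm \<C> B"
    using extriangulated_category.five_right_inverse[OF extriangulated_category_opp,
        of C' y' B' x' A' \<delta>' C y B x A \<delta> c b a] assms by auto
  show ?thesis using b w(1) v(1) w(2) v(2) by (rule isosI)
qed

text \<open>The axioms realize the pushout along \<open>a'\<close> by some middle term;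
  \<open>five_lemma\<close> identifies it with \<open>B\<close>, so that \<open>B\<close> itself can
  be kept.\<close>

lemma Etriangles_replace_left:
  assumes T: "(A, x, B, y, C, \<delta>) \<in> Etriangles \<C>" and a: "a \<in> isos \<C> A' A"
    and a': "a' \<in> isos \<C> A A'" "a' \<circledcirc> a = idm \<C> A'"
  shows "(A', x \<circledcirc> a, B, y, C, push \<C> C a' \<delta>) \<in> Etriangles \<C>"
proof -
  note t = EtrianglesD[OF T] and r = isos_arr[OF a] isos_arr[OF a'(1)]
  obtain x' B' y' where T': "(A', x', B', y', C, push \<C> C a' \<delta>) \<in> Etriangles \<C>"
    using push_closed[OF r(2) t(3)] by (rule realize)
  note t' = EtrianglesD[OF T']
  have e: "push \<C> C a' \<delta> = pull \<C> A' (idm \<C> C) (push \<C> C a' \<delta>)" using t'(3) by simp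
  then obtain b where b: "b \<in> arr \<C> B B'" "b \<circledcirc> x = x' \<circledcirc> a'" "y' \<circledcirc> b = idm \<C> C \<circledcirc> y"
    using ET2_morphism[OF T T' r(2) idm_closed] by blast
  have "b \<in> isos \<C> B B'" using five_lemma[OF T T' a'(1) b(1) idm_iso b(2,3) e] .
  then obtain b' where b': "b' \<in> isos \<C> B' B" "b' \<circledcirc> b = idm \<C> B" "b \<circledcirc> b' = idm \<C> B'"
    by (rule isos_inverse)
  note q = isos_arr[OF b'(1)]
  have xa: "x \<circledcirc> a \<in> arr \<C> A' B" using r(1) t(1) by (rule cmp_closed)
  have "b \<circledcirc> (x \<circledcirc> a) = x'"
    using cmp_assoc[OF r(1) t(1) b(1)] cmp_assoc[OF r(1) r(2) t'(1)] b a' t' by (simp add: cmp_idm_right)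
  then have "b' \<circledcirc> x' = x \<circledcirc> a"
    using cmp_assoc[OF xa b(1) q] b' xa by (simp add: cmp_idm_left)
  moreover have "y \<circledcirc> b' = y'"
    using cmp_assoc[OF q b(1) t'(2)] b b' t' t by (simp add: cmp_idm_left cmp_idm_right)
  ultimately show ?thesis using Etriangles_cong[OF T' b'(1) xa t(2)] by blast
qed

text \<open>The section is prescribed, since \<open>pushout_triangle\<close> needs a particular one.
  The retraction \<open>r\<close> is read off from \<open>1 - s y\<close>, which factors through
  \<open>x\<close>; the arbitrary retraction \<open>r0\<close> shows that \<open>x\<close> is
  monic.\<close>

lemma split_biproduct:
  assumes T: "(A, x, B, y, C, \<one>\<^bsub>\<EE> \<C> C A\<^esub>) \<in> Etriangles \<C>"
    and s: "s \<in> arr \<C> C B" "y \<circledcirc> s = idm \<C> C"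
  obtains r where "biproduct \<C> A C B x s r y"
proof -
  note t = EtrianglesD[OF T]
  obtain r0 where r0: "r0 \<in> arr \<C> B A" "r0 \<circledcirc> x = idm \<C> A"
    using T idm_closed push_one[OF idm_closed] by (rule extend_push)
  have mono: "u = v" if "u \<in> arr \<C> X A" "v \<in> arr \<C> X A" "x \<circledcirc> u = x \<circledcirc> v" for u v X
    using cmp_assoc[OF that(1) t(1) r0(1)] cmp_assoc[OF that(2) t(1) r0(1)] that r0
    by (simp add: cmp_idm_left)
  have sy: "s \<circledcirc> y \<in> arr \<C> B B" using t(2) s(1) by (rule cmp_closed)
  obtain d where d: "d \<in> arr \<C> B B" "idm \<C> B = (s \<circledcirc> y) \<otimes>\<^bsub>Hom \<C> B B\<^esub> d"
    using idm_closed sy by (rule difference_exists)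
  have "y \<circledcirc> (s \<circledcirc> y) = y" using cmp_assoc[OF t(2) s(1) t(2)] s t by (simp add: cmp_idm_left)
  then have "y \<circledcirc> d = zero_arr \<C> B C"
    using cmp_add_right[OF sy d(1) t(2)] d(2)[symmetric] t(2)
    by (intro add_eq_self[OF t(2) cmp_closed[OF d(1) t(2)]]) (simp add: cmp_idm_right)
  with T d(1) obtain r where r: "r \<in> arr \<C> B A" "d = x \<circledcirc> r" by (rule lift_zero)
  have "(s \<circledcirc> y) \<circledcirc> x = zero_arr \<C> A B"
    using cmp_assoc[OF t(1) t(2) s(1)] Etriangles_comp_zero[OF T] s(1) by simp
  then have "x = d \<circledcirc> x"
    using cmp_add_left[OF t(1) sy d(1)] d(2)[symmetric] t(1) cmp_closed[OF t(1) d(1)] by (simp add: cmp_idm_left)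
  then have "x \<circledcirc> (r \<circledcirc> x) = x \<circledcirc> idm \<C> A"
    using cmp_assoc[OF t(1) r(1) t(1)] r(2) t(1) by (simp add: cmp_idm_right)
  then have rx: "r \<circledcirc> x = idm \<C> A" by (rule mono[OF cmp_closed[OF t(1) r(1)] idm_closed])
  have "(s \<circledcirc> y) \<circledcirc> s = s" using cmp_assoc[OF s(1) t(2) s(1)] s by (simp add: cmp_idm_right)
  then have "d \<circledcirc> s = zero_arr \<C> C B"
    using cmp_add_left[OF s(1) sy d(1)] d(2)[symmetric] s(1)
    by (intro add_eq_self[OF s(1) cmp_closed[OF s(1) d(1)]]) (simp add: cmp_idm_left)
  then have "x \<circledcirc> (r \<circledcirc> s) = x \<circledcirc> zero_arr \<C> C A"
    using cmp_assoc[OF s(1) r(1) t(1)] r(2) t(1) by simp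
  then have rs: "r \<circledcirc> s = zero_arr \<C> C A" by (rule mono[OF cmp_closed[OF s(1) r(1)] zero_closed])
  interpret comm_group "Hom \<C> B B" by (rule Hom_comm_group)
  have "biproduct \<C> A C B x s r y"
    unfolding biproduct_def
    using t(1,2) s r(1) rx rs Etriangles_comp_zero[OF T] d(2) r(2) m_comm[OF sy d(1)] by simp
  then show ?thesis by (rule that)
qed

text \<open>
  The cone \<open>E\<close> of \<open>A \<rightarrow> B2 \<rightarrow> M\<close> is an extension of \<open>C1\<close> by \<open>C2\<close>, split since \<open>y2 x2 = 0\<close>.  A section
  \<open>s\<close> is corrected so that \<open>s\<^sup>*\<delta>'' = \<delta>1\<close>; then the kernel of \<open>M \<rightarrow> E \<rightarrow> C2\<close> is \<open>B1\<close>.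
\<close>

lemma pushout_triangle:
  assumes T1: "(A, x1, B1, y1, C1, \<delta>1) \<in> Etriangles \<C>" and T2: "(A, x2, B2, y2, C2, \<delta>2) \<in> Etriangles \<C>"
    and T3: "(B2, m, M, m', C1, push \<C> C1 x2 \<delta>1) \<in> Etriangles \<C>"
  obtains k k' where "(B1, k, M, k', C2, push \<C> C2 x1 \<delta>2) \<in> Etriangles \<C>"
proof -
  note t1 = EtrianglesD[OF T1] and t2 = EtrianglesD[OF T2] and t3 = EtrianglesD[OF T3]
  obtain E \<delta>'' h d e where E: "(A, m \<circledcirc> x2, M, h, E, \<delta>'') \<in> Etriangles \<C>"
    and D: "(C2, d, E, e, C1, push \<C> C1 y2 (push \<C> C1 x2 \<delta>1)) \<in> Etriangles \<C>"
    and hm: "h \<circledcirc> m = d \<circledcirc> y2" "e \<circledcirc> h = m'"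
    and dd: "pull \<C> A d \<delta>'' = \<delta>2" and ee: "push \<C> E x2 \<delta>'' = pull \<C> B2 e (push \<C> C1 x2 \<delta>1)"
    using ET4[OF T2 T3] by blast
  have "push \<C> C1 y2 (push \<C> C1 x2 \<delta>1) = \<one>\<^bsub>\<EE> \<C> C1 C2\<^esub>"
    using push_push[OF t2(1,2) t1(3)] Etriangles_comp_zero[OF T2] t1(3) by simp
  with D have D: "(C2, d, E, e, C1, \<one>\<^bsub>\<EE> \<C> C1 C2\<^esub>) \<in> Etriangles \<C>" by simp
  note tD = EtrianglesD[OF D] and tE = EtrianglesD[OF E]
  obtain s0 where s0: "s0 \<in> arr \<C> C1 E" "e \<circledcirc> s0 = idm \<C> C1"
    using D idm_closed pull_one[OF idm_closed] by (rule lift_pull)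
  \<comment> \<open>The section \<open>s0\<close> pulls \<open>\<delta>''\<close> back to
    \<open>\<delta>1\<close> up to an error \<open>\<tau>\<close>. By \<open>ee\<close> the error
    dies under pushing along \<open>x2\<close>, so it is a pullback of \<open>\<delta>2\<close>,
    that is, of \<open>\<delta>''\<close> along \<open>d \<circledcirc> t\<close>; adding this map
    to \<open>s0\<close> removes it.\<close>
  have s0d: "pull \<C> A s0 \<delta>'' \<in> carrier (\<EE> \<C> C1 A)" using s0(1) tE(3) by (rule pull_closed)
  obtain \<tau> where \<tau>: "\<tau> \<in> carrier (\<EE> \<C> C1 A)" "\<delta>1 = pull \<C> A s0 \<delta>'' \<otimes>\<^bsub>\<EE> \<C> C1 A\<^esub> \<tau>"
    using t1(3) s0d by (rule EE_difference_exists)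
  have "push \<C> C1 x2 (pull \<C> A s0 \<delta>'') = push \<C> C1 x2 \<delta>1"
    using push_pull[OF t2(1) s0(1) tE(3)] ee pull_pull[OF tD(2) s0(1) t3(3)] s0(2) t3(3) by simp
  then have "push \<C> C1 x2 \<delta>1 = push \<C> C1 x2 \<delta>1 \<otimes>\<^bsub>\<EE> \<C> C1 B2\<^esub> push \<C> C1 x2 \<tau>"
    using hom_mult[OF push_hom[OF t2(1)] s0d \<tau>(1)] \<tau>(2) by simp
  then have "push \<C> C1 x2 \<tau> = \<one>\<^bsub>\<EE> \<C> C1 B2\<^esub>"
    by (rule EE_eq_self[OF t3(3) push_closed[OF t2(1) \<tau>(1)]])
  with T2 \<tau>(1) obtain t where t: "t \<in> arr \<C> C1 C2" "\<tau> = pull \<C> A t \<delta>2" by (rule push_eq_one_pull)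
  have dt: "d \<circledcirc> t \<in> arr \<C> C1 E" using t(1) tD(1) by (rule cmp_closed)
  define s where "s = s0 \<otimes>\<^bsub>Hom \<C> C1 E\<^esub> (d \<circledcirc> t)"
  have s: "s \<in> arr \<C> C1 E" unfolding s_def using s0(1) dt by (rule add_closed)
  have sd: "pull \<C> A s \<delta>'' = \<delta>1"
    using pull_add[OF s0(1) dt tE(3)] pull_pull[OF tD(1) t(1) tE(3)] dd t(2) \<tau>(2) by (simp add: s_def)
  have es: "e \<circledcirc> s = idm \<C> C1"
    using cmp_add_right[OF s0(1) dt tD(2)] cmp_assoc[OF t(1) tD(1,2), symmetric] Etriangles_comp_zero[OF D] s0 t(1)
    by (simp add: s_def idm_closed)
  obtain r where R: "biproduct \<C> C2 C1 E d s r e" using D s es by (rule split_biproduct)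
  note r = biproductD[OF R]
  obtain K \<epsilon> k d2 e2 where K: "(K, k, M, r \<circledcirc> h, C2, \<epsilon>) \<in> Etriangles \<C>"
    and F: "(A, e2, K, d2, C1, pull \<C> A s \<delta>'') \<in> Etriangles \<C>"
    and \<epsilon>: "pull \<C> K r \<epsilon> = push \<C> E e2 \<delta>''"
    using ET4_op[OF ET2_zero[OF biproduct_swap[OF R]] E] by blast
  note tK = EtrianglesD[OF K] and tF = EtrianglesD[OF F]
  obtain b where b: "b \<in> isos \<C> B1 K" "b \<circledcirc> x1 = e2" "d2 \<circledcirc> b = y1"
    using T1 F unfolding sd by (rule Etriangles_seq_equiv)
  obtain b' where b': "b' \<in> isos \<C> K B1" "b' \<circledcirc> b = idm \<C> B1" using b(1) by (rule isos_inverse)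
  \<comment> \<open>As \<open>r\<close> splits \<open>d\<close>, the class \<open>\<epsilon>\<close>
    is recovered from its pullback along \<open>r\<close>, a pushout of \<open>\<delta>''\<close>.
    So \<open>\<epsilon>\<close> is the pushout of \<open>\<delta>2\<close> along \<open>e2\<close>,
    which \<open>b'\<close> turns into \<open>x1\<close>.\<close>
  have "\<epsilon> = pull \<C> K d (pull \<C> K r \<epsilon>)"
    using pull_pull[OF r(3) r(1) tK(3)] r(5) tK(3) by simp
  also have "\<dots> = push \<C> C2 e2 \<delta>2"
    using push_pull[OF tF(1) tD(1) tE(3)] dd \<epsilon> by simp
  finally have "push \<C> C2 b' \<epsilon> = push \<C> C2 (b' \<circledcirc> e2) \<delta>2"
    using push_push[OF tF(1) isos_arr[OF b'(1)] t2(3)] by simp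
  also have "b' \<circledcirc> e2 = x1"
    using cmp_assoc[OF t1(1) isos_arr[OF b(1)] isos_arr[OF b'(1)]] b b' t1(1) by (simp add: cmp_idm_left)
  finally show ?thesis
    using Etriangles_replace_left[OF K b(1) b'] that by simp
qed

lemma pullback_triangle:
  assumes "(A1, x1, B1, y1, C, \<delta>1) \<in> Etriangles \<C>" "(A2, x2, B2, y2, C, \<delta>2) \<in> Etriangles \<C>"
    and "(A1, m, M, m', B2, pull \<C> A1 y2 \<delta>1) \<in> Etriangles \<C>"
  obtains k k' where "(A2, k, M, k', B1, pull \<C> A2 y1 \<delta>2) \<in> Etriangles \<C>"
proof -
  have "(C, y1, B1, x1, A1, \<delta>1) \<in> Etriangles (opp \<C>)" "(C, y2, B2, x2, A2, \<delta>2) \<in> Etriangles (opp \<C>)"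
    "(B2, m', M, m, A1, push (opp \<C>) A1 y2 \<delta>1) \<in> Etriangles (opp \<C>)"
    using assms by simp_all
  then obtain k k' where "(B1, k, M, k', A2, push (opp \<C>) A2 y1 \<delta>2) \<in> Etriangles (opp \<C>)"
    by (rule extriangulated_category.pushout_triangle[OF extriangulated_category_opp])
  then show ?thesis using that by simp
qed

end

section \<open>Extensions in a proper class\<close>

context proper_class
begin

text \<open>Membership of a triangle in \<open>\<xi>\<close> depends on its extension alone
  (\<open>xiI\<close>), so \<open>\<xi>\<close> is handled as a part of \<open>\<EE>\<close> stable
  under pushing and pulling.\<close>

definition Xi :: "'o \<Rightarrow> 'o \<Rightarrow> 'e set" where
  "Xi C A = {\<delta>. \<exists>x B y. (A, x, B, y, C, \<delta>) \<in> \<xi>}"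

lemma xi_Etriangles: "t \<in> \<xi> \<Longrightarrow> t \<in> Etriangles \<C>"
  using subset_Etriangles by blast

lemma Xi_carrier: "\<delta> \<in> Xi C A \<Longrightarrow> \<delta> \<in> carrier (\<EE> \<C> C A)"
  using xi_Etriangles EtrianglesD(3) by (fastforce simp: Xi_def)

lemma xi_Xi: "(A, x, B, y, C, \<delta>) \<in> \<xi> \<Longrightarrow> \<delta> \<in> Xi C A"
  by (auto simp: Xi_def)

lemma xiI:
  assumes "(A, x, B, y, C, \<delta>) \<in> Etriangles \<C>" "\<delta> \<in> Xi C A"
  shows "(A, x, B, y, C, \<delta>) \<in> \<xi>"
proof -
  obtain x' B' y' where "(A, x', B', y', C, \<delta>) \<in> \<xi>" using assms(2) by (auto simp: Xi_def)
  from base_change[OF this idm_closed, of x B y] assms Xi_carrier[OF assms(2)] show ?thesis by simp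
qed

lemma Xi_realize:
  assumes "\<delta> \<in> Xi C A"
  obtains x B y where "(A, x, B, y, C, \<delta>) \<in> \<xi>"
  using assms by (auto simp: Xi_def)

lemma Xi_pull:
  assumes d: "\<delta> \<in> Xi C A" and c: "c \<in> arr \<C> C' C"
  shows "pull \<C> A c \<delta> \<in> Xi C' A"
proof -
  obtain x B y where "(A, x, B, y, C', pull \<C> A c \<delta>) \<in> Etriangles \<C>"
    using pull_closed[OF c Xi_carrier[OF d]] by (rule realize)
  then show ?thesis using d c base_change xi_Xi by (meson Xi_realize)
qed

lemma Xi_push:
  assumes d: "\<delta> \<in> Xi C A" and a: "a \<in> arr \<C> A A'"
  shows "push \<C> C a \<delta> \<in> Xi C A'"
proof -
  obtain x B y where "(A', x, B, y, C, push \<C> C a \<delta>) \<in> Etriangles \<C>"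
    using push_closed[OF a Xi_carrier[OF d]] by (rule realize)
  then show ?thesis using d a cobase_change xi_Xi by (meson Xi_realize)
qed

text \<open>
  Saturation is applied to the deflation realizing \<open>f\<^sub>*\<delta>'' = e\<^sup>*\<delta>'\<close>: the pullback of \<open>\<delta>''\<close> along it is
  killed by \<open>f\<^sub>*\<close>, hence is itself a pullback of \<open>\<delta>\<close>.
\<close>

lemma xi_ET4:
  assumes T: "(A, f, B, f', D, \<delta>) \<in> \<xi>" and T': "(B, g, C, g', F, \<delta>') \<in> \<xi>"
  obtains E \<delta>'' h d e where "(A, g \<circledcirc> f, C, h, E, \<delta>'') \<in> \<xi>" "(D, d, E, e, F, push \<C> F f' \<delta>') \<in> \<xi>"
    "h \<circledcirc> g = d \<circledcirc> f'" "e \<circledcirc> h = g'"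
proof -
  obtain E \<delta>'' h d e where E: "(A, g \<circledcirc> f, C, h, E, \<delta>'') \<in> Etriangles \<C>"
    and D: "(D, d, E, e, F, push \<C> F f' \<delta>') \<in> Etriangles \<C>"
    and h: "h \<circledcirc> g = d \<circledcirc> f'" "e \<circledcirc> h = g'"
    and ff: "push \<C> E f \<delta>'' = pull \<C> B e \<delta>'"
    using ET4[OF T[THEN xi_Etriangles] T'[THEN xi_Etriangles]] by blast
  note t = EtrianglesD[OF T[THEN xi_Etriangles]] and tE = EtrianglesD[OF E] and tD = EtrianglesD[OF D]
  have "pull \<C> B e \<delta>' \<in> Xi E B" using xi_Xi[OF T'] tD(2) by (rule Xi_pull)
  then obtain n M y where M: "(B, n, M, y, E, pull \<C> B e \<delta>') \<in> \<xi>" by (rule Xi_realize)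
  note tM = EtrianglesD[OF M[THEN xi_Etriangles]]
  have y\<delta>: "pull \<C> A y \<delta>'' \<in> carrier (\<EE> \<C> M A)" using tM(2) tE(3) by (rule pull_closed)
  have "push \<C> M f (pull \<C> A y \<delta>'') = \<one>\<^bsub>\<EE> \<C> M B\<^esub>"
    using push_pull[OF t(1) tM(2) tE(3)] ff pull_deflation[OF M[THEN xi_Etriangles]] by simp
  with T[THEN xi_Etriangles] y\<delta> obtain c where "c \<in> arr \<C> M D" "pull \<C> A y \<delta>'' = pull \<C> A c \<delta>"
    by (rule push_eq_one_pull)
  then have "pull \<C> A y \<delta>'' \<in> Xi M A" using Xi_pull[OF xi_Xi[OF T]] by simp
  then obtain m M' m' where "(A, m, M', m', M, pull \<C> A y \<delta>'') \<in> \<xi>" by (rule Xi_realize)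
  then have "(A, g \<circledcirc> f, C, h, E, \<delta>'') \<in> \<xi>" by (rule saturated[OF E M])
  moreover have "(D, d, E, e, F, push \<C> F f' \<delta>') \<in> \<xi>"
    using D Xi_push[OF xi_Xi[OF T'] t(2)] by (rule xiI)
  ultimately show ?thesis using h by (rule that)
qed

text \<open>Saturation applies directly, with \<open>f\<close> as the deflation: the pullback of
  \<open>\<delta>''\<close> along \<open>f\<close> is a pushout of \<open>\<delta>'\<close>, hence
  in \<open>\<xi>\<close>.\<close>

lemma xi_ET4_op:
  assumes T: "(D, f', B, f, A, \<delta>) \<in> \<xi>" and T': "(F, g', C, g, B, \<delta>') \<in> \<xi>"
  obtains E \<delta>'' h d e where "(E, h, C, f \<circledcirc> g, A, \<delta>'') \<in> \<xi>" "(F, e, E, d, D, pull \<C> F f' \<delta>') \<in> \<xi>"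
proof -
  obtain E \<delta>'' h d e where E: "(E, h, C, f \<circledcirc> g, A, \<delta>'') \<in> Etriangles \<C>"
    and D: "(F, e, E, d, D, pull \<C> F f' \<delta>') \<in> Etriangles \<C>"
    and ff: "pull \<C> E f \<delta>'' = push \<C> B e \<delta>'"
    using ET4_op[OF T[THEN xi_Etriangles] T'[THEN xi_Etriangles]] by blast
  note t = EtrianglesD[OF T[THEN xi_Etriangles]] and tD = EtrianglesD[OF D]
  have "pull \<C> E f \<delta>'' \<in> Xi B E" using Xi_push[OF xi_Xi[OF T'] tD(1)] ff by simp
  then obtain m M m' where "(E, m, M, m', B, pull \<C> E f \<delta>'') \<in> \<xi>" by (rule Xi_realize)
  then have "(E, h, C, f \<circledcirc> g, A, \<delta>'') \<in> \<xi>" by (rule saturated[OF E T])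
  moreover have "(F, e, E, d, D, pull \<C> F f' \<delta>') \<in> \<xi>"
    using D Xi_pull[OF xi_Xi[OF T'] t(1)] by (rule xiI)
  ultimately show ?thesis by (rule that)
qed

section \<open>Pushouts, pullbacks and horseshoes within the proper class\<close>

lemma biproduct_xi:
  assumes "biproduct \<C> A C S i j p q"
  shows "(A, i, S, q, C, \<one>\<^bsub>\<EE> \<C> C A\<^esub>) \<in> \<xi>" "(C, j, S, p, A, \<one>\<^bsub>\<EE> \<C> A C\<^esub>) \<in> \<xi>"
  using split_in[OF ET2_zero[OF assms]] split_in[OF ET2_zero[OF biproduct_swap[OF assms]]] .

lemma xi_pushout:
  assumes T1: "(A, x1, B1, y1, C1, \<delta>1) \<in> \<xi>" and T2: "(A, x2, B2, y2, C2, \<delta>2) \<in> \<xi>"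
    and T3: "(B2, m, M, m', C1, push \<C> C1 x2 \<delta>1) \<in> \<xi>"
  obtains k k' \<delta> where "(B1, k, M, k', C2, \<delta>) \<in> \<xi>"
proof -
  obtain k k' where "(B1, k, M, k', C2, push \<C> C2 x1 \<delta>2) \<in> Etriangles \<C>"
    using assms[THEN xi_Etriangles] by (rule pushout_triangle)
  moreover have "push \<C> C2 x1 \<delta>2 \<in> Xi C2 B1"
    using xi_Xi[OF T2] EtrianglesD(1)[OF T1[THEN xi_Etriangles]] by (rule Xi_push)
  ultimately show ?thesis using xiI that by blast
qed

lemma xi_pullback:
  assumes T1: "(A1, x1, B1, y1, C, \<delta>1) \<in> \<xi>" and T2: "(A2, x2, B2, y2, C, \<delta>2) \<in> \<xi>"
    and T3: "(A1, m, M, m', B2, pull \<C> A1 y2 \<delta>1) \<in> \<xi>"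
  obtains k k' \<delta> where "(A2, k, M, k', B1, \<delta>) \<in> \<xi>"
proof -
  obtain k k' where "(A2, k, M, k', B1, pull \<C> A2 y1 \<delta>2) \<in> Etriangles \<C>"
    using assms[THEN xi_Etriangles] by (rule pullback_triangle)
  moreover have "pull \<C> A2 y1 \<delta>2 \<in> Xi B1 A2"
    using xi_Xi[OF T2] EtrianglesD(2)[OF T1[THEN xi_Etriangles]] by (rule Xi_pull)
  ultimately show ?thesis using xiI that by blast
qed

text \<open>The pushout of \<open>T\<close> along \<open>a\<close> splits by assumption, which gives
  \<open>P \<rightarrow> X \<oplus> C \<rightarrow> K\<close>; pushing out along \<open>c\<close>
  gives \<open>X \<oplus> C \<rightarrow> X \<oplus> Y \<rightarrow> L\<close>.
  \<open>xi_ET4\<close> composes the two inflations.\<close>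

lemma horseshoe_right:
  assumes T: "(A, x, P, y, C, \<delta>) \<in> \<xi>" and TA: "(A, a, X, a', K, \<epsilon>) \<in> \<xi>"
    and TC: "(C, c, Y, c', L, \<phi>) \<in> \<xi>" and a\<delta>: "push \<C> C a \<delta> = \<one>\<^bsub>\<EE> \<C> C X\<^esub>"
  obtains i j p q M W g h d e \<epsilon>1 \<epsilon>2
  where "biproduct \<C> X Y M i j p q" "(P, g, M, h, W, \<epsilon>1) \<in> \<xi>" "(K, d, W, e, L, \<epsilon>2) \<in> \<xi>"
proof -
  note tC = EtrianglesD[OF TC[THEN xi_Etriangles]]
  obtain S i j p q where S: "biproduct \<C> X C S i j p q" using biproduct_exists by blast
  have "(X, i, S, q, C, push \<C> C a \<delta>) \<in> \<xi>" using biproduct_xi(1)[OF S] a\<delta> by simp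
  with T TA obtain k k' \<beta> where P: "(P, k, S, k', K, \<beta>) \<in> \<xi>" by (rule xi_pushout)
  obtain M i' j' p' q' where M: "biproduct \<C> X Y M i' j' p' q'" using biproduct_exists by blast
  have "(Y, j', M, p', X, push \<C> X c \<one>\<^bsub>\<EE> \<C> X C\<^esub>) \<in> \<xi>"
    using biproduct_xi(2)[OF M] tC by simp
  with biproduct_xi(2)[OF S] TC obtain l l' \<gamma> where "(S, l, M, l', L, \<gamma>) \<in> \<xi>" by (rule xi_pushout)
  with P show ?thesis using that[OF M] by (rule xi_ET4)
qed

text \<open>The dual construction, through \<open>A \<oplus> Y\<close>. For injective
  \<open>Y\<close> the splitting along \<open>c'\<close> is not automatic, unlike the one along
  \<open>a\<close> for injective \<open>X\<close>; it will come from
  \<open>A \<in> orth\<close>.\<close>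

lemma horseshoe_left:
  assumes T: "(A, x, P, y, C, \<delta>) \<in> \<xi>" and TA: "(K, a, X, a', A, \<epsilon>) \<in> \<xi>"
    and TC: "(L, c, Y, c', C, \<phi>) \<in> \<xi>" and c\<delta>: "pull \<C> A c' \<delta> = \<one>\<^bsub>\<EE> \<C> Y A\<^esub>"
  obtains i j p q M W g h d e \<epsilon>1 \<epsilon>2
  where "biproduct \<C> X Y M i j p q" "(W, g, M, h, P, \<epsilon>1) \<in> \<xi>" "(K, d, W, e, L, \<epsilon>2) \<in> \<xi>"
proof -
  note tA = EtrianglesD[OF TA[THEN xi_Etriangles]]
  obtain S i j p q where S: "biproduct \<C> A Y S i j p q" using biproduct_exists by blast
  have "(A, i, S, q, Y, pull \<C> A c' \<delta>) \<in> \<xi>" using biproduct_xi(1)[OF S] c\<delta> by simp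
  with T TC obtain k k' \<beta> where P: "(L, k, S, k', P, \<beta>) \<in> \<xi>" by (rule xi_pullback)
  obtain M i' j' p' q' where M: "biproduct \<C> X Y M i' j' p' q'" using biproduct_exists by blast
  have "(Y, j', M, p', X, pull \<C> Y a' \<one>\<^bsub>\<EE> \<C> A Y\<^esub>) \<in> \<xi>"
    using biproduct_xi(2)[OF M] tA by simp
  with biproduct_xi(2)[OF S] TA obtain l l' \<gamma> where "(K, l, M, l', S, \<gamma>) \<in> \<xi>" by (rule xi_pullback)
  with P show ?thesis using that[OF M] by (rule xi_ET4_op)
qed

section \<open>Relative injective objects\<close>

lemma Inj_extend:
  assumes "I \<in> Inj \<C> \<xi>" "(A, x, B, y, C, \<delta>) \<in> \<xi>" "u \<in> arr \<C> A I"
  obtains v where "v \<in> arr \<C> B I" "v \<circledcirc> x = u"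
proof -
  have "exact_into \<C> I (A, x, B, y, C, \<delta>)" using assms by (auto simp: Inj_def)
  then have "(\<lambda>u. u \<circledcirc> x) ` arr \<C> B I = arr \<C> A I"
    by (auto simp: short_exact_sequence_iff epi_def mon_def)
  then have "u \<in> (\<lambda>u. u \<circledcirc> x) ` arr \<C> B I" using assms(3) by blast
  then show ?thesis using that by blast
qed

lemma Inj_cancel:
  assumes "I \<in> Inj \<C> \<xi>" "(A, x, B, y, C, \<delta>) \<in> \<xi>" "v \<in> arr \<C> C I" "v \<circledcirc> y = zero_arr \<C> B I"
  shows "v = zero_arr \<C> C I"
proof -
  have "exact_into \<C> I (A, x, B, y, C, \<delta>)" using assms by (auto simp: Inj_def)
  then have inj: "inj_on (\<lambda>u. u \<circledcirc> y) (arr \<C> C I)"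
    by (auto simp: short_exact_sequence_iff epi_def mon_def)
  show ?thesis
    using assms(4) EtrianglesD(2)[OF assms(2)[THEN xi_Etriangles]]
    by (intro inj_onD[OF inj _ assms(3) zero_closed]) simp
qed

text \<open>Exactness in the middle holds for every triangle by \<open>extend_zero\<close>, which
  leaves the two ends to be checked; \<open>exact_fromI\<close> is dual.\<close>

lemma exact_intoI:
  assumes T: "(A, x, B, y, C, \<delta>) \<in> Etriangles \<C>"
    and ext: "\<And>u. u \<in> arr \<C> A W \<Longrightarrow> \<exists>v \<in> arr \<C> B W. v \<circledcirc> x = u"
    and canc: "\<And>v. \<lbrakk>v \<in> arr \<C> C W; v \<circledcirc> y = zero_arr \<C> B W\<rbrakk> \<Longrightarrow> v = zero_arr \<C> C W"
  shows "exact_into \<C> W (A, x, B, y, C, \<delta>)"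
proof -
  note t = EtrianglesD[OF T]
  have hx: "group_hom (Hom \<C> B W) (Hom \<C> A W) (\<lambda>u. u \<circledcirc> x)"
    and hy: "group_hom (Hom \<C> C W) (Hom \<C> B W) (\<lambda>u. u \<circledcirc> y)"
    using cmp_hom_right t Hom_group by (auto simp: group_hom_def group_hom_axioms_def)
  have "kernel (Hom \<C> B W) (Hom \<C> A W) (\<lambda>u. u \<circledcirc> x) = (\<lambda>u. u \<circledcirc> y) ` arr \<C> C W"
  proof (intro subset_antisym subsetI)
    fix u assume "u \<in> kernel (Hom \<C> B W) (Hom \<C> A W) (\<lambda>u. u \<circledcirc> x)"
    then have u: "u \<in> arr \<C> B W" "u \<circledcirc> x = zero_arr \<C> A W" by (auto simp: kernel_def)
    then obtain v where "v \<in> arr \<C> C W" "u = v \<circledcirc> y" by (rule extend_zero[OF T])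
    then show "u \<in> (\<lambda>u. u \<circledcirc> y) ` arr \<C> C W" by blast
  next
    fix u assume "u \<in> (\<lambda>u. u \<circledcirc> y) ` arr \<C> C W"
    then obtain v where "v \<in> arr \<C> C W" "u = v \<circledcirc> y" by blast
    then show "u \<in> kernel (Hom \<C> B W) (Hom \<C> A W) (\<lambda>u. u \<circledcirc> x)"
      using cmp_assoc[OF t(1,2)] Etriangles_comp_zero[OF T] t cmp_closed by (auto simp: kernel_def)
  qed
  moreover have "inj_on (\<lambda>u. u \<circledcirc> y) (arr \<C> C W)"
    using group_hom.inj_on_one_iff[OF hy] canc by blast
  moreover have "(\<lambda>u. u \<circledcirc> x) ` arr \<C> B W = arr \<C> A W"
    using ext t cmp_closed by blast
  ultimately show ?thesis
    using hx hy by (auto simp: short_exact_sequence_iff epi_def mon_def group_hom_def group_hom_axioms_def)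
qed

lemma exact_fromI:
  assumes T: "(A, x, B, y, C, \<delta>) \<in> Etriangles \<C>"
    and lift: "\<And>c. c \<in> arr \<C> W C \<Longrightarrow> \<exists>u \<in> arr \<C> W B. y \<circledcirc> u = c"
    and canc: "\<And>v. \<lbrakk>v \<in> arr \<C> W A; x \<circledcirc> v = zero_arr \<C> W B\<rbrakk> \<Longrightarrow> v = zero_arr \<C> W A"
  shows "exact_from \<C> W (A, x, B, y, C, \<delta>)"
proof -
  note t = EtrianglesD[OF T]
  have hx: "group_hom (Hom \<C> W A) (Hom \<C> W B) (\<lambda>u. x \<circledcirc> u)"
    and hy: "group_hom (Hom \<C> W B) (Hom \<C> W C) (\<lambda>u. y \<circledcirc> u)"
    using cmp_hom_left t Hom_group by (auto simp: group_hom_def group_hom_axioms_def)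
  have "kernel (Hom \<C> W B) (Hom \<C> W C) (\<lambda>u. y \<circledcirc> u) = (\<lambda>u. x \<circledcirc> u) ` arr \<C> W A"
  proof (intro subset_antisym subsetI)
    fix u assume "u \<in> kernel (Hom \<C> W B) (Hom \<C> W C) (\<lambda>u. y \<circledcirc> u)"
    then have u: "u \<in> arr \<C> W B" "y \<circledcirc> u = zero_arr \<C> W C" by (auto simp: kernel_def)
    then obtain v where "v \<in> arr \<C> W A" "u = x \<circledcirc> v" by (rule lift_zero[OF T])
    then show "u \<in> (\<lambda>u. x \<circledcirc> u) ` arr \<C> W A" by blast
  next
    fix u assume "u \<in> (\<lambda>u. x \<circledcirc> u) ` arr \<C> W A"
    then obtain v where v: "v \<in> arr \<C> W A" "u = x \<circledcirc> v" by blast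
    then show "u \<in> kernel (Hom \<C> W B) (Hom \<C> W C) (\<lambda>u. y \<circledcirc> u)"
      using cmp_assoc[OF v(1) t(1,2)] Etriangles_comp_zero[OF T] t cmp_closed by (auto simp: kernel_def)
  qed
  moreover have "inj_on (\<lambda>u. x \<circledcirc> u) (arr \<C> W A)"
    using group_hom.inj_on_one_iff[OF hx] canc by blast
  moreover have "(\<lambda>u. y \<circledcirc> u) ` arr \<C> W B = arr \<C> W C"
    using lift t cmp_closed by blast
  ultimately show ?thesis
    using hx hy by (auto simp: short_exact_sequence_iff epi_def mon_def group_hom_def group_hom_axioms_def)
qed

text \<open>The identity of \<open>I\<close> extends over the inflation of a realization, so pushing
  \<open>\<theta>\<close> along it gives the split extension.\<close>

lemma Inj_Xi:
  assumes I: "I \<in> Inj \<C> \<xi>" and \<theta>: "\<theta> \<in> Xi C I"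
  shows "\<theta> = \<one>\<^bsub>\<EE> \<C> C I\<^esub>"
proof -
  obtain x B y where T: "(I, x, B, y, C, \<theta>) \<in> \<xi>" using \<theta> by (rule Xi_realize)
  obtain v where "v \<in> arr \<C> B I" "v \<circledcirc> x = idm \<C> I" using I T idm_closed by (rule Inj_extend)
  then show ?thesis
    using push_cmp_inflation[OF T[THEN xi_Etriangles], of v I] Xi_carrier[OF \<theta>] by simp
qed

lemma Inj_biproduct:
  assumes S: "biproduct \<C> I J S i j p q" and I: "I \<in> Inj \<C> \<xi>" and J: "J \<in> Inj \<C> \<xi>"
  shows "S \<in> Inj \<C> \<xi>"
proof -
  note s = biproductD[OF S]
  have dec: "u = (i \<circledcirc> (p \<circledcirc> u)) \<otimes>\<^bsub>Hom \<C> X S\<^esub> (j \<circledcirc> (q \<circledcirc> u))" if u: "u \<in> arr \<C> X S" for u X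
    using cmp_add_left[OF u cmp_closed[OF s(3,1)] cmp_closed[OF s(4,2)]] s(9)
      cmp_assoc[OF u s(3,1)] cmp_assoc[OF u s(4,2)] u by (simp add: cmp_idm_left)
  have "exact_into \<C> S (A, x, B, y, C, \<delta>)" if T: "(A, x, B, y, C, \<delta>) \<in> \<xi>" for A x B y C \<delta>
  proof (rule exact_intoI[OF T[THEN xi_Etriangles]])
    note t = EtrianglesD[OF T[THEN xi_Etriangles]]
    fix u assume u: "u \<in> arr \<C> A S"
    obtain v where v: "v \<in> arr \<C> B I" "v \<circledcirc> x = p \<circledcirc> u"
      using I T cmp_closed[OF u s(3)] by (rule Inj_extend)
    obtain w where w: "w \<in> arr \<C> B J" "w \<circledcirc> x = q \<circledcirc> u"
      using J T cmp_closed[OF u s(4)] by (rule Inj_extend)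
    have c: "i \<circledcirc> v \<in> arr \<C> B S" "j \<circledcirc> w \<in> arr \<C> B S"
      using cmp_closed[OF v(1) s(1)] cmp_closed[OF w(1) s(2)] by blast+
    have "((i \<circledcirc> v) \<otimes>\<^bsub>Hom \<C> B S\<^esub> (j \<circledcirc> w)) \<circledcirc> x = u"
      using cmp_add_left[OF t(1) c] cmp_assoc[OF t(1) v(1) s(1)] cmp_assoc[OF t(1) w(1) s(2)]
        v(2) w(2) dec[OF u] by simp
    then show "\<exists>v\<in>arr \<C> B S. v \<circledcirc> x = u" using add_closed[OF c] by blast
  next
    note t = EtrianglesD[OF T[THEN xi_Etriangles]]
    fix v assume v: "v \<in> arr \<C> C S" "v \<circledcirc> y = zero_arr \<C> B S"
    have "p \<circledcirc> v = zero_arr \<C> C I"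
      using cmp_assoc[OF t(2) v(1) s(3)] v(2) s(3) by (intro Inj_cancel[OF I T cmp_closed[OF v(1) s(3)]]) simp
    moreover have "q \<circledcirc> v = zero_arr \<C> C J"
      using cmp_assoc[OF t(2) v(1) s(4)] v(2) s(4) by (intro Inj_cancel[OF J T cmp_closed[OF v(1) s(4)]]) simp
    ultimately show "v = zero_arr \<C> C S" using dec[OF v(1)] s by simp
  qed
  then show ?thesis unfolding Inj_def by (auto simp del: exact_into.simps)
qed

lemma zero_Inj:
  assumes Z: "is_zero \<C> Z"
  shows "Z \<in> Inj \<C> \<xi>"
proof -
  have "exact_into \<C> Z (A, x, B, y, C, \<delta>)" if T: "(A, x, B, y, C, \<delta>) \<in> \<xi>" for A x B y C \<delta>
  proof (rule exact_intoI[OF T[THEN xi_Etriangles]])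
    fix u assume "u \<in> arr \<C> A Z"
    then show "\<exists>v\<in>arr \<C> B Z. v \<circledcirc> x = u"
      using is_zero_arr(1)[OF Z] EtrianglesD[OF T[THEN xi_Etriangles]] by (metis cmp_zero_left zero_closed)
  qed (rule is_zero_arr(1)[OF Z])
  then show ?thesis unfolding Inj_def by (auto simp del: exact_into.simps)
qed

section \<open>Gorenstein injective objects\<close>

text \<open>
  The first condition makes \<open>\<C>(I,A) \<rightarrow> \<C>(I,B)\<close> injective for every triangle \<open>A \<rightarrow> B \<rightarrow> C\<close> in \<open>\<xi>\<close>
  (which is not automatic, as there is no term preceding \<open>\<C>(I,A)\<close> in the long exact sequence), the
  second one makes \<open>\<C>(I,B) \<rightarrow> \<C>(I,C)\<close> surjective.
\<close>

definition orth :: "'o set" where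
  "orth = {A. \<forall>I \<in> Inj \<C> \<xi>.
     (\<forall>u \<in> arr \<C> I A. (\<forall>J \<in> Inj \<C> \<xi>. \<forall>q \<in> arr \<C> A J. q \<circledcirc> u = zero_arr \<C> I J) \<longrightarrow> u = zero_arr \<C> I A) \<and>
     Xi I A \<subseteq> {\<one>\<^bsub>\<EE> \<C> I A\<^esub>}}"

lemma orthI:
  assumes "\<And>I u. \<lbrakk>I \<in> Inj \<C> \<xi>; u \<in> arr \<C> I A;
      \<And>J q. \<lbrakk>J \<in> Inj \<C> \<xi>; q \<in> arr \<C> A J\<rbrakk> \<Longrightarrow> q \<circledcirc> u = zero_arr \<C> I J\<rbrakk> \<Longrightarrow> u = zero_arr \<C> I A"
    and "\<And>I \<theta>. \<lbrakk>I \<in> Inj \<C> \<xi>; \<theta> \<in> Xi I A\<rbrakk> \<Longrightarrow> \<theta> = \<one>\<^bsub>\<EE> \<C> I A\<^esub>"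
  shows "A \<in> orth"
  using assms by (auto simp: orth_def)

lemma orth_null:
  assumes "A \<in> orth" "I \<in> Inj \<C> \<xi>" "u \<in> arr \<C> I A"
    and "\<And>J q. \<lbrakk>J \<in> Inj \<C> \<xi>; q \<in> arr \<C> A J\<rbrakk> \<Longrightarrow> q \<circledcirc> u = zero_arr \<C> I J"
  shows "u = zero_arr \<C> I A"
  using assms unfolding orth_def by blast

lemma orth_Xi: "\<lbrakk>A \<in> orth; I \<in> Inj \<C> \<xi>; \<theta> \<in> Xi I A\<rbrakk> \<Longrightarrow> \<theta> = \<one>\<^bsub>\<EE> \<C> I A\<^esub>"
  unfolding orth_def by blast

lemma orth_lift:
  assumes A: "A \<in> orth" and T: "(A, x, B, y, C, \<delta>) \<in> \<xi>" and I: "I \<in> Inj \<C> \<xi>" and c: "c \<in> arr \<C> I C"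
  obtains u where "u \<in> arr \<C> I B" "y \<circledcirc> u = c"
  using T[THEN xi_Etriangles] c orth_Xi[OF A I Xi_pull[OF xi_Xi[OF T] c]] by (rule lift_pull)

text \<open>Lifting is the vanishing of \<open>Xi I A\<close>. For injectivity, every map from
  \<open>A\<close> to an injective extends over \<open>x\<close>, hence kills \<open>u\<close> once
  \<open>x\<close> does.\<close>

lemma orth_exact_from:
  assumes A: "A \<in> orth" and T: "(A, x, B, y, C, \<delta>) \<in> \<xi>" and I: "I \<in> Inj \<C> \<xi>"
  shows "exact_from \<C> I (A, x, B, y, C, \<delta>)"
proof (rule exact_fromI[OF T[THEN xi_Etriangles]])
  show "\<exists>u \<in> arr \<C> I B. y \<circledcirc> u = c" if "c \<in> arr \<C> I C" for c
    using orth_lift[OF A T I that] by blast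
next
  note t = EtrianglesD[OF T[THEN xi_Etriangles]]
  fix u assume u: "u \<in> arr \<C> I A" "x \<circledcirc> u = zero_arr \<C> I B"
  show "u = zero_arr \<C> I A"
  proof (rule orth_null[OF A I u(1)])
    fix J q assume "J \<in> Inj \<C> \<xi>" "q \<in> arr \<C> A J"
    with T obtain v where v: "v \<in> arr \<C> B J" "v \<circledcirc> x = q" by (metis Inj_extend)
    then show "q \<circledcirc> u = zero_arr \<C> I J" using cmp_assoc[OF u(1) t(1) v(1)] u(2) by simp
  qed
qed

text \<open>A map into \<open>P\<close> is tested first on \<open>C\<close>, then on
  \<open>A\<close>. For extensions, \<open>xi_ET4\<close> factors the deflation
  \<open>Q \<rightarrow> I\<close> into deflations \<open>Q \<rightarrow> E\<close> and
  \<open>E \<rightarrow> I\<close> with first terms \<open>A\<close> and \<open>C\<close>, and the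
  identity of \<open>I\<close> is lifted through both.\<close>

lemma orth_extension:
  assumes T: "(A, x, P, y, C, \<delta>) \<in> \<xi>" and A: "A \<in> orth" and C: "C \<in> orth"
  shows "P \<in> orth"
proof (rule orthI)
  note t = EtrianglesD[OF T[THEN xi_Etriangles]]
  fix I u assume I: "I \<in> Inj \<C> \<xi>" and u: "u \<in> arr \<C> I P"
    and null: "\<And>J q. \<lbrakk>J \<in> Inj \<C> \<xi>; q \<in> arr \<C> P J\<rbrakk> \<Longrightarrow> q \<circledcirc> u = zero_arr \<C> I J"
  have "y \<circledcirc> u = zero_arr \<C> I C"
  proof (rule orth_null[OF C I cmp_closed[OF u t(2)]])
    fix J q assume q: "J \<in> Inj \<C> \<xi>" "q \<in> arr \<C> C J"
    show "q \<circledcirc> (y \<circledcirc> u) = zero_arr \<C> I J"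
      using cmp_assoc[OF u t(2) q(2)] null[OF q(1) cmp_closed[OF t(2) q(2)]] by simp
  qed
  with T[THEN xi_Etriangles] u obtain v where v: "v \<in> arr \<C> I A" "u = x \<circledcirc> v" by (rule lift_zero)
  have "v = zero_arr \<C> I A"
  proof (rule orth_null[OF A I v(1)])
    fix J q assume q: "J \<in> Inj \<C> \<xi>" "q \<in> arr \<C> A J"
    obtain w where w: "w \<in> arr \<C> P J" "w \<circledcirc> x = q" using q(1) T q(2) by (rule Inj_extend)
    then show "q \<circledcirc> v = zero_arr \<C> I J"
      using cmp_assoc[OF v(1) t(1) w(1)] null[OF q(1) w(1)] v(2) by simp
  qed
  then show "u = zero_arr \<C> I P" using v(2) t(1) by simp
next
  note t = EtrianglesD[OF T[THEN xi_Etriangles]]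
  fix I \<theta> assume I: "I \<in> Inj \<C> \<xi>" and \<theta>: "\<theta> \<in> Xi I P"
  obtain p Q r where Q: "(P, p, Q, r, I, \<theta>) \<in> \<xi>" using \<theta> by (rule Xi_realize)
  note tQ = EtrianglesD[OF Q[THEN xi_Etriangles]]
  obtain E \<delta>' h d e where E: "(A, p \<circledcirc> x, Q, h, E, \<delta>') \<in> \<xi>"
    and F: "(C, d, E, e, I, push \<C> I y \<theta>) \<in> \<xi>" and eh: "e \<circledcirc> h = r"
    using T Q by (rule xi_ET4)
  note tE = EtrianglesD[OF E[THEN xi_Etriangles]] and tF = EtrianglesD[OF F[THEN xi_Etriangles]]
  obtain s where s: "s \<in> arr \<C> I E" "e \<circledcirc> s = idm \<C> I"
    using C F I idm_closed by (rule orth_lift)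
  obtain w where w: "w \<in> arr \<C> I Q" "h \<circledcirc> w = s" using A E I s(1) by (rule orth_lift)
  have "r \<circledcirc> w = idm \<C> I" using cmp_assoc[OF w(1) tE(2) tF(2)] w(2) s(2) eh by simp
  then show "\<theta> = \<one>\<^bsub>\<EE> \<C> I P\<^esub>"
    using pull_cmp_deflation[OF Q[THEN xi_Etriangles] w(1)] tQ(3) by simp
qed

text \<open>Choice turns the one-step conditions into functions \<open>P\<close> and
  \<open>R\<close>; iterating them on \<open>A\<close> gives a complex in both directions, and all
  its cosyzygies stay in \<open>S\<close>, hence in \<open>orth\<close>.\<close>

lemma GInj_coinduct:
  assumes orth: "S \<subseteq> orth"
    and left: "\<And>A. A \<in> S \<Longrightarrow> \<exists>A' x X y \<delta>. (A', x, X, y, A, \<delta>) \<in> \<xi> \<and> X \<in> Inj \<C> \<xi> \<and> A' \<in> S"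
    and right: "\<And>A. A \<in> S \<Longrightarrow> \<exists>x X y A'' \<delta>. (A, x, X, y, A'', \<delta>) \<in> \<xi> \<and> X \<in> Inj \<C> \<xi> \<and> A'' \<in> S"
  shows "S \<subseteq> GInj \<C> \<xi>"
proof
  fix A assume A: "A \<in> S"
  obtain P xl Xl yl dl where
    l: "\<And>A. A \<in> S \<Longrightarrow> (P A, xl A, Xl A, yl A, A, dl A) \<in> \<xi> \<and> Xl A \<in> Inj \<C> \<xi> \<and> P A \<in> S"
    using left by metis
  obtain xr Xr yr R dr where
    r: "\<And>A. A \<in> S \<Longrightarrow> (A, xr A, Xr A, yr A, R A, dr A) \<in> \<xi> \<and> Xr A \<in> Inj \<C> \<xi> \<and> R A \<in> S"
    using right by metis
  \<comment> \<open>\<open>P\<close> is iterated for nonnegative and \<open>R\<close> for negative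
    indices. The triangle of index \<open>n\<close> runs from \<open>K (n + 1)\<close> to
    \<open>K n\<close>, so for negative \<open>n\<close> it is the one chosen on the right of
    \<open>K (n + 1)\<close>.\<close>
  define K :: "int \<Rightarrow> 'o" where "K n = (if 0 \<le> n then (P ^^ nat n) A else (R ^^ nat (- n)) A)" for n
  have P: "(P ^^ k) A \<in> S" for k using A l by (induction k) auto
  have R: "(R ^^ k) A \<in> S" for k using A r by (induction k) auto
  have KS: "K n \<in> S" for n using P R by (simp add: K_def)
  have K1: "K (n + 1) = P (K n)" if "0 \<le> n" for n
    using that by (simp add: K_def nat_add_distrib)
  have K2: "K n = R (K (n + 1))" if "n < 0" for n
  proof -
    have "nat (- n) = Suc (nat (- (n + 1)))" using that by simp
    then show ?thesis using that by (auto simp: K_def)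
  qed
  define g f X \<delta> where "g n = (if 0 \<le> n then xl (K n) else xr (K (n + 1)))"
    and "f n = (if 0 \<le> n then yl (K n) else yr (K (n + 1)))"
    and "X n = (if 0 \<le> n then Xl (K n) else Xr (K (n + 1)))"
    and "\<delta> n = (if 0 \<le> n then dl (K n) else dr (K (n + 1)))" for n
  have T: "(K (n + 1), g n, X n, f n, K n, \<delta> n) \<in> \<xi>" "X n \<in> Inj \<C> \<xi>" for n
    using l[OF KS[of n]] r[OF KS[of "n + 1"]] K1[of n] K2[of n]
    by (auto simp: g_def f_def X_def \<delta>_def)
  have "resolution_triangles \<C> \<xi> X (\<lambda>n. g (n - 1) \<circledcirc> f n) K g f \<delta>"
    using T(1) by (simp add: resolution_triangles_def)
  moreover have "\<forall>n. \<forall>I \<in> Inj \<C> \<xi>. exact_from \<C> I (K (n + 1), g n, X n, f n, K n, \<delta> n)"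
    using orth_exact_from[OF _ T(1)] KS orth by blast
  moreover have "A = K 0" by (simp add: K_def)
  ultimately show "A \<in> GInj \<C> \<xi>" using T(2) unfolding GInj_def by blast
qed

lemma GInj_left:
  assumes "A \<in> GInj \<C> \<xi>"
  obtains A' x X y \<delta> where "(A', x, X, y, A, \<delta>) \<in> \<xi>" "X \<in> Inj \<C> \<xi>" "A' \<in> GInj \<C> \<xi>"
proof -
  obtain X d K g f \<delta> n where *: "resolution_triangles \<C> \<xi> X d K g f \<delta>" "\<forall>n. X n \<in> Inj \<C> \<xi>"
    "\<forall>n. \<forall>I \<in> Inj \<C> \<xi>. exact_from \<C> I (K (n + 1), g n, X n, f n, K n, \<delta> n)" "A = K n"
    using assms unfolding GInj_def by blast
  then have "K (n + 1) \<in> GInj \<C> \<xi>" unfolding GInj_def by blast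
  moreover have "(K (n + 1), g n, X n, f n, K n, \<delta> n) \<in> \<xi>"
    using *(1) unfolding resolution_triangles_def by blast
  ultimately show ?thesis using that *(2,4) by blast
qed

text \<open>The exactness clause is retained because \<open>GInj_orth\<close> is derived from
  it.\<close>

lemma GInj_right_exact:
  assumes "A \<in> GInj \<C> \<xi>"
  obtains x X y A'' \<delta> where "(A, x, X, y, A'', \<delta>) \<in> \<xi>" "X \<in> Inj \<C> \<xi>" "A'' \<in> GInj \<C> \<xi>"
    "\<forall>I \<in> Inj \<C> \<xi>. exact_from \<C> I (A, x, X, y, A'', \<delta>)"
proof -
  obtain X d K g f \<delta> m where *: "resolution_triangles \<C> \<xi> X d K g f \<delta>" "\<forall>n. X n \<in> Inj \<C> \<xi>"
    "\<forall>n. \<forall>I \<in> Inj \<C> \<xi>. exact_from \<C> I (K (n + 1), g n, X n, f n, K n, \<delta> n)" "A = K m"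
    using assms unfolding GInj_def by blast
  define n where "n = m - 1"
  have "K n \<in> GInj \<C> \<xi>" using * unfolding GInj_def by blast
  moreover have "(K (n + 1), g n, X n, f n, K n, \<delta> n) \<in> \<xi>"
    using *(1) unfolding resolution_triangles_def by blast
  moreover have "A = K (n + 1)" using *(4) by (simp add: n_def)
  ultimately show ?thesis using that *(2,3) by blast
qed

text \<open>A null map is killed by \<open>x : A \<rightarrow> X\<close>, as \<open>X\<close> is
  injective, and so vanishes by exactness. An extension in \<open>Xi I A\<close> splits after
  pushing along \<open>x\<close>; hence it is the pullback of \<open>\<delta>\<close> along a map
  \<open>I \<rightarrow> A''\<close>, which lifts to \<open>X\<close>.\<close>

lemma GInj_orth:
  assumes "A \<in> GInj \<C> \<xi>"
  shows "A \<in> orth"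
proof -
  obtain x X y A'' \<delta> where T: "(A, x, X, y, A'', \<delta>) \<in> \<xi>" and X: "X \<in> Inj \<C> \<xi>"
    and "A'' \<in> GInj \<C> \<xi>" and ex: "\<forall>I \<in> Inj \<C> \<xi>. exact_from \<C> I (A, x, X, y, A'', \<delta>)"
    using assms by (rule GInj_right_exact)
  note t = EtrianglesD[OF T[THEN xi_Etriangles]]
  show ?thesis
  proof (rule orthI)
    fix I u assume I: "I \<in> Inj \<C> \<xi>" and u: "u \<in> arr \<C> I A"
      and null: "\<And>J q. \<lbrakk>J \<in> Inj \<C> \<xi>; q \<in> arr \<C> A J\<rbrakk> \<Longrightarrow> q \<circledcirc> u = zero_arr \<C> I J"
    have inj: "inj_on (\<lambda>u. x \<circledcirc> u) (arr \<C> I A)"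
      using bspec[OF ex I] by (auto simp: short_exact_sequence_iff mon_def)
    show "u = zero_arr \<C> I A"
      using null[OF X t(1)] t(1) by (intro inj_onD[OF inj _ u zero_closed]) simp
  next
    fix I \<theta> assume I: "I \<in> Inj \<C> \<xi>" and \<theta>: "\<theta> \<in> Xi I A"
    have "push \<C> I x \<theta> = \<one>\<^bsub>\<EE> \<C> I X\<^esub>" using X Xi_push[OF \<theta> t(1)] by (rule Inj_Xi)
    with T[THEN xi_Etriangles] Xi_carrier[OF \<theta>] obtain c where c: "c \<in> arr \<C> I A''" "\<theta> = pull \<C> A c \<delta>"
      by (rule push_eq_one_pull)
    have "(\<lambda>u. y \<circledcirc> u) ` arr \<C> I X = arr \<C> I A''"
      using bspec[OF ex I] by (auto simp: short_exact_sequence_iff epi_def)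
    then have "c \<in> (\<lambda>u. y \<circledcirc> u) ` arr \<C> I X" using c(1) by blast
    then obtain u where "u \<in> arr \<C> I X" "c = y \<circledcirc> u" by blast
    then show "\<theta> = \<one>\<^bsub>\<EE> \<C> I A\<^esub>" using pull_cmp_deflation[OF T[THEN xi_Etriangles]] c(2) by simp
  qed
qed

lemma GInj_right:
  assumes "A \<in> GInj \<C> \<xi>"
  obtains x X y A'' \<delta> where "(A, x, X, y, A'', \<delta>) \<in> \<xi>" "X \<in> Inj \<C> \<xi>" "A'' \<in> GInj \<C> \<xi>"
  using GInj_right_exact[OF assms] by metis

section \<open>Closure properties of Gorenstein injective objects\<close>

lemma GInj_extension:
  assumes "(A, x, P, y, C, \<delta>) \<in> \<xi>" "A \<in> GInj \<C> \<xi>" "C \<in> GInj \<C> \<xi>"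
  shows "P \<in> GInj \<C> \<xi>"
proof -
  \<comment> \<open>The class of all extensions is coinductive: both horseshoes produce a
    neighbouring term that is again such an extension.\<close>
  define S where "S = {P. \<exists>A x y C \<delta>. (A, x, P, y, C, \<delta>) \<in> \<xi> \<and> A \<in> GInj \<C> \<xi> \<and> C \<in> GInj \<C> \<xi>}"
  have "S \<subseteq> GInj \<C> \<xi>"
  proof (rule GInj_coinduct)
    show "S \<subseteq> orth" using orth_extension GInj_orth by (auto simp: S_def)
  next
    fix P assume "P \<in> S"
    then obtain A x y C \<delta> where T: "(A, x, P, y, C, \<delta>) \<in> \<xi>" and A: "A \<in> GInj \<C> \<xi>" and C: "C \<in> GInj \<C> \<xi>"
      by (auto simp: S_def)
    obtain A' a X a' \<epsilon> where TA: "(A', a, X, a', A, \<epsilon>) \<in> \<xi>" and X: "X \<in> Inj \<C> \<xi>" "A' \<in> GInj \<C> \<xi>"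
      using A by (rule GInj_left)
    obtain C' c Y c' \<phi> where TC: "(C', c, Y, c', C, \<phi>) \<in> \<xi>" and Y: "Y \<in> Inj \<C> \<xi>" "C' \<in> GInj \<C> \<xi>"
      using C by (rule GInj_left)
    \<comment> \<open>On the left the splitting comes from \<open>A \<in> orth\<close> and the
      injectivity of \<open>Y\<close>; on the right, below, from the injectivity of \<open>X\<close>
      alone.\<close>
    have "pull \<C> A c' \<delta> = \<one>\<^bsub>\<EE> \<C> Y A\<^esub>"
      using GInj_orth[OF A] Y(1) Xi_pull[OF xi_Xi[OF T] EtrianglesD(2)[OF TC[THEN xi_Etriangles]]]
      by (rule orth_Xi)
    with T TA TC obtain i j p q M W g h d e \<epsilon>1 \<epsilon>2
      where M: "biproduct \<C> X Y M i j p q" and "(W, g, M, h, P, \<epsilon>1) \<in> \<xi>" "(A', d, W, e, C', \<epsilon>2) \<in> \<xi>"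
      by (rule horseshoe_left)
    moreover have "M \<in> Inj \<C> \<xi>" using M X(1) Y(1) by (rule Inj_biproduct)
    ultimately show "\<exists>A' x X y \<delta>. (A', x, X, y, P, \<delta>) \<in> \<xi> \<and> X \<in> Inj \<C> \<xi> \<and> A' \<in> S"
      using X(2) Y(2) unfolding S_def by blast
  next
    fix P assume "P \<in> S"
    then obtain A x y C \<delta> where T: "(A, x, P, y, C, \<delta>) \<in> \<xi>" and A: "A \<in> GInj \<C> \<xi>" and C: "C \<in> GInj \<C> \<xi>"
      by (auto simp: S_def)
    obtain a X a' A' \<epsilon> where TA: "(A, a, X, a', A', \<epsilon>) \<in> \<xi>" and X: "X \<in> Inj \<C> \<xi>" "A' \<in> GInj \<C> \<xi>"
      using A by (rule GInj_right)
    obtain c Y c' C' \<phi> where TC: "(C, c, Y, c', C', \<phi>) \<in> \<xi>" and Y: "Y \<in> Inj \<C> \<xi>" "C' \<in> GInj \<C> \<xi>"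
      using C by (rule GInj_right)
    have "push \<C> C a \<delta> = \<one>\<^bsub>\<EE> \<C> C X\<^esub>"
      using X(1) Xi_push[OF xi_Xi[OF T] EtrianglesD(1)[OF TA[THEN xi_Etriangles]]] by (rule Inj_Xi)
    with T TA TC obtain i j p q M W g h d e \<epsilon>1 \<epsilon>2
      where M: "biproduct \<C> X Y M i j p q" and "(P, g, M, h, W, \<epsilon>1) \<in> \<xi>" "(A', d, W, e, C', \<epsilon>2) \<in> \<xi>"
      by (rule horseshoe_right)
    moreover have "M \<in> Inj \<C> \<xi>" using M X(1) Y(1) by (rule Inj_biproduct)
    ultimately show "\<exists>x X y A'' \<delta>. (P, x, X, y, A'', \<delta>) \<in> \<xi> \<and> X \<in> Inj \<C> \<xi> \<and> A'' \<in> S"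
      using X(2) Y(2) unfolding S_def by blast
  qed
  then show ?thesis using assms unfolding S_def by blast
qed

lemma Inj_orth:
  assumes "A \<in> Inj \<C> \<xi>"
  shows "A \<in> orth"
proof (rule orthI)
  fix I u assume u: "u \<in> arr \<C> I A"
    and null: "\<And>J q. \<lbrakk>J \<in> Inj \<C> \<xi>; q \<in> arr \<C> A J\<rbrakk> \<Longrightarrow> q \<circledcirc> u = zero_arr \<C> I J"
  show "u = zero_arr \<C> I A" using null[OF assms idm_closed] u by (simp add: cmp_idm_left)
qed (rule Inj_Xi[OF assms])

lemma Inj_GInj: "Inj \<C> \<xi> \<subseteq> GInj \<C> \<xi>"
proof (rule GInj_coinduct)
  obtain Z where Z: "is_zero \<C> Z" using zero_exists by blast
  fix A assume A: "A \<in> Inj \<C> \<xi>"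
  show "\<exists>A' x X y \<delta>. (A', x, X, y, A, \<delta>) \<in> \<xi> \<and> X \<in> Inj \<C> \<xi> \<and> A' \<in> Inj \<C> \<xi>"
    using split_in[OF split_left[OF Z]] A zero_Inj[OF Z] by blast
  show "\<exists>x X y A'' \<delta>. (A, x, X, y, A'', \<delta>) \<in> \<xi> \<and> X \<in> Inj \<C> \<xi> \<and> A'' \<in> Inj \<C> \<xi>"
    using split_in[OF split_right[OF Z]] A zero_Inj[OF Z] by blast
qed (use Inj_orth in blast)

lemma zero_GInj: "is_zero \<C> Z \<Longrightarrow> Z \<in> GInj \<C> \<xi>"
  using zero_Inj Inj_GInj by blast

lemma orth_summand:
  assumes B: "biproduct \<C> J L S i s r q" and S: "S \<in> orth"
  shows "L \<in> orth"
proof (rule orthI)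
  note b = biproductD[OF B]
  fix I u assume I: "I \<in> Inj \<C> \<xi>" and u: "u \<in> arr \<C> I L"
    and null: "\<And>J q. \<lbrakk>J \<in> Inj \<C> \<xi>; q \<in> arr \<C> L J\<rbrakk> \<Longrightarrow> q \<circledcirc> u = zero_arr \<C> I J"
  have "s \<circledcirc> u = zero_arr \<C> I S"
  proof (rule orth_null[OF S I cmp_closed[OF u b(2)]])
    fix J q assume q: "J \<in> Inj \<C> \<xi>" "q \<in> arr \<C> S J"
    show "q \<circledcirc> (s \<circledcirc> u) = zero_arr \<C> I J"
      using cmp_assoc[OF u b(2) q(2)] null[OF q(1) cmp_closed[OF b(2) q(2)]] by simp
  qed
  then show "u = zero_arr \<C> I L" using cmp_assoc[OF u b(2) b(4)] b(4,6) u by (simp add: cmp_idm_left)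
next
  note b = biproductD[OF B]
  fix I \<theta> assume I: "I \<in> Inj \<C> \<xi>" and \<theta>: "\<theta> \<in> Xi I L"
  have "push \<C> I s \<theta> = \<one>\<^bsub>\<EE> \<C> I S\<^esub>" using S I Xi_push[OF \<theta> b(2)] by (rule orth_Xi)
  then show "\<theta> = \<one>\<^bsub>\<EE> \<C> I L\<^esub>"
    using push_push[OF b(2) b(4) Xi_carrier[OF \<theta>]] b(6) b(4) Xi_carrier[OF \<theta>] by simp
qed

text \<open>A resolution step for \<open>S\<close> gives one for \<open>L\<close> whose new term
  \<open>E\<close> is built by extension from \<open>J\<close> and \<open>K\<close>. As the
  complement \<open>J\<close> is injective, \<open>E\<close> is Gorenstein injective, and it lies in
  \<open>T\<close> with zero complement.\<close>

lemma GInj_summand: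
  assumes "biproduct \<C> J L S i s r q" "J \<in> Inj \<C> \<xi>" "S \<in> GInj \<C> \<xi>"
  shows "L \<in> GInj \<C> \<xi>"
proof -
  define T where "T = {L. \<exists>J S i s r q. biproduct \<C> J L S i s r q \<and> J \<in> Inj \<C> \<xi> \<and> S \<in> GInj \<C> \<xi>}"
  obtain Z where Z: "is_zero \<C> Z" using zero_exists by blast
  have sub: "A \<in> T" if "A \<in> GInj \<C> \<xi>" for A
    using biproduct_swap[OF biproduct_zero[OF Z]] zero_Inj[OF Z] that unfolding T_def by blast
  have "T \<subseteq> GInj \<C> \<xi>"
  proof (rule GInj_coinduct)
    show "T \<subseteq> orth" using orth_summand GInj_orth by (auto simp: T_def)
  next
    fix L assume "L \<in> T"
    then obtain J S i s r q where B: "biproduct \<C> J L S i s r q" and J: "J \<in> Inj \<C> \<xi>" and S: "S \<in> GInj \<C> \<xi>"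
      by (auto simp: T_def)
    obtain K k X k' \<epsilon> where K: "(K, k, X, k', S, \<epsilon>) \<in> \<xi>" and X: "X \<in> Inj \<C> \<xi>" "K \<in> GInj \<C> \<xi>"
      using S by (rule GInj_left)
    obtain E \<delta>'' h d e where E: "(E, h, X, q \<circledcirc> k', L, \<delta>'') \<in> \<xi>" and F: "(K, e, E, d, J, pull \<C> K i \<epsilon>) \<in> \<xi>"
      using biproduct_xi(1)[OF B] K by (rule xi_ET4_op)
    have "E \<in> GInj \<C> \<xi>" using F X(2) J Inj_GInj GInj_extension by blast
    then show "\<exists>A' x X y \<delta>. (A', x, X, y, L, \<delta>) \<in> \<xi> \<and> X \<in> Inj \<C> \<xi> \<and> A' \<in> T"
      using E X(1) sub by blast
  next
    fix L assume "L \<in> T"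
    then obtain J S i s r q where B: "biproduct \<C> J L S i s r q" and J: "J \<in> Inj \<C> \<xi>" and S: "S \<in> GInj \<C> \<xi>"
      by (auto simp: T_def)
    obtain k X k' K \<epsilon> where K: "(S, k, X, k', K, \<epsilon>) \<in> \<xi>" and X: "X \<in> Inj \<C> \<xi>" "K \<in> GInj \<C> \<xi>"
      using S by (rule GInj_right)
    obtain E \<delta>'' h d e where E: "(L, k \<circledcirc> s, X, h, E, \<delta>'') \<in> \<xi>" and F: "(J, d, E, e, K, push \<C> K r \<epsilon>) \<in> \<xi>"
      using biproduct_xi(2)[OF B] K by (rule xi_ET4)
    have "E \<in> GInj \<C> \<xi>" using F X(2) J Inj_GInj GInj_extension by blast
    then show "\<exists>x X y A'' \<delta>. (L, x, X, y, A'', \<delta>) \<in> \<xi> \<and> X \<in> Inj \<C> \<xi> \<and> A'' \<in> T"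
      using E X(1) sub by blast
  qed
  then show ?thesis using assms unfolding T_def by blast
qed

text \<open>Pushing out along an inflation of \<open>G\<close> into an injective \<open>J\<close>
  gives \<open>J \<oplus> L\<close>, which is also an extension of the Gorenstein injective
  \<open>K\<close> by \<open>P\<close>.\<close>

lemma GInj_cokernel:
  assumes T: "(G, x, P, y, L, \<delta>) \<in> \<xi>" and G: "G \<in> GInj \<C> \<xi>" and P: "P \<in> GInj \<C> \<xi>"
  shows "L \<in> GInj \<C> \<xi>"
proof -
  obtain a J a' K \<epsilon> where TJ: "(G, a, J, a', K, \<epsilon>) \<in> \<xi>" and J: "J \<in> Inj \<C> \<xi>" "K \<in> GInj \<C> \<xi>"
    using G by (rule GInj_right)
  obtain S i j p q where S: "biproduct \<C> J L S i j p q" using biproduct_exists by blast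
  have "push \<C> L a \<delta> = \<one>\<^bsub>\<EE> \<C> L J\<^esub>"
    using J(1) Xi_push[OF xi_Xi[OF T] EtrianglesD(1)[OF TJ[THEN xi_Etriangles]]] by (rule Inj_Xi)
  then have "(J, i, S, q, L, push \<C> L a \<delta>) \<in> \<xi>" using biproduct_xi(1)[OF S] by simp
  with T TJ obtain k k' \<delta>' where "(P, k, S, k', K, \<delta>') \<in> \<xi>" by (rule xi_pushout)
  then have "S \<in> GInj \<C> \<xi>" using P J(2) by (rule GInj_extension)
  with S J(1) show ?thesis by (rule GInj_summand)
qed

text \<open>By the lifting hypothesis the pullback along a deflation
  \<open>I \<rightarrow> L\<close> splits, with middle term \<open>I \<oplus> A\<close>; read the
  other way, it is an extension of \<open>G\<close> by the Gorenstein injective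
  \<open>K\<close>.\<close>

lemma GInj_kernel:
  assumes T: "(A, x, G, y, L, \<delta>) \<in> \<xi>" and G: "G \<in> GInj \<C> \<xi>" and L: "L \<in> GInj \<C> \<xi>"
    and lift: "\<And>I c. \<lbrakk>I \<in> Inj \<C> \<xi>; c \<in> arr \<C> I L\<rbrakk> \<Longrightarrow> \<exists>u \<in> arr \<C> I G. y \<circledcirc> u = c"
  shows "A \<in> GInj \<C> \<xi>"
proof -
  obtain K k I k' \<epsilon> where K: "(K, k, I, k', L, \<epsilon>) \<in> \<xi>" and I: "I \<in> Inj \<C> \<xi>" "K \<in> GInj \<C> \<xi>"
    using L by (rule GInj_left)
  obtain S i j p q where S: "biproduct \<C> I A S i j p q" using biproduct_exists by blast
  obtain u where "u \<in> arr \<C> I G" "y \<circledcirc> u = k'"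
    using lift[OF I(1) EtrianglesD(2)[OF K[THEN xi_Etriangles]]] by blast
  then have "pull \<C> A k' \<delta> = \<one>\<^bsub>\<EE> \<C> I A\<^esub>"
    using pull_cmp_deflation[OF T[THEN xi_Etriangles]] by blast
  then have "(A, j, S, p, I, pull \<C> A k' \<delta>) \<in> \<xi>" using biproduct_xi(2)[OF S] by simp
  with T K obtain l l' \<delta>' where "(K, l, S, l', G, \<delta>') \<in> \<xi>" by (rule xi_pullback)
  then have "S \<in> GInj \<C> \<xi>" using I(2) G by (rule GInj_extension)
  with S I(1) show ?thesis by (rule GInj_summand)
qed

section \<open>Gorenstein injective dimension\<close>

text \<open>These are coresolutions by Gorenstein injectives that need not be proper. Recursion over
  the naturals leaves out degree -1, where \<open>Gid_le\<close> admits zero objects only; in the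
  other degrees \<open>Gid_le_iff\<close> shows agreement.\<close>

primrec cosyzygy_class :: "nat \<Rightarrow> 'o set" where
  "cosyzygy_class 0 = GInj \<C> \<xi>"
| "cosyzygy_class (Suc m) =
    {A. \<exists>x Q y L \<delta>. (A, x, Q, y, L, \<delta>) \<in> \<xi> \<and> Q \<in> GInj \<C> \<xi> \<and> L \<in> cosyzygy_class m}"

lemma cosyzygy_class_SucI:
  "\<lbrakk>(A, x, Q, y, L, \<delta>) \<in> \<xi>; Q \<in> GInj \<C> \<xi>; L \<in> cosyzygy_class m\<rbrakk> \<Longrightarrow> A \<in> cosyzygy_class (Suc m)"
  unfolding cosyzygy_class.simps by blast

lemma GInj_cosyzygy_class: "GInj \<C> \<xi> \<subseteq> cosyzygy_class m"
proof (induction m)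
  case (Suc m)
  obtain Z where Z: "is_zero \<C> Z" using zero_exists by blast
  show ?case
    using cosyzygy_class_SucI[OF split_in[OF split_right[OF Z]]] zero_GInj[OF Z] Suc by blast
qed simp

text \<open>\<open>G\<close> is sent to an injective \<open>I\<close>, so that the horseshoe
  applies; the new cosyzygy \<open>W\<close> is an extension of \<open>L'\<close> by
  \<open>K\<close>, the same situation one degree lower.\<close>

lemma cosyzygy_class_extension:
  assumes "(G, x, P, y, L, \<delta>) \<in> \<xi>" "G \<in> GInj \<C> \<xi>" "L \<in> cosyzygy_class m"
  shows "P \<in> cosyzygy_class m"
  using assms
proof (induction m arbitrary: G x P y L \<delta>)
  case 0
  then show ?case using GInj_extension by simp
next
  case (Suc m)
  note T = Suc.prems(1)
  obtain c Q c' L' \<phi> where TL: "(L, c, Q, c', L', \<phi>) \<in> \<xi>" and Q: "Q \<in> GInj \<C> \<xi>" "L' \<in> cosyzygy_class m"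
    using Suc.prems(3) by auto
  obtain a I a' K \<epsilon> where TG: "(G, a, I, a', K, \<epsilon>) \<in> \<xi>" and I: "I \<in> Inj \<C> \<xi>" "K \<in> GInj \<C> \<xi>"
    using Suc.prems(2) by (rule GInj_right)
  have "push \<C> L a \<delta> = \<one>\<^bsub>\<EE> \<C> L I\<^esub>"
    using I(1) Xi_push[OF xi_Xi[OF T] EtrianglesD(1)[OF TG[THEN xi_Etriangles]]] by (rule Inj_Xi)
  with T TG TL obtain i j p q M W g h d e \<epsilon>1 \<epsilon>2
    where M: "biproduct \<C> I Q M i j p q" and P: "(P, g, M, h, W, \<epsilon>1) \<in> \<xi>" and W: "(K, d, W, e, L', \<epsilon>2) \<in> \<xi>"
    by (rule horseshoe_right)
  have "M \<in> GInj \<C> \<xi>" using biproduct_xi(1)[OF M] I(1) Inj_GInj Q(1) GInj_extension by blast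
  moreover have "W \<in> cosyzygy_class m" using W I(2) Q(2) by (rule Suc.IH)
  ultimately show ?case by (rule cosyzygy_class_SucI[OF P])
qed

text \<open>The third term \<open>E\<close> of the composite
  \<open>G \<rightarrow> P \<rightarrow> Q\<close> is Gorenstein injective by
  \<open>GInj_cokernel\<close>, and \<open>L \<rightarrow> E \<rightarrow> L'\<close> starts a
  coresolution of \<open>L\<close>.\<close>

lemma cosyzygy_class_cokernel:
  assumes T: "(G, x, P, y, L, \<delta>) \<in> \<xi>" and G: "G \<in> GInj \<C> \<xi>" and P: "P \<in> cosyzygy_class m"
  shows "L \<in> cosyzygy_class m"
proof (cases m)
  case 0
  then show ?thesis using GInj_cokernel[OF T G] P by simp
next
  case (Suc k)
  then obtain q Q q' L' \<epsilon> where Q: "(P, q, Q, q', L', \<epsilon>) \<in> \<xi>" "Q \<in> GInj \<C> \<xi>" "L' \<in> cosyzygy_class k"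
    using P by auto
  obtain E \<delta>'' h d e where E: "(G, q \<circledcirc> x, Q, h, E, \<delta>'') \<in> \<xi>" and F: "(L, d, E, e, L', push \<C> L' y \<epsilon>) \<in> \<xi>"
    using T Q(1) by (rule xi_ET4)
  have "E \<in> GInj \<C> \<xi>" using E G Q(2) by (rule GInj_cokernel)
  then show ?thesis unfolding Suc using Q(3) by (rule cosyzygy_class_SucI[OF F])
qed

text \<open>A relative form of Schanuel's lemma: \<open>Q \<oplus> B\<close> is an extension of \<open>L\<close> by \<open>H\<close>.\<close>

lemma cosyzygy_class_proper_cosyzygy:
  assumes A: "A \<in> cosyzygy_class (Suc m)" and T: "(A, h, H, k, B, \<delta>) \<in> \<xi>" and H: "H \<in> GInj \<C> \<xi>"
    and ex: "\<forall>W \<in> GInj \<C> \<xi>. exact_into \<C> W (A, h, H, k, B, \<delta>)"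
  shows "B \<in> cosyzygy_class m"
proof -
  obtain x Q y L \<epsilon> where Q: "(A, x, Q, y, L, \<epsilon>) \<in> \<xi>" "Q \<in> GInj \<C> \<xi>" "L \<in> cosyzygy_class m"
    using A by auto
  \<comment> \<open>Properness with test object \<open>Q\<close> factors \<open>x\<close> through
    \<open>h\<close>, so that the pushout of \<open>\<delta>\<close> along \<open>x\<close>
    splits.\<close>
  have "(\<lambda>u. u \<circledcirc> h) ` arr \<C> H Q = arr \<C> A Q"
    using bspec[OF ex Q(2)] by (auto simp: short_exact_sequence_iff epi_def)
  then have "x \<in> (\<lambda>u. u \<circledcirc> h) ` arr \<C> H Q"
    using EtrianglesD(1)[OF Q(1)[THEN xi_Etriangles]] by blast
  then obtain u where "u \<in> arr \<C> H Q" "x = u \<circledcirc> h" by blast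
  then have x\<delta>: "push \<C> B x \<delta> = \<one>\<^bsub>\<EE> \<C> B Q\<^esub>"
    using push_cmp_inflation[OF T[THEN xi_Etriangles]] by blast
  obtain S i j p q where S: "biproduct \<C> Q B S i j p q" using biproduct_exists by blast
  have "(Q, i, S, q, B, push \<C> B x \<delta>) \<in> \<xi>" using biproduct_xi(1)[OF S] x\<delta> by simp
  with T Q(1) obtain l l' \<delta>' where "(H, l, S, l', L, \<delta>') \<in> \<xi>" by (rule xi_pushout)
  then have "S \<in> cosyzygy_class m" using H Q(3) by (rule cosyzygy_class_extension)
  with biproduct_xi(1)[OF S] Q(2) show ?thesis by (rule cosyzygy_class_cokernel)
qed

lemma cosyzygy_class_Suc: "A \<in> cosyzygy_class m \<Longrightarrow> A \<in> cosyzygy_class (Suc m)"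
proof (induction m arbitrary: A)
  case 0
  then show ?case using GInj_cosyzygy_class by (metis cosyzygy_class.simps(1) subsetD)
next
  case (Suc m)
  then show ?case by (simp only: cosyzygy_class.simps(2) mem_Collect_eq) blast
qed

lemma cosyzygy_class_mono: "\<lbrakk>m \<le> n; A \<in> cosyzygy_class m\<rbrakk> \<Longrightarrow> A \<in> cosyzygy_class n"
  by (induction n rule: dec_induct) (auto intro: cosyzygy_class_Suc simp del: cosyzygy_class.simps)

lemma cosyzygy_class_Gid_le: "A \<in> cosyzygy_class m \<Longrightarrow> Gid_le \<C> \<xi> (int m) A"
proof (induction m arbitrary: A)
  case 0
  then show ?case by (simp add: Gid_le.GInj)
next
  case (Suc m)
  then show ?case by (auto intro: Gid_le.step)
qed

lemma Gid_le_ge: "Gid_le \<C> \<xi> k A \<Longrightarrow> -1 \<le> k"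
  by (induction rule: Gid_le.induct) auto

text \<open>
  In degree \<open>0\<close> the rule \<open>step\<close> produces the kernel of a map from a Gorenstein injective object to a
  zero object.
\<close>

lemma Gid_le_cosyzygy_class: "Gid_le \<C> \<xi> k A \<Longrightarrow> A \<in> cosyzygy_class (nat k)"
proof (induction rule: Gid_le.induct)
  case (zero A k)
  then show ?case using zero_GInj GInj_cosyzygy_class by blast
next
  case (GInj A k)
  then show ?case using GInj_cosyzygy_class by blast
next
  case (step A x Q y L \<delta> k)
  show ?case
  proof (cases "k \<le> 0")
    case False
    then have "nat k = Suc (nat (k - 1))" by simp
    then show ?thesis using cosyzygy_class_SucI[OF step.hyps(1,2) step.IH] by simp
  next
    case True
    \<comment> \<open>Here the bound on \<open>L\<close> is at most -1: rule \<open>GInj\<close>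
      asks for a nonnegative bound, and rule \<open>step\<close> for an object with bound below -1,
      which \<open>Gid_le_ge\<close> excludes.\<close>
    have "is_zero \<C> L"
      using step.hyps(3)
    proof cases
      case (step x Q y L' \<delta>)
      then show ?thesis using Gid_le_ge[of "k - 1 - 1" L'] True by linarith
    qed (use True in auto)
    note L = this
    have "A \<in> GInj \<C> \<xi>"
    proof (rule GInj_kernel[OF step.hyps(1,2) zero_GInj[OF L]])
      fix I c assume c: "c \<in> arr \<C> I L"
      then show "\<exists>u\<in>arr \<C> I Q. y \<circledcirc> u = c"
        using is_zero_arr(1)[OF L c] cmp_zero_right[OF EtrianglesD(2)[OF step.hyps(1)[THEN xi_Etriangles]]]
        by (intro bexI[of _ "zero_arr \<C> I Q"]) auto
    qed
    then show ?thesis using GInj_cosyzygy_class by blast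
  qed
qed

lemma Gid_le_iff: "Gid_le \<C> \<xi> (int m) A \<longleftrightarrow> A \<in> cosyzygy_class m"
  using Gid_le_cosyzygy_class[of "int m" A] cosyzygy_class_Gid_le by auto

text \<open>The bounds are integers: if none were at most \<open>n\<close>, all would be at least
  \<open>n + 1\<close>, and so would their infimum.\<close>

lemma Gid_le_nat_iff: "Gid \<C> \<xi> A \<le> ereal (real n) \<longleftrightarrow> A \<in> cosyzygy_class n"
proof
  assume "A \<in> cosyzygy_class n"
  then have "Gid_le \<C> \<xi> (int n) A" by (simp add: Gid_le_iff)
  then have "ereal (real_of_int (int n)) \<in> {ereal (real_of_int k) | k. Gid_le \<C> \<xi> k A}" by blast
  then have "Gid \<C> \<xi> A \<le> ereal (real_of_int (int n))" unfolding Gid_def by (rule Inf_lower)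
  then show "Gid \<C> \<xi> A \<le> ereal (real n)" by simp
next
  assume le: "Gid \<C> \<xi> A \<le> ereal (real n)"
  have "\<exists>k. Gid_le \<C> \<xi> k A \<and> k \<le> int n"
  proof (rule ccontr)
    assume "\<nexists>k. Gid_le \<C> \<xi> k A \<and> k \<le> int n"
    then have "ereal (real n + 1) \<le> ereal (real_of_int k)" if "Gid_le \<C> \<xi> k A" for k
      using that by (smt (verit) ereal_less_eq(3) of_int_add of_int_le_iff of_int_of_nat_eq of_int_1)
    then have "ereal (real n + 1) \<le> Gid \<C> \<xi> A"
      unfolding Gid_def by (auto intro: Inf_greatest)
    with le have "ereal (real n + 1) \<le> ereal (real n)" by (rule order_trans[rotated])
    then show False by simp
  qed
  then obtain k where "Gid_le \<C> \<xi> k A" "k \<le> int n" by blast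
  then show "A \<in> cosyzygy_class n"
    using Gid_le_cosyzygy_class cosyzygy_class_mono by (meson nat_le_iff)
qed

text \<open>The infimum of the empty set is infinite, so some bound exists.\<close>

lemma finite_Gid_cosyzygy_class:
  assumes "A \<in> finite_Gid \<C> \<xi>"
  obtains m where "A \<in> cosyzygy_class m"
proof -
  have "Inf {ereal (real_of_int k) | k. Gid_le \<C> \<xi> k A} \<noteq> Inf {}"
    using assms unfolding finite_Gid_def Gid_def by (simp add: top_ereal_def)
  then have "{ereal (real_of_int k) | k. Gid_le \<C> \<xi> k A} \<noteq> {}" by metis
  then show ?thesis using that Gid_le_cosyzygy_class by blast
qed

section \<open>Vanishing of relative cohomology\<close>

text \<open>Only positive degrees occur in the theorem. \<open>dd\<close> makes the coboundaries
  \<open>B\<close> a subgroup of the cocycles \<open>Z\<close>, and \<open>Z Mod B\<close> is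
  trivial iff every coset of a cocycle equals \<open>B\<close>, that is,
  \<open>Z \<subseteq> B\<close>.\<close>

lemma trivial_hom_cohomology_Suc:
  assumes d: "d m \<in> arr \<C> (H m) (H (Suc m))" "d (Suc m) \<in> arr \<C> (H (Suc m)) (H (Suc (Suc m)))"
    and dd: "d (Suc m) \<circledcirc> d m = zero_arr \<C> (H m) (H (Suc (Suc m)))"
  shows "trivial_group (hom_cohomology \<C> A H d (Suc m)) \<longleftrightarrow>
    (\<forall>u \<in> arr \<C> A (H (Suc m)). d (Suc m) \<circledcirc> u = zero_arr \<C> A (H (Suc (Suc m)))
       \<longrightarrow> (\<exists>v \<in> arr \<C> A (H m). u = d m \<circledcirc> v))"
proof -
  let ?G = "Hom \<C> A (H (Suc m))"
  define Z where "Z = kernel ?G (Hom \<C> A (H (Suc (Suc m)))) (\<lambda>u. d (Suc m) \<circledcirc> u)"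
  define B where "B = (\<lambda>u. d m \<circledcirc> u) ` arr \<C> A (H m)"
  interpret G: comm_group ?G by (rule Hom_comm_group)
  have h1: "group_hom ?G (Hom \<C> A (H (Suc (Suc m)))) (\<lambda>u. d (Suc m) \<circledcirc> u)"
    and h2: "group_hom (Hom \<C> A (H m)) ?G (\<lambda>u. d m \<circledcirc> u)"
    using cmp_hom_left d Hom_group by (auto simp: group_hom_def group_hom_axioms_def)
  have Z: "subgroup Z ?G" unfolding Z_def by (rule group_hom.subgroup_kernel[OF h1])
  have "subgroup B ?G" unfolding B_def by (rule group_hom.img_is_subgroup[OF h2])
  moreover have BZ: "B \<subseteq> Z"
    using cmp_assoc[OF _ d] cmp_closed[OF _ d(1)] dd by (auto simp: B_def Z_def kernel_def)
  ultimately have B: "subgroup B (?G\<lparr>carrier := Z\<rparr>)" by (metis G.subgroup_incl Z)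
  interpret K: comm_group "?G\<lparr>carrier := Z\<rparr>"
    using subgroup.mem_carrier[OF Z] G.m_comm
    by (intro group.group_comm_groupI[OF G.subgroup_imp_group[OF Z]]) simp
  have N: "B \<lhd> (?G\<lparr>carrier := Z\<rparr>)" using K.subgroup_imp_normal[OF B] .
  have e: "hom_cohomology \<C> A H d (Suc m) = (?G\<lparr>carrier := Z\<rparr>) Mod B"
    by (simp add: hom_cohomology_def Z_def B_def)
  have "trivial_group (hom_cohomology \<C> A H d (Suc m)) \<longleftrightarrow>
      carrier ((?G\<lparr>carrier := Z\<rparr>) Mod B) = {B}"
    unfolding e trivial_group_def using normal.factorgroup_is_group[OF N] by (auto simp: FactGroup_def)
  also have "\<dots> \<longleftrightarrow> Z \<subseteq> B"
  proof
    assume a: "carrier ((?G\<lparr>carrier := Z\<rparr>) Mod B) = {B}"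
    show "Z \<subseteq> B"
    proof
      fix z assume z: "z \<in> Z"
      have "B #>\<^bsub>?G\<lparr>carrier := Z\<rparr>\<^esub> z = B"
        using a z by (auto simp: FactGroup_def RCOSETS_def)
      then show "z \<in> B" using K.rcos_self[of z B] z B by auto
    qed
  next
    assume "Z \<subseteq> B"
    then have "B #>\<^bsub>?G\<lparr>carrier := Z\<rparr>\<^esub> z = B" if "z \<in> Z" for z
      using that K.coset_join2[of z B] B by auto
    then show "carrier ((?G\<lparr>carrier := Z\<rparr>) Mod B) = {B}"
      using K.one_closed by (auto simp: FactGroup_def RCOSETS_def)
  qed
  also have "\<dots> \<longleftrightarrow> (\<forall>u \<in> arr \<C> A (H (Suc m)). d (Suc m) \<circledcirc> u = zero_arr \<C> A (H (Suc (Suc m)))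
       \<longrightarrow> (\<exists>v \<in> arr \<C> A (H m). u = d m \<circledcirc> v))"
    by (auto simp: Z_def B_def kernel_def)
  finally show ?thesis .
qed

lemma proper_coresolution_cosyzygies:
  assumes "proper_coresolution \<C> \<xi> (GInj \<C> \<xi>) N \<epsilon> H d" "N \<in> cosyzygy_class m"
    and "L 0 = N" "\<And>i. (L i, g i, H i, f i, L (Suc i), \<delta> i) \<in> \<xi>"
    and "\<And>i. \<forall>W \<in> GInj \<C> \<xi>. exact_into \<C> W (L i, g i, H i, f i, L (Suc i), \<delta> i)"
  shows "L k \<in> cosyzygy_class (m - k)"
proof (induction k)
  case 0
  then show ?case using assms by simp
next
  case (Suc k)
  have H: "H k \<in> GInj \<C> \<xi>" using assms(1) by (simp add: proper_coresolution_def)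
  \<comment> \<open>Subtraction is truncated: for \<open>k < m\<close> the two indices agree,
    afterwards the class is enlarged from \<open>0\<close> to \<open>1\<close> before the next
    cosyzygy is taken.\<close>
  have "L k \<in> cosyzygy_class (Suc (m - Suc k))"
    using Suc cosyzygy_class_mono[of "m - k" "Suc (m - Suc k)"] by simp
  then show ?case using assms(4) H assms(5) by (rule cosyzygy_class_proper_cosyzygy)
qed

text \<open>\<open>L\<close> is itself an admissible test object, so its identity extends over
  \<open>g\<close>.\<close>

lemma GInj_proper_split:
  assumes T: "(L, g, H, f, L', \<delta>) \<in> \<xi>" and L: "L \<in> GInj \<C> \<xi>"
    and ex: "\<forall>W \<in> GInj \<C> \<xi>. exact_into \<C> W (L, g, H, f, L', \<delta>)"
  obtains r where "r \<in> arr \<C> H L" "r \<circledcirc> g = idm \<C> L" "\<delta> = \<one>\<^bsub>\<EE> \<C> L' L\<^esub>"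
proof -
  have "(\<lambda>u. u \<circledcirc> g) ` arr \<C> H L = arr \<C> L L"
    using bspec[OF ex L] by (auto simp: short_exact_sequence_iff epi_def)
  then have "idm \<C> L \<in> (\<lambda>u. u \<circledcirc> g) ` arr \<C> H L" using idm_closed by blast
  then obtain r where r: "r \<in> arr \<C> H L" "r \<circledcirc> g = idm \<C> L" by force
  have "push \<C> L' (r \<circledcirc> g) \<delta> = \<one>\<^bsub>\<EE> \<C> L' L\<^esub>"
    using T[THEN xi_Etriangles] r(1) by (rule push_cmp_inflation)
  then show ?thesis using that[OF r] r(2) EtrianglesD(3)[OF T[THEN xi_Etriangles]] by simp
qed

lemma GInj_dimension_cohomology:
  assumes N: "N \<in> finite_Gid \<C> \<xi>" and C: "proper_coresolution \<C> \<xi> (GInj \<C> \<xi>) N \<epsilon> H d"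
  shows "N \<in> cosyzygy_class n \<Longrightarrow> n < m \<Longrightarrow> trivial_group (hom_cohomology \<C> M H d m)"
    and "(\<And>m I. \<lbrakk>n < m; I \<in> Inj \<C> \<xi>\<rbrakk> \<Longrightarrow> trivial_group (hom_cohomology \<C> I H d m))
      \<Longrightarrow> N \<in> cosyzygy_class n"
proof -
  have H: "H i \<in> GInj \<C> \<xi>" for i using C by (simp add: proper_coresolution_def)
  obtain L g f \<delta> where L0: "L 0 = N"
    and T: "\<And>i. (L i, g i, H i, f i, L (Suc i), \<delta> i) \<in> \<xi>"
    and ex: "\<And>i. \<forall>W \<in> GInj \<C> \<xi>. exact_into \<C> W (L i, g i, H i, f i, L (Suc i), \<delta> i)"
    and d: "\<And>i. d i = g (Suc i) \<circledcirc> f i"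
    using C unfolding proper_coresolution_def by blast
  note t = T[THEN xi_Etriangles]
  have g: "g i \<in> arr \<C> (L i) (H i)" and f: "f i \<in> arr \<C> (H i) (L (Suc i))" for i
    using EtrianglesD[OF t] by blast+
  have dc: "d i \<in> arr \<C> (H i) (H (Suc i))" for i unfolding d using f g by (rule cmp_closed)
  have du: "d i \<circledcirc> u = g (Suc i) \<circledcirc> (f i \<circledcirc> u)" if "u \<in> arr \<C> M (H i)" for i u M
    unfolding d using cmp_assoc[OF that f g] .
  have dd: "d (Suc i) \<circledcirc> d i = zero_arr \<C> (H i) (H (Suc (Suc i)))" for i
  proof -
    have "f (Suc i) \<circledcirc> d i = zero_arr \<C> (H i) (L (Suc (Suc i)))"
      unfolding d using cmp_assoc[OF f[of i] g f] Etriangles_comp_zero[OF t] f[of i] by simp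
    then show ?thesis using du[OF dc[of i]] g by simp
  qed
  \<comment> \<open>Inflations need not be monic in an extriangulated category; \<open>g i\<close>
    is a split monomorphism once \<open>L i\<close> is Gorenstein injective.\<close>
  have cancel: "u = v" if G: "L i \<in> GInj \<C> \<xi>" and u: "u \<in> arr \<C> M (L i)" and v: "v \<in> arr \<C> M (L i)"
    and uv: "g i \<circledcirc> u = g i \<circledcirc> v" for i u v M
  proof -
    obtain r where r: "r \<in> arr \<C> (H i) (L i)" "r \<circledcirc> g i = idm \<C> (L i)"
      using T G ex by (rule GInj_proper_split)
    show ?thesis
      using cmp_assoc[OF u g r(1)] cmp_assoc[OF v g r(1)] uv r(2) u v by (simp add: cmp_idm_left)
  qed
  have syz: "L k \<in> GInj \<C> \<xi>" if "N \<in> cosyzygy_class m" "m \<le> k" for m k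
    using proper_coresolution_cosyzygies[OF C that(1) L0 T ex, of k] that(2) by simp
  show "trivial_group (hom_cohomology \<C> M H d m)" if n: "N \<in> cosyzygy_class n" "n < m"
  proof -
    obtain k where k: "m = Suc k" "n \<le> k" using n(2) by (cases m) auto
    \<comment> \<open>\<open>L (Suc (Suc k))\<close> allows \<open>g\<close> to be cancelled from
      the cocycle condition; \<open>L k\<close> splits the triangle along which the resulting map
      lifts.\<close>
    have G: "L k \<in> GInj \<C> \<xi>" "L (Suc (Suc k)) \<in> GInj \<C> \<xi>" using syz[OF n(1)] k(2) by simp_all
    have "\<exists>v \<in> arr \<C> M (H k). u = d k \<circledcirc> v"
      if u: "u \<in> arr \<C> M (H (Suc k))" "d (Suc k) \<circledcirc> u = zero_arr \<C> M (H (Suc (Suc k)))" for u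
    proof -
      have "f (Suc k) \<circledcirc> u = zero_arr \<C> M (L (Suc (Suc k)))"
        using du[OF u(1)] u(2) cmp_zero_right[OF g]
        by (intro cancel[OF G(2) cmp_closed[OF u(1) f] zero_closed]) simp
      with t u(1) obtain v where v: "v \<in> arr \<C> M (L (Suc k))" "u = g (Suc k) \<circledcirc> v" by (rule lift_zero)
      have \<delta>: "\<delta> k = \<one>\<^bsub>\<EE> \<C> (L (Suc k)) (L k)\<^esub>" using T G(1) ex by (rule GInj_proper_split)
      obtain w where w: "w \<in> arr \<C> M (H k)" "f k \<circledcirc> w = v"
        by (rule lift_pull[OF t v(1)]) (use \<delta> pull_one[OF v(1)] in auto)
      then show ?thesis using du[OF w(1)] v(2) by (intro bexI[OF _ w(1)]) simp
    qed
    then show ?thesis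
      unfolding k(1) trivial_hom_cohomology_Suc[of d k H, OF dc dc dd] by (intro ballI impI)
  qed
  show "N \<in> cosyzygy_class n"
    if triv: "\<And>m I. \<lbrakk>n < m; I \<in> Inj \<C> \<xi>\<rbrakk> \<Longrightarrow> trivial_group (hom_cohomology \<C> I H d m)"
  proof -
    obtain m where m: "N \<in> cosyzygy_class m" using N by (rule finite_Gid_cosyzygy_class)
    have down: "L k \<in> GInj \<C> \<xi>" if k: "n \<le> k" and G: "L (Suc k) \<in> GInj \<C> \<xi>" for k
    proof (rule GInj_kernel[OF T H G])
      fix I c assume I: "I \<in> Inj \<C> \<xi>" and c: "c \<in> arr \<C> I (L (Suc k))"
      \<comment> \<open>Composing \<open>c\<close> with \<open>g (Suc k)\<close> gives a cocycle. It
        is a coboundary \<open>d k \<circledcirc> v\<close> by hypothesis, and cancelling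
        \<open>g (Suc k)\<close> shows that \<open>v\<close> lifts \<open>c\<close>.\<close>
      have gc: "g (Suc k) \<circledcirc> c \<in> arr \<C> I (H (Suc k))" using c g by (rule cmp_closed)
      have "f (Suc k) \<circledcirc> (g (Suc k) \<circledcirc> c) = zero_arr \<C> I (L (Suc (Suc k)))"
        using cmp_assoc[OF c g f] Etriangles_comp_zero[OF t] c by simp
      then have "d (Suc k) \<circledcirc> (g (Suc k) \<circledcirc> c) = zero_arr \<C> I (H (Suc (Suc k)))"
        using du[OF gc] g by simp
      moreover have "trivial_group (hom_cohomology \<C> I H d (Suc k))" using k I by (intro triv) simp_all
      note bspec[OF this[unfolded trivial_hom_cohomology_Suc[of d k H, OF dc dc dd]] gc]
      ultimately obtain v where v: "v \<in> arr \<C> I (H k)" "g (Suc k) \<circledcirc> c = d k \<circledcirc> v" by blast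
      have "f k \<circledcirc> v = c"
        using du[OF v(1)] v(2) by (intro cancel[OF G cmp_closed[OF v(1) f] c]) simp
      then show "\<exists>u \<in> arr \<C> I (H k). f k \<circledcirc> u = c" using v(1) by blast
    qed
    \<comment> \<open>By finite dimension \<open>L (n + m)\<close> is Gorenstein injective;
      \<open>down\<close> descends from there to \<open>L n\<close>.\<close>
    have "L (n + j) \<in> GInj \<C> \<xi> \<Longrightarrow> L n \<in> GInj \<C> \<xi>" for j
    proof (induction j)
      case (Suc j)
      then show ?case using down[of "n + j"] by simp
    qed simp
    then have Ln: "L n \<in> GInj \<C> \<xi>" using syz[OF m, of "n + m"] by simp
    \<comment> \<open>Starting from \<open>L n\<close>, the first \<open>n\<close> triangles of the
      coresolution are added one by one; \<open>j = n\<close> reaches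
      \<open>L 0 = N\<close>.\<close>
    have "L (n - j) \<in> cosyzygy_class j" if "j \<le> n" for j
      using that
    proof (induction j)
      case (Suc j)
      then have "L (Suc (n - Suc j)) \<in> cosyzygy_class j" by (simp add: Suc_diff_Suc)
      then show ?case by (rule cosyzygy_class_SucI[OF T H])
    qed (use Ln in simp)
    from this[of n] show ?thesis using L0 by simp
  qed
qed

end

theorem proposition3p27:
  fixes \<C> :: "('o, 'm, 'e) extri_data"
    and \<xi> :: "('o, 'm, 'e) triangle set"
    and n :: nat
    and N :: 'o
  assumes "extriangulated_category \<C>"
    and "WIC \<C>"
    and "proper_class \<C> \<xi>"
    and "enough_projectives \<C> \<xi>"
    and "enough_injectives \<C> \<xi>"
    and "(SUP M. Gpd \<C> \<xi> M) < \<infinity>"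
    and "N \<in> Res_GInj \<C> \<xi> \<inter> finite_Gid \<C> \<xi>"
  shows "(Gid \<C> \<xi> N \<le> ereal (real n)
            \<longleftrightarrow> (\<forall>i\<ge>1. \<forall>M. trivial_group (xixt_GInj \<C> \<xi> (n + i) M N)))
       \<and> (Gid \<C> \<xi> N \<le> ereal (real n)
            \<longleftrightarrow> (\<forall>i\<ge>1. \<forall>I \<in> Inj \<C> \<xi>. trivial_group (xixt_GInj \<C> \<xi> (n + i) I N)))"
proof -
  interpret proper_class \<C> \<xi> by fact
  obtain H d where Hd: "chosen_coresolution \<C> \<xi> N = (H, d)" by fastforce
  have "\<exists>p. case p of (H, d) \<Rightarrow> \<exists>\<epsilon>. proper_coresolution \<C> \<xi> (GInj \<C> \<xi>) N \<epsilon> H d"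
    using assms(7) by (auto simp: Res_GInj_def)
  \<comment> \<open>Since \<open>N\<close> has a proper coresolution, the pair selected by
    \<open>SOME\<close> is one.\<close>
  from someI_ex[OF this] obtain \<epsilon> where C: "proper_coresolution \<C> \<xi> (GInj \<C> \<xi>) N \<epsilon> H d"
    using Hd unfolding chosen_coresolution_def by auto
  have N: "N \<in> finite_Gid \<C> \<xi>" using assms(7) by blast
  have x: "xixt_GInj \<C> \<xi> m M N = hom_cohomology \<C> M H d m" for m M
    by (simp add: xixt_GInj_def Hd)
  have 12: "\<forall>i\<ge>1. \<forall>M. trivial_group (xixt_GInj \<C> \<xi> (n + i) M N)" if "Gid \<C> \<xi> N \<le> ereal (real n)"
    using GInj_dimension_cohomology(1)[OF N C] that by (auto simp: Gid_le_nat_iff x)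
  have 31: "Gid \<C> \<xi> N \<le> ereal (real n)"
    if triv: "\<forall>i\<ge>1. \<forall>I \<in> Inj \<C> \<xi>. trivial_group (xixt_GInj \<C> \<xi> (n + i) I N)"
    unfolding Gid_le_nat_iff
  proof (rule GInj_dimension_cohomology(2)[OF N C])
    fix m I assume "n < m" "I \<in> Inj \<C> \<xi>"
    then show "trivial_group (hom_cohomology \<C> I H d m)"
      using triv[rule_format, of "m - n" I] by (simp add: x)
  qed
  \<comment> \<open>Condition (3) is the restriction of (2) to injective objects, which closes the
    cycle.\<close>
  from 12 31 show ?thesis by blast
qed

end
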